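(* Let $A=\bigoplus_{r\in\mathbb Q}A_rX^r$ be a graded extension of $V$ in $K[\mathbb Q,\sigma]$. Then the following are equivalent: (1) $A$ is a graded extension of Type (I). (2) $A$ is a graded extension of Type (a), Type (b), Type (c), Type (d), Type (f) or Type (g).
   Context: $K$ is a division ring and $V$ is a total valuation ring of $K$ (a subring such that for every nonzero $k\in K$, $k\in V$ or $k^{-1}\in V$), with $V\neq K$. $\sigma:\mathbb Q\to \mathrm{Aut}(K)$ is a homomorphism from the additive group $\mathbb Q$. For $a\in K$, $I\subseteq K$, $g\in\mathbb Q$ write $a^{\sigma(g)}=\sigma(g)(a)$, $I^{\sigma(g)}=\sigma(g)(I)$. For a nonzero subgroup $G\subseteq\mathbb Q$, $K[G,\sigma]=\bigoplus_{g\in G}KX^g$ is the skew group ring, with $X^ga=a^{\sigma(g)}X^g$ and $X^gX^h=X^{g+h}$. A graded subring $A=\bigoplus_{g\in G}A_gX^g$ of $K[G,\sigma]$ is a graded total valuation ring if for every nonzero homogeneous element $aX^g$, $aX^g\in A$ or $(aX^g)^{-1}\in A$; it is a graded extension of $V$ in $K[G,\sigma]$ if moreover $A_0=V$. For $g>0$ in $\mathbb Q$, $K[X^g,X^{-g};\sigma(g)]$ denotes $K[\mathbb Zg,\sigma|_{\mathbb Zg}]$. Products of additive subgroups of $K$ are the additive subgroups generated by products of elements; $\subset,\supset$ denote proper inclusion; $\mathbb N=\{1,2,\dots\}$; $J(\cdot)$ denotes the Jacobson radical; $O_l(I)=\{a\in K\mid aI\subseteq I\}$. For a left $V$-ideal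 $I$ of $K$, ${}^*I=\bigcap\{Uc\mid I\subseteq Uc,\ c\in K\}$, where $U=O_l(I)$. A graded extension $A=\bigoplus_{g\in G}A_gX^g$ of $V$ in $K[G,\sigma]$ is of Type (I) if for all $g,h\in G$ with $g,h>0$: $A_gA_h^{\sigma(g)}=A_{g+h}$ and $A_{-g}(A_{-h})^{\sigma(-g)}=A_{-g-h}$. Types over $K[X^g,X^{-g};\sigma(g)]$: let $g>0$, let $\bigoplus_{i\in\mathbb Z}A_{ig}X^{ig}$ be a graded extension of $V$ in $K[X^g,X^{-g};\sigma(g)]$, put $W=O_l(A_g)$ and $M_{ig}=A_gA_g^{\sigma(g)}\cdots A_g^{\sigma((i-1)g)}$ for $i\in\mathbb N$. It is of Type (a) if $A_g=Va=aV^{\sigma(g)}$ and $A_{-g}=V(a^{-1})^{\sigma(-g)}$ for some $a\in K$; Type (b) if $A_g=Wa\supset aW^{\sigma(g)}$ for some $a\in K$; Type (c) if $A_g=Wa\subset aW^{\sigma(g)}$ for some $a\in K$; Type (d) if $A_g=Wa=aW^{\sigma(g)}$, $A_{-g}=J(W)(a^{-1})^{\sigma(-g)}$ for some $a\in K$ and $J(W)^2=J(W)$; Type (f) if ${}^*A_g\supset A_g$; Type (g) if ${}^*A_g=A_g$ and ${}^*M_{ig}$ is not a principal left $W$-ideal for any $i\in\mathbb N$. Types over $K[\mathbb Q,\sigma]$: let $A=\bigoplus_{r\in\mathbb Q}A_rX^r$ be a graded extension of $V$ in $K[\mathbb Q,\sigma]$ and for $r>0$ let $H_r=\bigoplus_{i\in\mathbb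 Z}A_{ir}X^{ir}$. For each letter x among a, b, c, d, f, g: $A$ is of Type (x) if for every rational $r>0$, $H_r$ is a graded extension of $V$ of Type (x) in $K[X^r,X^{-r};\sigma(r)]$. *)

theory Defs
  imports
    "HOL-Library.Poly_Mapping"
    "HOL-Computational_Algebra.Group_Closure"
    "HOL-Algebra.Subrings"
begin

section \<open>Subsets of a division ring\<close>

text \<open>The division ring \<open>K\<close> is a type of class \<open>division_ring\<close> (multiplication is not
  assumed commutative); its subrings, additive subgroups and ideals are sets.\<close>

definition add_subgroup :: "'a::division_ring set \<Rightarrow> bool" where
  "add_subgroup I \<longleftrightarrow> 0 \<in> I \<and> (\<forall>a\<in>I. \<forall>b\<in>I. a - b \<in> I)"

definition total_valuation_ring :: "'a::division_ring set \<Rightarrow> bool" where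
  "total_valuation_ring V \<longleftrightarrow>
     add_subgroup V \<and> 1 \<in> V \<and> (\<forall>a\<in>V. \<forall>b\<in>V. a * b \<in> V) \<and>
     (\<forall>k. k \<noteq> 0 \<longrightarrow> k \<in> V \<or> inverse k \<in> V)"

definition set_prod :: "'a::division_ring set \<Rightarrow> 'a set \<Rightarrow> 'a set" (infixl \<open>\<odot>\<close> 70) where
  "I \<odot> J = group_closure {a * b | a b. a \<in> I \<and> b \<in> J}"

definition set_right :: "'a::division_ring set \<Rightarrow> 'a \<Rightarrow> 'a set" (infixl \<open>\<bullet>>\<close> 75) where
  "U \<bullet>> c = {u * c | u. u \<in> U}"

definition set_left :: "'a::division_ring \<Rightarrow> 'a set \<Rightarrow> 'a set" (infixl \<open><\<bullet>\<close> 75) where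
  "c <\<bullet> U = {c * u | u. u \<in> U}"

definition O_l :: "'a::division_ring set \<Rightarrow> 'a set" where
  "O_l I = {a. a <\<bullet> I \<subseteq> I}"

definition star :: "'a::division_ring set \<Rightarrow> 'a set" where
  "star I = \<Inter> {O_l I \<bullet>> c | c. I \<subseteq> O_l I \<bullet>> c}"

text \<open>As usual, left \<open>W\<close>-ideals of \<open>K\<close> are nonzero, so a principal one has a nonzero
  generator.\<close>

definition principal_left_ideal :: "'a::division_ring set \<Rightarrow> 'a set \<Rightarrow> bool" where
  "principal_left_ideal W I \<longleftrightarrow> (\<exists>c. c \<noteq> 0 \<and> I = W \<bullet>> c)"

definition left_ideal_of :: "'a::division_ring set \<Rightarrow> 'a set \<Rightarrow> bool" where
  "left_ideal_of W L \<longleftrightarrow> L \<subseteq> W \<and> add_subgroup L \<and> (\<forall>w\<in>W. \<forall>x\<in>L. w * x \<in> L)"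

definition maximal_left_ideal_of :: "'a::division_ring set \<Rightarrow> 'a set \<Rightarrow> bool" where
  "maximal_left_ideal_of W M \<longleftrightarrow>
     left_ideal_of W M \<and> M \<noteq> W \<and>
     (\<forall>L. left_ideal_of W L \<longrightarrow> M \<subseteq> L \<longrightarrow> L = M \<or> L = W)"

definition jacobson_radical :: "'a::division_ring set \<Rightarrow> 'a set" where
  "jacobson_radical W = W \<inter> \<Inter> {M. maximal_left_ideal_of W M}"

section \<open>Skew group rings over subgroups of the rationals\<close>

definition ring_automorphism :: "('a::division_ring \<Rightarrow> 'a) \<Rightarrow> bool" where
  "ring_automorphism f \<longleftrightarrow>
     bij f \<and> f 1 = 1 \<and> (\<forall>a b. f (a + b) = f a + f b) \<and> (\<forall>a b. f (a * b) = f a * f b)"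

definition aut_action :: "(rat \<Rightarrow> 'a::division_ring \<Rightarrow> 'a) \<Rightarrow> bool" where
  "aut_action \<sigma> \<longleftrightarrow>
     (\<forall>g. ring_automorphism (\<sigma> g)) \<and> (\<forall>g h. \<sigma> (g + h) = \<sigma> g \<circ> \<sigma> h)"

text \<open>The monomial \<open>a X\<^sup>g\<close> is represented by \<open>Poly_Mapping.single g a\<close>.\<close>

definition skew_mult ::
  "(rat \<Rightarrow> 'a::division_ring \<Rightarrow> 'a) \<Rightarrow> (rat \<Rightarrow>\<^sub>0 'a) \<Rightarrow> (rat \<Rightarrow>\<^sub>0 'a) \<Rightarrow> (rat \<Rightarrow>\<^sub>0 'a)" where
  "skew_mult \<sigma> p q =
     (\<Sum>g\<in>Poly_Mapping.keys p. \<Sum>h\<in>Poly_Mapping.keys q.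
        Poly_Mapping.single (g + h)
          (Poly_Mapping.lookup p g * \<sigma> g (Poly_Mapping.lookup q h)))"

definition skew_group_ring ::
  "rat set \<Rightarrow> (rat \<Rightarrow> 'a::division_ring \<Rightarrow> 'a) \<Rightarrow> (rat \<Rightarrow>\<^sub>0 'a) ring" where
  "skew_group_ring G \<sigma> =
     \<lparr>carrier = {p. Poly_Mapping.keys p \<subseteq> G}, mult = skew_mult \<sigma>, one = Poly_Mapping.single 0 1,
      zero = 0, add = (+)\<rparr>"

text \<open>A family \<open>A\<close> of subsets of \<open>K\<close> stands for the direct sum of the \<open>A\<^sub>g X\<^sup>g\<close> with
  \<open>g \<in> G\<close>; the values of \<open>A\<close> outside \<open>G\<close> are irrelevant. In particular the same family over
  a subgroup of \<open>G\<close> gives the corresponding partial sum.\<close>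

definition graded_sum :: "rat set \<Rightarrow> (rat \<Rightarrow> 'a::division_ring set) \<Rightarrow> (rat \<Rightarrow>\<^sub>0 'a) set" where
  "graded_sum G A =
     {p. Poly_Mapping.keys p \<subseteq> G \<and> (\<forall>g\<in>G. Poly_Mapping.lookup p g \<in> A g)}"

definition graded_subring ::
  "rat set \<Rightarrow> (rat \<Rightarrow> 'a::division_ring \<Rightarrow> 'a) \<Rightarrow> (rat \<Rightarrow> 'a set) \<Rightarrow> bool" where
  "graded_subring G \<sigma> A \<longleftrightarrow>
     (\<forall>g\<in>G. add_subgroup (A g)) \<and> subring (graded_sum G A) (skew_group_ring G \<sigma>)"

definition graded_total_valuation_ring ::
  "rat set \<Rightarrow> (rat \<Rightarrow> 'a::division_ring \<Rightarrow> 'a) \<Rightarrow> (rat \<Rightarrow> 'a set) \<Rightarrow> bool" where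
  "graded_total_valuation_ring G \<sigma> A \<longleftrightarrow>
     graded_subring G \<sigma> A \<and>
     (\<forall>g\<in>G. \<forall>a. a \<noteq> 0 \<longrightarrow>
        Poly_Mapping.single g a \<in> graded_sum G A \<or>
        inv\<^bsub>skew_group_ring G \<sigma>\<^esub> (Poly_Mapping.single g a) \<in> graded_sum G A)"

definition graded_extension ::
  "'a::division_ring set \<Rightarrow> rat set \<Rightarrow> (rat \<Rightarrow> 'a \<Rightarrow> 'a) \<Rightarrow> (rat \<Rightarrow> 'a set) \<Rightarrow> bool" where
  "graded_extension V G \<sigma> A \<longleftrightarrow> graded_total_valuation_ring G \<sigma> A \<and> A 0 = V"

section \<open>Types of graded extensions\<close>

definition type_I ::
  "'a::division_ring set \<Rightarrow> rat set \<Rightarrow> (rat \<Rightarrow> 'a \<Rightarrow> 'a) \<Rightarrow> (rat \<Rightarrow> 'a set) \<Rightarrow> bool" where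
  "type_I V G \<sigma> A \<longleftrightarrow>
     graded_extension V G \<sigma> A \<and>
     (\<forall>g\<in>G. \<forall>h\<in>G. g > 0 \<longrightarrow> h > 0 \<longrightarrow>
        A g \<odot> \<sigma> g ` A h = A (g + h) \<and>
        A (- g) \<odot> \<sigma> (- g) ` A (- h) = A (- g - h))"

text \<open>The infinite cyclic group generated by \<open>g\<close>.\<close>

definition multiples :: "rat \<Rightarrow> rat set" where
  "multiples g = range (\<lambda>i::int. of_int i * g)"

text \<open>\<open>iter_prod \<sigma> A g i\<close> is the product of the \<open>i\<close> factors \<open>\<sigma> (j g) ` A g\<close>, \<open>j < i\<close>; it is
  only used for \<open>i \<ge> 1\<close>.\<close>

fun iter_prod ::
  "(rat \<Rightarrow> 'a::division_ring \<Rightarrow> 'a) \<Rightarrow> (rat \<Rightarrow> 'a set) \<Rightarrow> rat \<Rightarrow> nat \<Rightarrow> 'a set" where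
  "iter_prod \<sigma> A g 0 = undefined"
| "iter_prod \<sigma> A g (Suc 0) = A g"
| "iter_prod \<sigma> A g (Suc (Suc i)) =
     iter_prod \<sigma> A g (Suc i) \<odot> \<sigma> (of_nat (Suc i) * g) ` A g"

text \<open>The following predicates concern the part of \<open>A\<close> supported on \<open>multiples g\<close>, as a
  graded extension of \<open>V\<close> in the skew group ring over that cyclic group.\<close>

definition type_a ::
  "'a::division_ring set \<Rightarrow> (rat \<Rightarrow> 'a \<Rightarrow> 'a) \<Rightarrow> (rat \<Rightarrow> 'a set) \<Rightarrow> rat \<Rightarrow> bool" where
  "type_a V \<sigma> A g \<longleftrightarrow>
     graded_extension V (multiples g) \<sigma> A \<and>
     (\<exists>a. a \<noteq> 0 \<and> A g = V \<bullet>> a \<and> V \<bullet>> a = a <\<bullet> (\<sigma> g ` V) \<and>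
          A (- g) = V \<bullet>> \<sigma> (- g) (inverse a))"

definition type_b ::
  "'a::division_ring set \<Rightarrow> (rat \<Rightarrow> 'a \<Rightarrow> 'a) \<Rightarrow> (rat \<Rightarrow> 'a set) \<Rightarrow> rat \<Rightarrow> bool" where
  "type_b V \<sigma> A g \<longleftrightarrow>
     graded_extension V (multiples g) \<sigma> A \<and>
     (let W = O_l (A g) in \<exists>a. A g = W \<bullet>> a \<and> a <\<bullet> (\<sigma> g ` W) \<subset> W \<bullet>> a)"

definition type_c ::
  "'a::division_ring set \<Rightarrow> (rat \<Rightarrow> 'a \<Rightarrow> 'a) \<Rightarrow> (rat \<Rightarrow> 'a set) \<Rightarrow> rat \<Rightarrow> bool" where
  "type_c V \<sigma> A g \<longleftrightarrow>
     graded_extension V (multiples g) \<sigma> A \<and>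
     (let W = O_l (A g) in \<exists>a. A g = W \<bullet>> a \<and> W \<bullet>> a \<subset> a <\<bullet> (\<sigma> g ` W))"

definition type_d ::
  "'a::division_ring set \<Rightarrow> (rat \<Rightarrow> 'a \<Rightarrow> 'a) \<Rightarrow> (rat \<Rightarrow> 'a set) \<Rightarrow> rat \<Rightarrow> bool" where
  "type_d V \<sigma> A g \<longleftrightarrow>
     graded_extension V (multiples g) \<sigma> A \<and>
     (let W = O_l (A g); J = jacobson_radical W in
        (\<exists>a. a \<noteq> 0 \<and> A g = W \<bullet>> a \<and> W \<bullet>> a = a <\<bullet> (\<sigma> g ` W) \<and>
             A (- g) = J \<bullet>> \<sigma> (- g) (inverse a)) \<and>
        J \<odot> J = J)"

definition type_f ::
  "'a::division_ring set \<Rightarrow> (rat \<Rightarrow> 'a \<Rightarrow> 'a) \<Rightarrow> (rat \<Rightarrow> 'a set) \<Rightarrow> rat \<Rightarrow> bool" where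
  "type_f V \<sigma> A g \<longleftrightarrow>
     graded_extension V (multiples g) \<sigma> A \<and> A g \<subset> star (A g)"

definition type_g ::
  "'a::division_ring set \<Rightarrow> (rat \<Rightarrow> 'a \<Rightarrow> 'a) \<Rightarrow> (rat \<Rightarrow> 'a set) \<Rightarrow> rat \<Rightarrow> bool" where
  "type_g V \<sigma> A g \<longleftrightarrow>
     graded_extension V (multiples g) \<sigma> A \<and>
     star (A g) = A g \<and>
     (\<forall>i\<ge>1. \<not> principal_left_ideal (O_l (A g)) (star (iter_prod \<sigma> A g i)))"

text \<open>Over the full group of rationals: \<open>A\<close> has one of the above types if all its cyclic parts
  have it.\<close>

definition type_Q ::
  "('a::division_ring set \<Rightarrow> (rat \<Rightarrow> 'a \<Rightarrow> 'a) \<Rightarrow> (rat \<Rightarrow> 'a set) \<Rightarrow> rat \<Rightarrow> bool) \<Rightarrow>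
   'a set \<Rightarrow> (rat \<Rightarrow> 'a \<Rightarrow> 'a) \<Rightarrow> (rat \<Rightarrow> 'a set) \<Rightarrow> bool" where
  "type_Q T V \<sigma> A \<longleftrightarrow> graded_extension V UNIV \<sigma> A \<and> (\<forall>r>0. T V \<sigma> A r)"

end

theory Submission
  imports Defs
begin

text \<open>
  Addition can be eliminated from the problem. The nonzero homogeneous elements \<open>a X\<^sup>g\<close> form a
  group \<open>\<Gamma>\<close> with a degree map to the rationals, and the nonzero homogeneous elements of the
  graded extension form a submonoid \<open>P\<close> with \<open>\<Gamma> = P \<union> P\<^sup>-\<^sup>1\<close>. Finitely many elements of a left
  \<open>V\<close>-module generate the same module as one of them, because \<open>V\<close> is a total valuation ring; hence
  the product of two components is just the set of products of their elements
  (\<open>hset_set_prod\<close>). Left orders, radicals, \<open>star\<close> and all the types thereby become statements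
  about \<open>P\<close>, and the theorem is proved for such cones in \<open>cone_I_iff\<close>. Below, \<open>A\<^sub>q\<close> denotes the
  part of \<open>P\<close> of degree \<open>q\<close>, \<open>W\<close> the left order of \<open>A\<^sub>r\<close>, and \<open>J\<close> the radical of \<open>W\<close>.

  The engine is \<open>product_defect\<close>: if \<open>z\<close> lies in \<open>A\<^sub>p\<^sub>+\<^sub>q\<close> but not in \<open>A\<^sub>p A\<^sub>q\<close>, then
  \<open>A\<^sub>q = A\<^sub>-\<^sub>p z\<close> and \<open>A\<^sub>p = z A\<^sub>-\<^sub>q\<close>. So Type (I) can only fail if a component is a translate
  of a component of a different kind.

  From the types to Type (I). If \<open>A\<^sub>r = W x\<close> and \<open>A\<^sub>-\<^sub>r = x\<^sup>-\<^sup>1 J\<close> with \<open>x W x\<^sup>-\<^sup>1 \<subseteq> W\<close>, a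
  failure would make \<open>J\<close> a translate of a conjugate of \<open>W\<close>; comparing orders, this conjugate is \<open>W\<close>
  itself and \<open>J\<close> is a principal ideal. That is impossible if the inclusion is proper or if
  \<open>J = J\<^sup>2\<close> (\<open>left_principal_step\<close>). This covers Types (b) and (d); Type (c) is Type (b) in the
  opposite group, and Type (f) is the same situation with \<open>r\<close> replaced by \<open>-r\<close>. Type (a) is
  immediate, as there \<open>A\<^sub>r\<close> contains a unit. In Type (g) a nonzero \<open>A\<^sub>r\<close> satisfies
  \<open>A\<^sub>r A\<^sub>-\<^sub>r = J\<close>, so that a failure gives a power of \<open>A\<^sub>r\<close> of the form \<open>J z\<close>, whose star closure is
  principal.

  From Type (I) to the types. Each single \<open>r\<close> has one of the types (\<open>types_exhaustive\<close>). The two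
  configurations to be excluded are a principal \<open>A\<^sub>r = W x = x W\<close> with \<open>J \<noteq> J\<^sup>2\<close>, and a star closed
  nonprincipal \<open>A\<^sub>r\<close> one of whose powers has principal star closure; in the
  former \<open>A\<^sub>-\<^sub>r A\<^sub>-\<^sub>r\<close> is too small to be \<open>A\<^sub>-\<^sub>2\<^sub>r\<close>, in the latter a higher power
  of \<open>A\<^sub>-\<^sub>r\<close> is too small. Finally every type passes from \<open>s\<close> to the multiples
  \<open>n s\<close>. Divisibility of the rationals makes the type uniform: if each type failed at some degree, take a common divisor \<open>s\<close> of these finitely many degrees; the
  type at \<open>s\<close> would then also hold where it fails.
\<close>

section \<open>Common divisors of rationals\<close>

lemma common_divisor:
  fixes F :: "rat set"
  assumes "finite F" "\<And>q. q \<in> F \<Longrightarrow> 0 < q"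
  shows "\<exists>s>0. \<forall>q\<in>F. \<exists>n\<ge>1. q = of_nat n * s"
  using assms
proof (induction F rule: finite_induct)
  case empty
  then show ?case by (auto intro: exI[of _ 1])
next
  case (insert q F)
  then obtain s where s: "0 < s" "\<forall>q\<in>F. \<exists>n\<ge>1. q = of_nat n * s" by auto
  have q: "0 < q / s" using insert.prems s(1) by simp
  obtain a b where ab: "quotient_of (q / s) = (a, b)" by (cases "quotient_of (q / s)")
  have b: "0 < b" using quotient_of_denom_pos[OF ab] .
  have qs: "q / s = of_int a / of_int b" using quotient_of_div[OF ab] .
  then have a: "0 < a" using q b by (simp add: zero_less_divide_iff)
  have nat: "of_nat (nat a) = (of_int a :: rat)" "of_nat (nat b) = (of_int b :: rat)" using a b by simp_all
  \<comment> \<open>With \<open>q / s = a / b\<close>, both \<open>s\<close> and \<open>q\<close> are multiples of \<open>s / b\<close>.\<close>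
  define t where "t = s / of_int b"
  have sb: "s = of_nat (nat b) * t" using b unfolding nat by (simp add: t_def)
  have qt: "q = of_nat (nat a) * t" using qs b s(1) unfolding nat by (simp add: t_def field_simps)
  have "\<exists>n\<ge>1. p = of_nat n * t" if p: "p \<in> insert q F" for p
  proof (cases "p = q")
    case True
    then show ?thesis using qt a by (intro exI[of _ "nat a"]) simp
  next
    case False
    then obtain n where "1 \<le> n" "p = of_nat n * s" using p s(2) by auto
    then show ?thesis using b by (intro exI[of _ "n * nat b"]) (auto simp: sb)
  qed
  moreover have "0 < t" using s(1) b by (simp add: t_def)
  ultimately show ?case by blast
qed

section \<open>Total cones in graded groups\<close>

text \<open>
  The intended instance has the nonzero homogeneous elements of a skew group ring as its group and
  those of a graded total valuation ring as \<open>P\<close>. There \<open>0\<close> is left out, so the zero component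
  becomes the empty set.
\<close>

locale graded_cone = gp: Groups.group mult e iv
  for mult :: "'g \<Rightarrow> 'g \<Rightarrow> 'g" (infixl \<open>\<cdot>\<close> 70) and e :: 'g and iv :: "'g \<Rightarrow> 'g" +
  fixes deg :: "'g \<Rightarrow> rat" and P :: "'g set"
  assumes deg_mult: "deg (x \<cdot> y) = deg x + deg y"
    and deg_surj: "\<exists>x. deg x = q"
    and P_mult: "x \<in> P \<Longrightarrow> y \<in> P \<Longrightarrow> x \<cdot> y \<in> P"
    and P_total: "x \<in> P \<or> iv x \<in> P"
begin

lemma cancel_simps [simp]:
  "iv x \<cdot> (x \<cdot> y) = y" "x \<cdot> (iv x \<cdot> y) = y" "e \<cdot> x = x" "x \<cdot> e = x"
  by (simp_all flip: gp.assoc add: gp.group_left_neutral)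

lemmas group_simps [simp] = gp.assoc gp.inverse_distrib_swap

lemma deg_simps [simp]: "deg (x \<cdot> y) = deg x + deg y" "deg e = 0" "deg (iv x) = - deg x"
proof -
  show "deg (x \<cdot> y) = deg x + deg y" for x y by (rule deg_mult)
  show *: "deg e = 0" using deg_mult[of e e] by simp
  show "deg (iv x) = - deg x" using deg_mult[of x "iv x"] * by simp
qed

text \<open>
  The axioms are left-right symmetric. Facts about right multiplication are read off from their
  left-handed versions in the opposite group.
\<close>

lemma opposite: "graded_cone (\<lambda>x y. y \<cdot> x) e iv deg P"
  by unfold_locales (auto simp: deg_surj P_total P_mult)

definition A :: "rat \<Rightarrow> 'g set" where "A q = {x \<in> P. deg x = q}"

definition sprod :: "'g set \<Rightarrow> 'g set \<Rightarrow> 'g set" (infixl \<open>\<star>\<close> 70) where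
  "S \<star> T = {s \<cdot> t | s t. s \<in> S \<and> t \<in> T}"

definition OL :: "'g set \<Rightarrow> 'g set" where "OL S = {v. deg v = 0 \<and> (\<forall>s\<in>S. v \<cdot> s \<in> S)}"

text \<open>
  For the nonzero part \<open>W\<close> of a valuation ring these are the nonzero elements of its Jacobson
  radical.
\<close>

definition Jac :: "'g set \<Rightarrow> 'g set" where "Jac W = {w \<in> W. iv w \<notin> W}"

definition overring :: "'g set \<Rightarrow> bool" where
  "overring W \<longleftrightarrow> A 0 \<subseteq> W \<and> (\<forall>w\<in>W. deg w = 0) \<and> (\<forall>w\<in>W. \<forall>w'\<in>W. w \<cdot> w' \<in> W)"

text \<open>
  The first condition fixes the degree, which the second leaves open if no translate of the
  order contains \<open>S\<close>. It also makes the closure of the empty set empty, as befits the zero module.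
\<close>

definition star :: "'g set \<Rightarrow> 'g set" where
  "star S = {y. (\<exists>s\<in>S. deg y = deg s) \<and> (\<forall>x. S \<subseteq> OL S \<star> {x} \<longrightarrow> y \<in> OL S \<star> {x})}"

lemma sprodI: "s \<in> S \<Longrightarrow> t \<in> T \<Longrightarrow> s \<cdot> t \<in> S \<star> T"
  by (auto simp: sprod_def)

lemma sprodE: "x \<in> S \<star> T \<Longrightarrow> (\<And>s t. x = s \<cdot> t \<Longrightarrow> s \<in> S \<Longrightarrow> t \<in> T \<Longrightarrow> R) \<Longrightarrow> R"
  by (auto simp: sprod_def)

lemma sprod_mono: "S \<subseteq> S' \<Longrightarrow> T \<subseteq> T' \<Longrightarrow> S \<star> T \<subseteq> S' \<star> T'"
  by (auto simp: sprod_def)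

lemma sprod_assoc [simp]: "S \<star> T \<star> U = S \<star> (T \<star> U)"
proof (intro equalityI subsetI)
  fix x assume "x \<in> S \<star> T \<star> U"
  then obtain s t u where "x = s \<cdot> (t \<cdot> u)" "s \<in> S" "t \<in> T" "u \<in> U"
    by (auto elim!: sprodE)
  then show "x \<in> S \<star> (T \<star> U)" by (auto intro: sprodI simp del: group_simps)
next
  fix x assume "x \<in> S \<star> (T \<star> U)"
  then obtain s t u where "x = s \<cdot> t \<cdot> u" "s \<in> S" "t \<in> T" "u \<in> U"
    by (auto elim!: sprodE)
  then show "x \<in> S \<star> T \<star> U" by (auto intro: sprodI simp del: group_simps)
qed

lemma sprod_empty [simp]: "S \<star> {} = {}" "{} \<star> S = {}"
  by (auto simp: sprod_def)

lemma mem_translate [simp]: "y \<in> S \<star> {x} \<longleftrightarrow> y \<cdot> iv x \<in> S" "y \<in> {x} \<star> S \<longleftrightarrow> iv x \<cdot> y \<in> S"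
proof -
  show "y \<in> S \<star> {x} \<longleftrightarrow> y \<cdot> iv x \<in> S"
    using sprodI[of "y \<cdot> iv x" S x "{x}"] by (auto simp: sprod_def)
  show "y \<in> {x} \<star> S \<longleftrightarrow> iv x \<cdot> y \<in> S"
    using sprodI[of x "{x}" "iv x \<cdot> y" S] by (auto simp: sprod_def)
qed

lemma translate_simps [simp]:
  "{e} \<star> S = S" "S \<star> {e} = S" "{x} \<star> {y} = {x \<cdot> y}"
  "{x} \<star> ({y} \<star> S) = {x \<cdot> y} \<star> S"
  by (auto simp: sprod_def) 

lemma translate_inject [simp]: "S \<star> {x} = T \<star> {x} \<longleftrightarrow> S = T" "{x} \<star> S = {x} \<star> T \<longleftrightarrow> S = T"
  "S \<star> {x} \<subseteq> T \<star> {x} \<longleftrightarrow> S \<subseteq> T" "{x} \<star> S \<subseteq> {x} \<star> T \<longleftrightarrow> S \<subseteq> T"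
proof -
  show 1: "S \<star> {x} \<subseteq> T \<star> {x} \<longleftrightarrow> S \<subseteq> T" for S T
    using sprod_mono[of "S \<star> {x}" "T \<star> {x}" "{iv x}" "{iv x}"] sprod_mono[of S T "{x}" "{x}"] by auto
  show 2: "{x} \<star> S \<subseteq> {x} \<star> T \<longleftrightarrow> S \<subseteq> T" for S T
    using sprod_mono[of "{iv x}" "{iv x}" "{x} \<star> S" "{x} \<star> T"] sprod_mono[of "{x}" "{x}" S T] by auto
  show "S \<star> {x} = T \<star> {x} \<longleftrightarrow> S = T" "{x} \<star> S = {x} \<star> T \<longleftrightarrow> S = T"
    using 1[of S T] 1[of T S] 2[of S T] 2[of T S] by auto
qed

lemma translate_swap: "S \<star> {x} = T \<longleftrightarrow> S = T \<star> {iv x}" "{x} \<star> S = T \<longleftrightarrow> S = {iv x} \<star> T"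
  by auto

lemma e_in_P: "e \<in> P"
  using P_total[of e] by simp

lemma A_mult: "x \<in> A p \<Longrightarrow> y \<in> A q \<Longrightarrow> x \<cdot> y \<in> A (p + q)"
  by (auto simp: A_def P_mult)

lemma A_sprod: "A p \<star> A q \<subseteq> A (p + q)"
  by (auto simp: A_mult elim!: sprodE)

lemma A_total: "deg x = q \<Longrightarrow> x \<notin> A q \<Longrightarrow> iv x \<in> A (- q)"
  using P_total[of x] by (auto simp: A_def)

lemma A_deg: "x \<in> A q \<Longrightarrow> deg x = q"
  by (simp add: A_def)

lemma e_in_A: "e \<in> A 0"
  by (simp add: A_def e_in_P)

section \<open>Overrings of the degree zero part and their radicals\<close>

lemma overring_A0: "overring (A 0)"
  using A_mult[of _ 0 _ 0] by (auto simp: overring_def A_deg)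

lemma overring_e: "overring W \<Longrightarrow> e \<in> W"
  using e_in_A by (auto simp: overring_def)

lemma overring_mult: "overring W \<Longrightarrow> u \<in> W \<Longrightarrow> v \<in> W \<Longrightarrow> u \<cdot> v \<in> W"
  by (auto simp: overring_def)

lemma overring_deg: "overring W \<Longrightarrow> u \<in> W \<Longrightarrow> deg u = 0"
  by (auto simp: overring_def)

text \<open>
  Every degree zero element outside \<open>A 0\<close> has its inverse in \<open>A 0\<close>, hence in each overring.
\<close>

lemma overring_total: "overring W \<Longrightarrow> deg u = 0 \<Longrightarrow> u \<notin> W \<Longrightarrow> iv u \<in> Jac W"
  using A_total[of u 0] by (auto simp: overring_def Jac_def)

lemma overring_idem [simp]: "overring W \<Longrightarrow> W \<star> W = W"
  using overring_e[of W] sprodI[of e W _ W] by (fastforce simp: overring_mult elim!: sprodE)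

lemma Jac_subset: "Jac W \<subseteq> W"
  by (auto simp: Jac_def)

lemma Jac_e: "e \<notin> Jac W"
  by (auto simp: Jac_def)

lemma Jac_left: "overring W \<Longrightarrow> w \<in> W \<Longrightarrow> j \<in> Jac W \<Longrightarrow> w \<cdot> j \<in> Jac W"
  using overring_mult[of W "iv j \<cdot> iv w" w] by (auto simp: Jac_def overring_mult)

lemma Jac_right: "overring W \<Longrightarrow> w \<in> W \<Longrightarrow> j \<in> Jac W \<Longrightarrow> j \<cdot> w \<in> Jac W"
  using overring_mult[of W w "iv w \<cdot> iv j"] by (auto simp: Jac_def overring_mult)

lemma overring_Jac [simp]: "overring W \<Longrightarrow> W \<star> Jac W = Jac W" "overring W \<Longrightarrow> Jac W \<star> W = Jac W"
proof -
  assume W: "overring W"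
  show "W \<star> Jac W = Jac W"
    using sprodI[of e W _ "Jac W"] overring_e[OF W] Jac_left[OF W] by (fastforce elim!: sprodE)
  show "Jac W \<star> W = Jac W"
    using sprodI[of _ "Jac W" e W] overring_e[OF W] Jac_right[OF W] by (fastforce elim!: sprodE)
qed

text \<open>
  For \<open>w\<close> in \<open>W - W'\<close> and \<open>w'\<close> in \<open>W' - W\<close>, one of \<open>w w'\<^sup>-\<^sup>1\<close> and \<open>w' w\<^sup>-\<^sup>1\<close> would lie in
  \<open>A 0\<close>, and so \<open>w\<close> in \<open>W'\<close> or \<open>w'\<close> in \<open>W\<close>.
\<close>

lemma overring_chain: "overring W \<Longrightarrow> overring W' \<Longrightarrow> W \<subseteq> W' \<or> W' \<subseteq> W"
proof (rule ccontr)
  assume W: "overring W" "overring W'" "\<not> (W \<subseteq> W' \<or> W' \<subseteq> W)"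
  then obtain w w' where w: "w \<in> W" "w \<notin> W'" "w' \<in> W'" "w' \<notin> W" by auto
  have "w \<cdot> iv w' \<in> A 0 \<or> w' \<cdot> iv w \<in> A 0"
    using A_total[of "w \<cdot> iv w'" 0] w W by (auto simp: overring_deg)
  then have "w \<cdot> iv w' \<in> W' \<or> w' \<cdot> iv w \<in> W" using W by (auto simp: overring_def)
  then show False
    using overring_mult[of W' "w \<cdot> iv w'" w'] overring_mult[of W "w' \<cdot> iv w" w] w W by auto
qed

lemma Jac_antimono: "overring W \<Longrightarrow> overring W' \<Longrightarrow> W \<subseteq> W' \<Longrightarrow> Jac W' \<subseteq> Jac W"
proof
  fix j assume W: "overring W" "overring W'" "W \<subseteq> W'" and j: "j \<in> Jac W'"
  then have "iv j \<notin> W" "deg (iv j) = 0" by (auto simp: Jac_def overring_deg)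
  then show "j \<in> Jac W" using overring_total[of W "iv j"] W by simp
qed

section \<open>Failure of multiplicativity\<close>

text \<open>
  For \<open>b\<close> of degree \<open>q\<close> in \<open>P\<close>, the element \<open>z b\<^sup>-\<^sup>1\<close> is not in \<open>P\<close>, since otherwise \<open>z\<close>
  would be a product. By totality its inverse \<open>b z\<^sup>-\<^sup>1\<close> is in \<open>P\<close>.
\<close>

lemma product_defect:
  assumes "z \<in> A (p + q)" "z \<notin> A p \<star> A q"
  shows "A q = A (- p) \<star> {z}" "A p = {z} \<star> A (- q)"
proof -
  have dz: "deg z = p + q" using assms A_deg by blast
  show "A q = A (- p) \<star> {z}"
  proof (intro equalityI subsetI)
    fix b assume b: "b \<in> A q"
    then have "z \<cdot> iv b \<notin> A p" using assms(2) sprodI[of "z \<cdot> iv b" "A p" b "A q"] by auto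
    then show "b \<in> A (- p) \<star> {z}" using A_total[of "z \<cdot> iv b" p] b dz A_deg[of b q] by simp
  next
    fix b assume "b \<in> A (- p) \<star> {z}"
    then show "b \<in> A q" using A_mult[of "b \<cdot> iv z" "- p" z "p + q"] assms(1) by simp
  qed
  show "A p = {z} \<star> A (- q)"
  proof (intro equalityI subsetI)
    fix b assume b: "b \<in> A p"
    then have "iv b \<cdot> z \<notin> A q" using assms(2) sprodI[of b "A p" "iv b \<cdot> z" "A q"] by auto
    then show "b \<in> {z} \<star> A (- q)" using A_total[of "iv b \<cdot> z" q] b dz A_deg[of b p] by simp
  next
    fix b assume "b \<in> {z} \<star> A (- q)"
    then show "b \<in> A p" using A_mult[of z "p + q" "iv z \<cdot> b" "- q"] assms(1) by simp
  qed
qed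

section \<open>Left orders\<close>

lemma OL_monoid:
  assumes "e \<in> W" "\<And>u v. u \<in> W \<Longrightarrow> v \<in> W \<Longrightarrow> u \<cdot> v \<in> W" "\<And>u. u \<in> W \<Longrightarrow> deg u = 0"
  shows "OL (W \<star> {x}) = W"
proof (intro equalityI subsetI)
  fix v assume "v \<in> OL (W \<star> {x})"
  then have "v \<cdot> s \<in> W \<star> {x}" if "s \<in> W \<star> {x}" for s using that unfolding OL_def by blast
  from this[of x] show "v \<in> W" using assms(1) by simp
next
  fix v assume v: "v \<in> W"
  then show "v \<in> OL (W \<star> {x})" using assms(2)[OF v, of "_ \<cdot> iv x"] assms(3) by (auto simp: OL_def)
qed

lemma OL_overring_right: "overring W \<Longrightarrow> OL (W \<star> {x}) = W"
  by (rule OL_monoid) (simp_all add: overring_e overring_mult overring_deg)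

text \<open>
  If \<open>v\<close> is not in \<open>W\<close>, then \<open>v\<^sup>-\<^sup>1\<close> is in the radical and \<open>v\<close> moves it to the identity.
\<close>

lemma OL_Jac_right:
  assumes "overring W" "Jac W \<noteq> {}" shows "OL (Jac W \<star> {x}) = W"
proof (intro equalityI subsetI)
  fix v assume v: "v \<in> OL (Jac W \<star> {x})"
  show "v \<in> W"
  proof (rule ccontr)
    assume "v \<notin> W"
    then have "iv v \<cdot> x \<in> Jac W \<star> {x}" using overring_total[of W v] assms v by (auto simp: OL_def)
    then have "v \<cdot> (iv v \<cdot> x) \<in> Jac W \<star> {x}" using v unfolding OL_def by blast
    then show False by (simp add: Jac_e)
  qed
qed (use assms in \<open>auto simp: OL_def Jac_left overring_deg\<close>)

lemma overring_OL:
  assumes "S \<subseteq> A q" "\<And>v s. v \<in> A 0 \<Longrightarrow> s \<in> S \<Longrightarrow> v \<cdot> s \<in> S" shows "overring (OL S)"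
  using assms by (auto simp: overring_def OL_def A_deg)

lemma overring_OL_A: "overring (OL (A q))"
  by (rule overring_OL[of _ q]) (use A_mult[of _ 0 _ q] in auto)

section \<open>Principal and idempotent radicals\<close>

text \<open>
  An element of \<open>J - J\<^sup>2\<close> generates: any \<open>y\<close> in \<open>J\<close> outside \<open>W c\<close> would give
  \<open>c = (c y\<^sup>-\<^sup>1) y\<close> with both factors in \<open>J\<close>.
\<close>

lemma Jac_principal:
  assumes W: "overring W" and n: "Jac W \<star> Jac W \<noteq> Jac W"
  obtains c where "Jac W = W \<star> {c}"
proof -
  have "Jac W \<star> Jac W \<subseteq> Jac W" using Jac_left[OF W] Jac_subset by (blast elim!: sprodE)
  then obtain c where c: "c \<in> Jac W" "c \<notin> Jac W \<star> Jac W" using n by auto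
  have "y \<cdot> iv c \<in> W" if y: "y \<in> Jac W" for y
  proof (rule ccontr)
    assume "y \<cdot> iv c \<notin> W"
    then have "c \<cdot> iv y \<in> Jac W"
      using overring_total[OF W, of "y \<cdot> iv c"] y c W Jac_subset[of W] by (auto simp: overring_deg subset_iff)
    then have "c \<cdot> iv y \<cdot> y \<in> Jac W \<star> Jac W" using y by (rule sprodI)
    then show False using c by simp
  qed
  then have "Jac W = W \<star> {c}" using Jac_left[OF W _ c(1)] by (force)
  then show thesis by (rule that)
qed

text \<open>
  With \<open>J = W c\<close> and \<open>c = j k\<close>, the second factor \<open>k\<close> is itself in \<open>W c\<close>, which makes \<open>j\<close>
  a unit.
\<close>

lemma Jac_idem_not_principal:
  assumes W: "overring W" and n: "Jac W \<star> Jac W = Jac W"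
  shows "Jac W \<noteq> W \<star> {c}"
proof
  assume J: "Jac W = W \<star> {c}"
  then have "c \<in> Jac W" using overring_e[OF W] by simp
  then have "c \<in> Jac W \<star> Jac W" using n by simp
  then obtain j k where jk: "c = j \<cdot> k" "j \<in> Jac W" "k \<in> Jac W" by (auto elim!: sprodE)
  then have "k \<cdot> iv c \<in> W" using J by auto
  then have "iv j \<in> W" using jk(1) by simp
  then show False using jk(2) by (simp add: Jac_def)
qed

lemma overring_conj:
  assumes "overring W" "\<And>v. v \<in> A 0 \<Longrightarrow> x \<cdot> v \<cdot> iv x \<in> W"
  shows "overring ({iv x} \<star> (W \<star> {x}))"
proof -
  have "deg w = 0" if "x \<cdot> (w \<cdot> iv x) \<in> W" for w
    using overring_deg[OF assms(1) that] by simp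
  then show ?thesis
    using assms overring_mult[OF assms(1), of "x \<cdot> _ \<cdot> iv x" "x \<cdot> _ \<cdot> iv x"]
    by (auto simp: overring_def)
qed


lemma OL_conj_overring:
  assumes "overring W" shows "OL ({x} \<star> (W \<star> {y})) = {x} \<star> (W \<star> {iv x})"
proof -
  have "deg u = 0" if "iv x \<cdot> (u \<cdot> x) \<in> W" for u using overring_deg[OF assms that] by simp
  then have "OL ({x} \<star> (W \<star> {iv x}) \<star> {x \<cdot> y}) = {x} \<star> (W \<star> {iv x})"
    using overring_mult[OF assms, of "iv x \<cdot> (_ \<cdot> x)" "iv x \<cdot> (_ \<cdot> x)"] overring_e[OF assms]
    by (intro OL_monoid) auto
  then show ?thesis by simp
qed

lemma Jac_conj: "Jac ({iv x} \<star> (W \<star> {x})) = {iv x} \<star> (Jac W \<star> {x})"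
  by (auto simp: Jac_def)

lemma Jac_conj_idem:
  assumes "Jac W \<noteq> {}" "Jac W \<star> Jac W = Jac W"
  shows "Jac ({iv x} \<star> (W \<star> {x})) \<noteq> {}"
    "Jac ({iv x} \<star> (W \<star> {x})) \<star> Jac ({iv x} \<star> (W \<star> {x})) = Jac ({iv x} \<star> (W \<star> {x}))"
proof -
  obtain j where "j \<in> Jac W" using assms(1) by auto
  then have "iv x \<cdot> (j \<cdot> x) \<in> Jac ({iv x} \<star> (W \<star> {x}))" by (simp add: Jac_conj)
  then show "Jac ({iv x} \<star> (W \<star> {x})) \<noteq> {}" by blast
  have "{iv x} \<star> (Jac W \<star> {x}) \<star> ({iv x} \<star> (Jac W \<star> {x})) = {iv x} \<star> (Jac W \<star> Jac W) \<star> {x}"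
    by (simp add: sprod_assoc[symmetric] del: sprod_assoc)
      (simp add: translate_simps(3)[symmetric] del: translate_simps(3))
  then show "Jac ({iv x} \<star> (W \<star> {x})) \<star> Jac ({iv x} \<star> (W \<star> {x})) = Jac ({iv x} \<star> (W \<star> {x}))"
    unfolding Jac_conj assms(2) by simp
qed

section \<open>Principal components\<close>

text \<open>
  This is used when \<open>x W x\<^sup>-\<^sup>1 \<subseteq> W\<close>, and then says that the inclusion is proper.
\<close>

definition shrinks :: "'g \<Rightarrow> 'g set \<Rightarrow> bool" where
  "shrinks x W \<longleftrightarrow> (\<exists>w\<in>W. iv x \<cdot> (w \<cdot> x) \<notin> W)"

text \<open>
  The degree \<open>q\<close> may be negative, which is how the components of Type (f) are covered.
\<close>

definition left_principal :: "rat \<Rightarrow> 'g \<Rightarrow> 'g set \<Rightarrow> bool" where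
  "left_principal q x W \<longleftrightarrow> overring W \<and> deg x = q \<and> A q = W \<star> {x} \<and> A (- q) = {iv x} \<star> Jac W \<and>
     (\<forall>w\<in>W. x \<cdot> (w \<cdot> iv x) \<in> W)"

definition right_principal :: "rat \<Rightarrow> 'g \<Rightarrow> 'g set \<Rightarrow> bool" where
  "right_principal q x W \<longleftrightarrow> overring W \<and> deg x = q \<and> A q = {x} \<star> W \<and> A (- q) = Jac W \<star> {iv x} \<and>
     (\<forall>w\<in>W. iv x \<cdot> (w \<cdot> x) \<in> W)"

text \<open>
  Type (I) amounts to this property for all \<open>r \<noteq> 0\<close> (\<open>cone_I_multiplicative\<close>).
\<close>

definition multiplicative :: "rat \<Rightarrow> bool" where
  "multiplicative r \<longleftrightarrow> (\<forall>i j. 1 \<le> i \<longrightarrow> 1 \<le> j \<longrightarrow>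
     A (of_nat i * r) \<star> A (of_nat j * r) = A (of_nat (i + j) * r))"

text \<open>
  The products are computed directly from \<open>W x W = W x\<close> and \<open>x J x\<^sup>-\<^sup>1 J = J\<close>; the latter uses
  that \<open>x J x\<^sup>-\<^sup>1\<close> contains a unit of \<open>W\<close> in the proper case, and \<open>J\<^sup>2 = J\<close> otherwise. If a product were
  not the full component, \<open>product_defect\<close> would express \<open>J\<close> as a two-sided translate of \<open>W\<close>. As both
  orders of a nonempty radical are \<open>W\<close>, this forces \<open>x W x\<^sup>-\<^sup>1 = W\<close> and \<open>J\<close> principal.
\<close>

lemma left_principal_step:
  assumes x: "left_principal r x W" and nd: "shrinks x W \<or> Jac W \<star> Jac W = Jac W" and y: "left_principal q y W"
  shows "A r \<star> A q = A (r + q)" "A (- q) \<star> A (- r) = A (- (r + q))" "left_principal (r + q) (x \<cdot> y) W"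
proof -
  let ?J = "Jac W"
  have W: "overring W" and dx: "deg x = r" and Ax: "A r = W \<star> {x}" "A (- r) = {iv x} \<star> ?J"
    and cx: "\<And>w. w \<in> W \<Longrightarrow> x \<cdot> (w \<cdot> iv x) \<in> W" using x by (auto simp: left_principal_def)
  have dy: "deg y = q" and Ay: "A q = W \<star> {y}" "A (- q) = {iv y} \<star> ?J"
    and cy: "\<And>w. w \<in> W \<Longrightarrow> y \<cdot> (w \<cdot> iv y) \<in> W" using y by (auto simp: left_principal_def)
  have WxW: "W \<star> ({x} \<star> W) = W \<star> {x}"
  proof (intro equalityI subsetI)
    fix v assume "v \<in> W \<star> ({x} \<star> W)"
    then obtain w s where v: "v = w \<cdot> s" "w \<in> W" "iv x \<cdot> s \<in> W" by (auto elim!: sprodE)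
    then show "v \<in> W \<star> {x}" using overring_mult[OF W v(2) cx[OF v(3)]] by simp
  next
    fix v assume "v \<in> W \<star> {x}"
    then show "v \<in> W \<star> ({x} \<star> W)"
      using sprodI[of "v \<cdot> iv x" W x "{x} \<star> W"] overring_e[OF W] by simp
  qed
  have pos: "A r \<star> A q = W \<star> {x \<cdot> y}"
  proof -
    have "A r \<star> A q = W \<star> ({x} \<star> W) \<star> {y}" by (simp add: Ax Ay)
    then show ?thesis unfolding WxW by simp
  qed
  have np: "?J \<noteq> W \<star> {d}" if "\<not> shrinks x W" for d
    using that nd Jac_idem_not_principal[OF W] by auto
  have 1: "A (r + q) = W \<star> {x \<cdot> y}"
  proof (rule ccontr)
    assume "A (r + q) \<noteq> W \<star> {x \<cdot> y}"
    then obtain z where z: "z \<in> A (r + q)" "z \<notin> A r \<star> A q" using A_sprod[of r q] pos by blast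
    have "W \<star> {y} = {iv x} \<star> (?J \<star> {z})" using product_defect(1)[OF z] by (simp add: Ax Ay)
    then have "{x} \<star> (W \<star> {y}) \<star> {iv z} = ?J" by simp
    then have J: "{x} \<star> (W \<star> {y \<cdot> iv z}) = ?J" by simp
    moreover have "x \<cdot> (y \<cdot> iv z) \<in> {x} \<star> (W \<star> {y \<cdot> iv z})" using overring_e[OF W] by simp
    ultimately have "OL ({x} \<star> (W \<star> {y \<cdot> iv z})) = W" using OL_Jac_right[OF W, of e] by auto
    then have c: "{x} \<star> (W \<star> {iv x}) = W" using OL_conj_overring[OF W] by simp
    then have "{x} \<star> W = W \<star> {x}" by (auto simp: translate_swap)
    then have "?J = W \<star> {x \<cdot> (y \<cdot> iv z)}" using J by (metis sprod_assoc translate_simps(3))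
    moreover have "\<not> shrinks x W"
    proof -
      have "iv x \<cdot> (w \<cdot> x) \<in> W" if "w \<in> W" for w
      proof -
        have "w \<in> {x} \<star> (W \<star> {iv x})" using c that by simp
        then show ?thesis by simp
      qed
      then show ?thesis by (auto simp: shrinks_def)
    qed
    ultimately show False using np by blast
  qed
  have JJ: "{x} \<star> (?J \<star> ({iv x} \<star> ?J)) = ?J"
  proof (intro equalityI subsetI)
    fix v assume "v \<in> {x} \<star> (?J \<star> ({iv x} \<star> ?J))"
    then obtain j k where v: "v = x \<cdot> (j \<cdot> (iv x \<cdot> k))" "j \<in> ?J" "k \<in> ?J"
      by (auto elim!: sprodE) (metis cancel_simps(1,2))
    then have "x \<cdot> (j \<cdot> iv x) \<in> W" using cx Jac_subset by auto
    from Jac_left[OF W this v(3)] show "v \<in> ?J" using v by simp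
  next
    fix j assume j: "j \<in> ?J"
    show "j \<in> {x} \<star> (?J \<star> ({iv x} \<star> ?J))"
    proof (cases "shrinks x W")
      case True
      then obtain w where w: "w \<in> W" "iv x \<cdot> (w \<cdot> x) \<notin> W" by (auto simp: shrinks_def)
      then have "iv x \<cdot> (iv w \<cdot> x) \<in> ?J"
        using overring_total[OF W, of "iv x \<cdot> (w \<cdot> x)"] by (simp add: overring_deg[OF W])
      from sprodI[OF this, of "iv x \<cdot> (w \<cdot> j)" "{iv x} \<star> ?J"] Jac_left[OF W w(1) j]
      show ?thesis by simp
    next
      case False
      then obtain a b where ab: "j = a \<cdot> b" "a \<in> ?J" "b \<in> ?J" using nd j by (metis sprodE)
      have "iv x \<cdot> (a \<cdot> x) \<in> ?J"
      proof -
        have "iv x \<cdot> (a \<cdot> x) \<in> W" using False ab Jac_subset by (auto simp: shrinks_def)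
        moreover have "iv x \<cdot> (iv a \<cdot> x) \<notin> W"
          using cx[of "iv x \<cdot> (iv a \<cdot> x)"] ab(2) by (auto simp: Jac_def)
        ultimately show ?thesis by (simp add: Jac_def)
      qed
      from sprodI[OF this, of "iv x \<cdot> b" "{iv x} \<star> ?J"] ab show ?thesis by simp
    qed
  qed
  have neg: "A (- q) \<star> A (- r) = {iv (x \<cdot> y)} \<star> ?J"
  proof -
    have "A (- q) \<star> A (- r) = {iv y} \<star> (?J \<star> ({iv x} \<star> ?J))" by (simp add: Ax Ay)
    also have "\<dots> = {iv y} \<star> ({iv x} \<star> ({x} \<star> (?J \<star> ({iv x} \<star> ?J))))"
      by (simp only: translate_simps gp.left_inverse)
    also have "\<dots> = {iv (x \<cdot> y)} \<star> ?J" unfolding JJ by simp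
    finally show ?thesis .
  qed
  have 2: "A (- (r + q)) = {iv (x \<cdot> y)} \<star> ?J"
  proof (rule ccontr)
    assume "A (- (r + q)) \<noteq> {iv (x \<cdot> y)} \<star> ?J"
    then obtain z where z: "z \<in> A (- q + - r)" "z \<notin> A (- q) \<star> A (- r)"
      using A_sprod[of "- q" "- r"] neg by (metis subset_antisym subsetI minus_add add.commute)
    have "{iv y} \<star> ?J = {z} \<star> (W \<star> {x})" using product_defect(2)[OF z] by (simp add: Ax Ay)
    then have J: "?J = {y \<cdot> z} \<star> (W \<star> {x})" by (simp add: translate_swap)
    have c: "iv x \<cdot> (w \<cdot> x) \<in> W" if w: "w \<in> W" for w
    proof (rule ccontr)
      assume "iv x \<cdot> (w \<cdot> x) \<notin> W"
      then have "iv x \<cdot> (iv w \<cdot> x) \<in> ?J"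
        using overring_total[OF W, of "iv x \<cdot> (w \<cdot> x)"] w by (simp add: overring_deg[OF W])
      then have "iv z \<cdot> (iv y \<cdot> (iv x \<cdot> iv w)) \<in> W" using J by simp
      from overring_mult[OF W this w] have "e \<in> ?J" using J by simp
      then show False by (simp add: Jac_e)
    qed
    then have ns: "\<not> shrinks x W" by (auto simp: shrinks_def)
    have "y \<cdot> (z \<cdot> x) \<in> ?J" unfolding J using overring_e[OF W] by simp
    then have "W = OL ?J" using OL_Jac_right[OF W, of e] by auto
    also have "\<dots> = {y \<cdot> z} \<star> (W \<star> {iv (y \<cdot> z)})" using OL_conj_overring[OF W] J by simp
    finally have "W \<star> {y \<cdot> z} = {y \<cdot> z} \<star> W" by (auto simp: translate_swap)
    then have "?J = W \<star> {y \<cdot> (z \<cdot> x)}" using J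
      by (metis sprod_assoc translate_simps(3) gp.assoc)
    then show False using np[OF ns] by blast
  qed
  show "A r \<star> A q = A (r + q)" "A (- q) \<star> A (- r) = A (- (r + q))"
    using pos neg 1 2 by auto
  have "x \<cdot> (y \<cdot> (w \<cdot> (iv y \<cdot> iv x))) \<in> W" if "w \<in> W" for w using cx[OF cy[OF that]] by simp
  then show "left_principal (r + q) (x \<cdot> y) W"
    using W 1 2 dx dy by (simp add: left_principal_def)
qed

text \<open>
  The conjugates by \<open>x\<close> and by \<open>x y\<close> satisfy \<open>x y W y\<^sup>-\<^sup>1 x\<^sup>-\<^sup>1 \<subseteq> x W x\<^sup>-\<^sup>1 \<subseteq> W\<close>.
\<close>

lemma shrinks_mult:
  assumes "\<And>w. w \<in> W \<Longrightarrow> x \<cdot> (w \<cdot> iv x) \<in> W" "\<And>w. w \<in> W \<Longrightarrow> y \<cdot> (w \<cdot> iv y) \<in> W"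
    and "shrinks y W = shrinks x W"
  shows "shrinks (x \<cdot> y) W = shrinks x W"
proof (cases "shrinks x W")
  case True
  then obtain w where w: "w \<in> W" "iv x \<cdot> (w \<cdot> x) \<notin> W" by (auto simp: shrinks_def)
  then have "iv y \<cdot> (iv x \<cdot> (w \<cdot> (x \<cdot> y))) \<notin> W"
    using assms(2)[of "iv y \<cdot> (iv x \<cdot> (w \<cdot> (x \<cdot> y)))"] by auto
  then show ?thesis using w True by (auto simp: shrinks_def)
next
  case False
  then have 1: "iv x \<cdot> (w \<cdot> x) \<in> W" "iv y \<cdot> (w \<cdot> y) \<in> W" if "w \<in> W" for w
    using assms that by (auto simp: shrinks_def)
  have "iv y \<cdot> (iv x \<cdot> (w \<cdot> (x \<cdot> y))) \<in> W" if "w \<in> W" for w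
    using 1(2)[OF 1(1)[OF that]] by simp
  then show ?thesis using False by (auto simp: shrinks_def)
qed

lemma multiplicative_leftI:
  assumes "\<And>n::nat. 1 \<le> n \<Longrightarrow> A r \<star> A (of_nat n * r) = A (of_nat (Suc n) * r)"
  shows "multiplicative r"
proof -
  have "A (of_nat i * r) \<star> A (of_nat j * r) = A (of_nat (i + j) * r)" if "1 \<le> i" "1 \<le> j" for i j :: nat
    using that(1)
  proof (induction i rule: nat_induct_at_least)
    case base
    then show ?case using assms[OF that(2)] by simp
  next
    case (Suc i)
    have "A (of_nat (Suc i) * r) \<star> A (of_nat j * r) = A r \<star> A (of_nat (i + j) * r)"
      using assms[OF Suc.hyps] Suc.IH by (metis sprod_assoc)
    then show ?case using assms[of "i + j"] Suc.hyps by simp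
  qed
  then show ?thesis by (simp add: multiplicative_def)
qed

lemma multiplicative_rightI:
  assumes "\<And>n::nat. 1 \<le> n \<Longrightarrow> A (of_nat n * r) \<star> A r = A (of_nat (Suc n) * r)"
  shows "multiplicative r"
proof -
  have "A (of_nat i * r) \<star> A (of_nat j * r) = A (of_nat (i + j) * r)" if "1 \<le> i" "1 \<le> j" for i j :: nat
    using that(2)
  proof (induction j rule: nat_induct_at_least)
    case base
    then show ?case using assms[OF that(1)] by simp
  next
    case (Suc j)
    have "A (of_nat i * r) \<star> A (of_nat (Suc j) * r) = A (of_nat (i + j) * r) \<star> A r"
      using assms[OF Suc.hyps] Suc.IH by (metis sprod_assoc)
    then show ?case using assms[of "i + j"] Suc.hyps by simp
  qed
  then show ?thesis by (simp add: multiplicative_def)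
qed

lemma left_principal_multiples:
  assumes x: "left_principal r x W" and nd: "shrinks x W \<or> Jac W \<star> Jac W = Jac W" and n: "1 \<le> (n::nat)"
  shows "\<exists>y. left_principal (of_nat n * r) y W \<and> shrinks y W = shrinks x W"
  using n
proof (induction n rule: nat_induct_at_least)
  case base
  then show ?case using x by auto
next
  case (Suc n)
  then obtain y where y: "left_principal (of_nat n * r) y W" "shrinks y W = shrinks x W" by auto
  have "left_principal (of_nat (Suc n) * r) (x \<cdot> y) W" using left_principal_step(3)[OF x nd y(1)] by (simp add: ring_distribs)
  moreover have "shrinks (x \<cdot> y) W = shrinks x W"
    using shrinks_mult[OF _ _ y(2)] x y(1) by (auto simp: left_principal_def)
  ultimately show ?case by blast
qed

lemma left_principal_multiplicative:
  assumes x: "left_principal r x W" and nd: "shrinks x W \<or> Jac W \<star> Jac W = Jac W"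
  shows "multiplicative r" "multiplicative (- r)"
proof -
  have s: "r + of_nat n * r = of_nat (Suc n) * r" for n :: nat by (simp add: ring_distribs)
  show "multiplicative r"
  proof (rule multiplicative_leftI)
    fix n :: nat assume "1 \<le> n"
    then obtain y where "left_principal (of_nat n * r) y W" using left_principal_multiples[OF x nd] by blast
    from left_principal_step(1)[OF x nd this] show "A r \<star> A (of_nat n * r) = A (of_nat (Suc n) * r)" unfolding s .
  qed
  show "multiplicative (- r)"
  proof (rule multiplicative_rightI)
    fix n :: nat assume "1 \<le> n"
    then obtain y where "left_principal (of_nat n * r) y W" using left_principal_multiples[OF x nd] by blast
    from left_principal_step(2)[OF x nd this] 
    show "A (of_nat n * - r) \<star> A (- r) = A (of_nat (Suc n) * - r)" unfolding s by simp
  qed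
qed

lemma op_sprod: "graded_cone.sprod (\<lambda>x y. y \<cdot> x) S T = T \<star> S"
  by (auto simp: graded_cone.sprod_def[OF opposite] sprod_def)

lemma op_overring: "graded_cone.overring (\<lambda>x y. y \<cdot> x) deg P W = overring W"
  by (auto simp: graded_cone.overring_def[OF opposite] overring_def)

lemma op_multiplicative: "graded_cone.multiplicative (\<lambda>x y. y \<cdot> x) deg P r = multiplicative r"
  unfolding graded_cone.multiplicative_def[OF opposite] multiplicative_def op_sprod by (metis add.commute)

lemma op_left_principal: "graded_cone.left_principal (\<lambda>x y. y \<cdot> x) iv deg P q x W = right_principal q x W"
  by (simp add: graded_cone.left_principal_def[OF opposite] right_principal_def op_sprod op_overring)

lemma op_shrinks: "graded_cone.shrinks (\<lambda>x y. y \<cdot> x) iv x W = shrinks (iv x) W"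
  by (simp add: graded_cone.shrinks_def[OF opposite] shrinks_def)

lemmas right_principal_multiples = graded_cone.left_principal_multiples[OF opposite,
  unfolded op_left_principal op_shrinks op_sprod]
lemmas right_principal_multiplicative = graded_cone.left_principal_multiplicative[OF opposite,
  unfolded op_left_principal op_shrinks op_sprod op_multiplicative]


section \<open>The star closure\<close>

lemma OL_translate: "OL ({x} \<star> S) = {x} \<star> (OL S \<star> {iv x})"
proof (intro equalityI subsetI)
  fix v assume v: "v \<in> OL ({x} \<star> S)"
  have "iv x \<cdot> (v \<cdot> (x \<cdot> s)) \<in> S" if "s \<in> S" for s
  proof -
    have "x \<cdot> s \<in> {x} \<star> S" using that by simp
    then have "v \<cdot> (x \<cdot> s) \<in> {x} \<star> S" using v unfolding OL_def by blast
    then show ?thesis by simp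
  qed
  then show "v \<in> {x} \<star> (OL S \<star> {iv x})" using v by (simp add: OL_def)
next
  fix v assume "v \<in> {x} \<star> (OL S \<star> {iv x})"
  then have v: "deg v = 0" "\<And>s. s \<in> S \<Longrightarrow> iv x \<cdot> (v \<cdot> (x \<cdot> s)) \<in> S" by (auto simp: OL_def)
  from v(2)[of "iv x \<cdot> _"] v(1) show "v \<in> OL ({x} \<star> S)" by (simp add: OL_def)
qed

lemma star_translate: "star ({x} \<star> S) = {x} \<star> star S"
proof -
  have all: "(\<forall>z. Q z) \<longleftrightarrow> (\<forall>z. Q (x \<cdot> z))" for Q by (metis cancel_simps(2))
  have 1: "{x} \<star> S \<subseteq> OL ({x} \<star> S) \<star> {x \<cdot> z} \<longleftrightarrow> S \<subseteq> OL S \<star> {z}" for z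
    by (simp add: OL_translate)
  have 2: "y \<in> OL ({x} \<star> S) \<star> {x \<cdot> z} \<longleftrightarrow> iv x \<cdot> y \<in> OL S \<star> {z}" for y z
    by (simp add: OL_translate)
  have 3: "(\<forall>z. {x} \<star> S \<subseteq> OL ({x} \<star> S) \<star> {z} \<longrightarrow> y \<in> OL ({x} \<star> S) \<star> {z}) \<longleftrightarrow>
      (\<forall>z. S \<subseteq> OL S \<star> {z} \<longrightarrow> iv x \<cdot> y \<in> OL S \<star> {z})" for y
    by (subst all) (simp only: 1 2)
  have 4: "(\<exists>s\<in>{x} \<star> S. deg y = deg s) \<longleftrightarrow> (\<exists>s\<in>S. deg (iv x \<cdot> y) = deg s)" for y
  proof
    assume "\<exists>s\<in>{x} \<star> S. deg y = deg s"
    then obtain s where "iv x \<cdot> s \<in> S" "deg y = deg s" by auto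
    then show "\<exists>s\<in>S. deg (iv x \<cdot> y) = deg s" by (intro bexI[of _ "iv x \<cdot> s"]) auto
  next
    assume "\<exists>s\<in>S. deg (iv x \<cdot> y) = deg s"
    then obtain s where "s \<in> S" "deg (iv x \<cdot> y) = deg s" by auto
    then show "\<exists>s\<in>{x} \<star> S. deg y = deg s" by (intro bexI[of _ "x \<cdot> s"]) auto
  qed
  have eq: "y \<in> star ({x} \<star> S) \<longleftrightarrow> iv x \<cdot> y \<in> star S" for y
    unfolding star_def mem_Collect_eq 3 4 by (rule refl)
  show ?thesis by (rule Set.set_eqI) (simp only: mem_translate eq)
qed

lemma star_superset: "S \<subseteq> star S"
  by (auto simp: star_def)

lemma star_principal:
  assumes "overring W" shows "star (W \<star> {x}) = W \<star> {x}"
  using star_superset OL_overring_right[OF assms, of x] by (auto simp: star_def)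

text \<open>
  If \<open>J y \<subseteq> W x\<close>, then \<open>y x\<^sup>-\<^sup>1\<close> multiplies \<open>J\<close> into \<open>W\<close>, so it lies in \<open>W\<close> because \<open>J\<close> is not
  principal. Every principal module containing \<open>J y\<close> thus contains \<open>W y\<close>.
\<close>

lemma star_Jac_idem:
  assumes W: "overring W" and J: "Jac W \<noteq> {}" "Jac W \<star> Jac W = Jac W"
  shows "star (Jac W \<star> {y}) = W \<star> {y}"
proof
  note OL = OL_Jac_right[OF W J(1), of y]
  have "Jac W \<star> {y} \<subseteq> W \<star> {y}" using Jac_subset by auto
  then show "star (Jac W \<star> {y}) \<subseteq> W \<star> {y}" by (auto simp: star_def OL)
  obtain j where j: "j \<in> Jac W" using J by auto
  show "W \<star> {y} \<subseteq> star (Jac W \<star> {y})"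
  proof
    fix v assume v: "v \<in> W \<star> {y}"
    then have dv: "deg v = deg y" using overring_deg[OF W, of "v \<cdot> iv y"] by simp
    have "v \<cdot> iv x \<in> W" if s: "Jac W \<star> {y} \<subseteq> W \<star> {x}" for x
    proof -
      have s': "j \<cdot> (y \<cdot> iv x) \<in> W" if "j \<in> Jac W" for j
        using that subsetD[OF s, of "j \<cdot> y"] by simp
      have "deg (j \<cdot> (y \<cdot> iv x)) = 0" using overring_deg[OF W s'[OF j]] .
      then have d: "deg (y \<cdot> iv x) = 0" using overring_deg[OF W] j Jac_subset[of W] by (auto simp: subset_iff)
      have "y \<cdot> iv x \<in> W"
      proof (rule ccontr)
        assume "y \<cdot> iv x \<notin> W"
        then have c: "x \<cdot> iv y \<in> Jac W" using overring_total[OF W d] by simp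
        have "Jac W = W \<star> {x \<cdot> iv y}" using s' Jac_left[OF W _ c] by (force)
        then show False using Jac_idem_not_principal[OF W J(2)] by blast
      qed
      then show ?thesis using overring_mult[OF W, of "v \<cdot> iv y" "y \<cdot> iv x"] v by simp
    qed
    moreover have "deg (j \<cdot> y) = deg y" using overring_deg[OF W] j Jac_subset by auto
    ultimately show "v \<in> star (Jac W \<star> {y})"
      using j dv by (auto simp: star_def OL intro!: bexI[of _ "j \<cdot> y"])
  qed
qed

lemma star_Jac:
  assumes W: "overring W" and J: "Jac W \<noteq> {}"
  obtains c where "star (Jac W \<star> {y}) = W \<star> {c}"
proof (cases "Jac W \<star> Jac W = Jac W")
  case True
  then show ?thesis using star_Jac_idem[OF W J] that by blast
next
  case False
  then obtain c where "Jac W = W \<star> {c}" using Jac_principal[OF W] by blast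
  then have "Jac W \<star> {y} = W \<star> {c \<cdot> y}" by simp
  then show ?thesis using star_principal[OF W, of "c \<cdot> y"] that by metis
qed

text \<open>
  Any \<open>y\<close> in the closure but not in \<open>S\<close> generates a principal module that contains \<open>S\<close>, hence
  the closure. So all these \<open>y\<close> generate the same module, they are its generators, and \<open>S\<close> is what
  remains.
\<close>

lemma not_star_closed:
  assumes S: "\<And>s. s \<in> S \<Longrightarrow> deg s = q" and W: "overring (OL S)" and n: "star S \<noteq> S"
  obtains y where "deg y = q" "S = Jac (OL S) \<star> {y}" "star S = OL S \<star> {y}"
proof -
  define W where "W = OL S"
  note W = W[folded W_def]
  have WS: "w \<cdot> s \<in> S" if "w \<in> W" "s \<in> S" for w s
    using that unfolding W_def OL_def by blast
  have dstar: "deg y = q" if "y \<in> star S" for y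
    using that S unfolding star_def by blast
  have stable: "W \<star> {y} \<subseteq> star S" if y: "y \<in> star S" for y
  proof
    fix v assume v: "v \<in> W \<star> {y}"
    have "v \<cdot> iv x \<in> W" if "S \<subseteq> W \<star> {x}" for x
    proof -
      have "y \<in> W \<star> {x}" using y that unfolding star_def W_def by blast
      then show ?thesis using overring_mult[OF W, of "v \<cdot> iv y" "y \<cdot> iv x"] v by simp
    qed
    moreover have "deg v = deg y" using overring_deg[OF W, of "v \<cdot> iv y"] v by simp
    ultimately show "v \<in> star S" using y unfolding star_def W_def by auto
  qed
  have gen: "star S = W \<star> {y}" if y: "y \<in> star S" "y \<notin> S" for y
  proof -
    have "s \<cdot> iv y \<in> W" if s: "s \<in> S" for s
    proof (rule ccontr)
      assume "s \<cdot> iv y \<notin> W"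
      then have "y \<cdot> iv s \<in> W"
        using overring_total[OF W, of "s \<cdot> iv y"] dstar[OF y(1)] S[OF s] Jac_subset by auto
      from WS[OF this s] show False using y(2) by simp
    qed
    then have "S \<subseteq> W \<star> {y}" by auto
    then have "star S \<subseteq> W \<star> {y}" unfolding star_def W_def by blast
    then show ?thesis using stable[OF y(1)] by blast
  qed
  obtain y where y: "y \<in> star S" "y \<notin> S" using n star_superset by blast
  have "S = Jac W \<star> {y}"
  proof (intro equalityI subsetI)
    fix s assume s: "s \<in> S"
    then have "s \<cdot> iv y \<in> W" using gen[OF y] star_superset[of S] by auto
    moreover have "y \<cdot> iv s \<notin> W" using WS[of "y \<cdot> iv s" s] s y(2) by auto
    ultimately show "s \<in> Jac W \<star> {y}" by (simp add: Jac_def)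
  next
    fix s assume s: "s \<in> Jac W \<star> {y}"
    show "s \<in> S"
    proof (rule ccontr)
      assume ns: "s \<notin> S"
      have "s \<in> star S" using s Jac_subset gen[OF y] by auto
      from gen[OF this ns] gen[OF y] have "y \<in> W \<star> {s}" using overring_e[OF W] by auto
      then show False using s by (simp add: Jac_def)
    qed
  qed
  then show thesis using that[of y] gen[OF y] dstar[OF y(1)] by (simp add: W_def)
qed

section \<open>The types, for cones\<close>

text \<open>
  The value at \<open>0\<close> lets the recursion start; it makes \<open>spow S 1\<close> equal to \<open>S\<close>.
\<close>

primrec spow :: "'g set \<Rightarrow> nat \<Rightarrow> 'g set" where
  "spow S 0 = {e}"
| "spow S (Suc n) = spow S n \<star> S"

text \<open>
  The following predicates render the types of graded extensions. Type (f) and Type (g) cope with the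
  zero component through the empty set: it is never of Type (f), and always of
  Type (g) since no power of it has a principal closure.
\<close>

definition cone_a :: "rat \<Rightarrow> bool" where
  "cone_a q \<longleftrightarrow> (\<exists>x. deg x = q \<and> A q = A 0 \<star> {x} \<and> A 0 \<star> {x} = {x} \<star> A 0 \<and> A (- q) = A 0 \<star> {iv x})"

definition cone_b :: "rat \<Rightarrow> bool" where
  "cone_b q \<longleftrightarrow> (\<exists>x. A q = OL (A q) \<star> {x} \<and> {x} \<star> OL (A q) \<subset> OL (A q) \<star> {x})"

definition cone_c :: "rat \<Rightarrow> bool" where
  "cone_c q \<longleftrightarrow> (\<exists>x. A q = OL (A q) \<star> {x} \<and> OL (A q) \<star> {x} \<subset> {x} \<star> OL (A q))"

definition cone_d :: "rat \<Rightarrow> bool" where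
  "cone_d q \<longleftrightarrow> (\<exists>x. A q = OL (A q) \<star> {x} \<and> OL (A q) \<star> {x} = {x} \<star> OL (A q) \<and>
      A (- q) = Jac (OL (A q)) \<star> {iv x}) \<and> Jac (OL (A q)) \<star> Jac (OL (A q)) = Jac (OL (A q))"

definition cone_f :: "rat \<Rightarrow> bool" where "cone_f q \<longleftrightarrow> A q \<subset> star (A q)"

definition cone_g :: "rat \<Rightarrow> bool" where
  "cone_g q \<longleftrightarrow> star (A q) = A q \<and> (\<forall>i\<ge>1. \<forall>c. star (spow (A q) i) \<noteq> OL (A q) \<star> {c})"

section \<open>Types (a) to (d)\<close>

lemma unit_sprod: "x \<in> A p \<Longrightarrow> iv x \<in> A (- p) \<Longrightarrow> A p \<star> A q = A (p + q)"
proof (rule ccontr)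
  assume x: "x \<in> A p" "iv x \<in> A (- p)" and n: "A p \<star> A q \<noteq> A (p + q)"
  then obtain z where z: "z \<in> A (p + q)" "z \<notin> A p \<star> A q" using A_sprod[of p q] by blast
  have "iv x \<cdot> z \<in> A q" using A_mult[OF x(2) z(1)] by simp
  from sprodI[OF x(1) this] show False using z(2) by simp
qed

text \<open>
  Totality puts \<open>x\<^sup>-\<^sup>1 J\<close> into \<open>A (- q)\<close>, because its inverses are not in \<open>W x\<close>. If \<open>A (- q)\<close> contains
  another element \<open>y\<close>, then \<open>x y\<close> is invertible in \<open>W\<close>, so \<open>W = W x y\<close> is contained in \<open>A 0\<close> and \<open>x\<close>
  is a unit of \<open>P\<close>.
\<close>

lemma principal_dichotomy:
  assumes x: "deg x = q" "A q = OL (A q) \<star> {x}"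
  shows "A (- q) = {iv x} \<star> Jac (OL (A q)) \<or>
    OL (A q) = A 0 \<and> A 0 \<star> {x} = {x} \<star> A 0 \<and> A (- q) = A 0 \<star> {iv x}"
proof -
  define W where "W = OL (A q)"
  have W: "overring W" unfolding W_def by (rule overring_OL_A)
  have Aq: "A q = W \<star> {x}" using x(2) by (simp add: W_def)
  have xA: "x \<in> A q" unfolding Aq using overring_e[OF W] by simp
  have 1: "{iv x} \<star> Jac W \<subseteq> A (- q)"
  proof
    fix y assume y: "y \<in> {iv x} \<star> Jac W"
    then have "iv y \<notin> A q" unfolding Aq by (simp add: Jac_def)
    moreover have "deg (x \<cdot> y) = 0" using y overring_deg[OF W, of "x \<cdot> y"] Jac_subset[of W] by auto
    ultimately show "y \<in> A (- q)" using A_total[of "iv y" q] x(1) by simp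
  qed
  show ?thesis
  proof (cases "A (- q) \<subseteq> {iv x} \<star> Jac W")
    case True
    then show ?thesis using 1 by (auto simp: W_def)
  next
    case False
    then obtain y where "y \<in> A (- q)" "y \<notin> {iv x} \<star> Jac W" by blast
    then have y: "y \<in> A (- q)" "x \<cdot> y \<notin> Jac W" by simp_all
    have xy: "x \<cdot> y \<in> A 0" using A_mult[OF xA y(1)] by simp
    then have "x \<cdot> y \<in> W" using W by (auto simp: overring_def)
    then have c: "iv (x \<cdot> y) \<in> W" using y(2) by (simp add: Jac_def)
    have "W \<subseteq> A 0"
    proof
      fix w assume "w \<in> W"
      then have "w \<cdot> iv (x \<cdot> y) \<cdot> x \<in> A q" unfolding Aq using overring_mult[OF W _ c] by simp
      from A_mult[OF this y(1)] show "w \<in> A 0" by simp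
    qed
    then have WV: "W = A 0" using W by (auto simp: overring_def)
    have ix: "iv x \<in> A (- q)" using A_mult[OF y(1), of "iv (x \<cdot> y)" 0] c WV by simp
    have "x \<cdot> (v \<cdot> iv x) \<in> A 0" "iv x \<cdot> (v \<cdot> x) \<in> A 0" if "v \<in> A 0" for v
      using A_mult[OF xA A_mult[OF that ix]] A_mult[OF ix A_mult[OF that xA]] by simp_all
    from this(1)[of "iv x \<cdot> _"] this(2)[of "_ \<cdot> iv x"] have "A 0 \<star> {x} = {x} \<star> A 0" by auto
    moreover have "A (- q) = A 0 \<star> {iv x}"
    proof -
      have "y \<cdot> x \<in> A 0" if "y \<in> A (- q)" for y using A_mult[OF that xA] by simp
      moreover have "y \<in> A (- q)" if "y \<cdot> x \<in> A 0" for y using A_mult[OF that ix] by simp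
      ultimately show ?thesis by auto
    qed
    ultimately show ?thesis using WV by (simp add: W_def)
  qed
qed

lemma cone_a_multiplicative: assumes "cone_a r" shows "multiplicative r" "multiplicative (- r)"
proof -
  obtain x where x: "A r = A 0 \<star> {x}" "A (- r) = A 0 \<star> {iv x}" using assms by (auto simp: cone_a_def)
  have "x \<in> A r" "iv x \<in> A (- r)" unfolding x using e_in_A by simp_all
  then have "A r \<star> A q = A (r + q)" "A (- r) \<star> A q = A (- r + q)" for q
    using unit_sprod[of x r q] unit_sprod[of "iv x" "- r" q] by simp_all
  then show "multiplicative r" "multiplicative (- r)" by 
    (auto intro!: multiplicative_leftI simp: ring_distribs simp del: add_uminus_conv_diff)
qed

lemma cone_a_multiples:
  assumes r: "cone_a r" and n: "1 \<le> (n::nat)" shows "cone_a (of_nat n * r)"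
  using n
proof (induction n rule: nat_induct_at_least)
  case base
  then show ?case using r by simp
next
  case (Suc n)
  obtain x where x: "deg x = r" "A r = A 0 \<star> {x}" "A 0 \<star> {x} = {x} \<star> A 0" "A (- r) = A 0 \<star> {iv x}"
    using r by (auto simp: cone_a_def)
  let ?q = "of_nat n * r"
  obtain y where y: "deg y = ?q" "A ?q = A 0 \<star> {y}" "A 0 \<star> {y} = {y} \<star> A 0" "A (- ?q) = A 0 \<star> {iv y}"
    using Suc by (auto simp: cone_a_def)
  have xy: "A 0 \<star> {x \<cdot> y} = {x \<cdot> y} \<star> A 0"
  proof -
    have "A 0 \<star> {x \<cdot> y} = A 0 \<star> {x} \<star> {y}" by simp
    also have "\<dots> = {x} \<star> (A 0 \<star> {y})" unfolding x(3) by simp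
    also have "\<dots> = {x \<cdot> y} \<star> A 0" unfolding y(3) by simp
    finally show ?thesis .
  qed
  have "x \<in> A r" "iv x \<in> A (- r)" unfolding x using e_in_A by simp_all
  then have "A (r + ?q) = A r \<star> A ?q" using unit_sprod[of x r ?q] by simp
  also have "\<dots> = A 0 \<star> ({x} \<star> A 0) \<star> {y}" by (simp add: x(2) y(2))
  also have "\<dots> = A 0 \<star> A 0 \<star> {x \<cdot> y}" unfolding x(3)[symmetric] by simp
  finally have 1: "A (r + ?q) = A 0 \<star> {x \<cdot> y}" using overring_idem[OF overring_A0] by simp
  have "y \<in> A ?q" "iv y \<in> A (- ?q)" unfolding y using e_in_A by simp_all
  then have "A (- ?q + - r) = A (- ?q) \<star> A (- r)" using unit_sprod[of "iv y" "- ?q" "- r"] by simp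
  also have "\<dots> = A 0 \<star> ({iv y} \<star> A 0) \<star> {iv x}" by (simp add: x(4) y(4))
  also have "{iv y} \<star> A 0 = A 0 \<star> {iv y}" using y(3) by (auto simp: translate_swap)
  also have "A 0 \<star> (A 0 \<star> {iv y}) \<star> {iv x} = A 0 \<star> A 0 \<star> {iv (x \<cdot> y)}" by simp
  finally have 2: "A (- ?q + - r) = A 0 \<star> {iv (x \<cdot> y)}"
    unfolding overring_idem[OF overring_A0] .
  have "of_nat (Suc n) * r = r + ?q" "- (r + ?q) = - ?q + - r" by (simp_all add: ring_distribs)
  then show ?case using 1 2 xy x(1) y(1) unfolding cone_a_def by (intro exI[of _ "x \<cdot> y"]) (simp only: deg_simps)
qed

lemma cone_b_iff: "cone_b q \<longleftrightarrow> (\<exists>x W. left_principal q x W \<and> shrinks x W)"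
proof
  assume "cone_b q"
  then obtain x where x: "A q = OL (A q) \<star> {x}" "{x} \<star> OL (A q) \<subset> OL (A q) \<star> {x}"
    by (auto simp: cone_b_def)
  have W: "overring (OL (A q))" by (rule overring_OL_A)
  have "x \<in> OL (A q) \<star> {x}" using overring_e[OF W] by simp
  then have dx: "deg x = q" using x(1) A_deg by blast
  have "A (- q) = {iv x} \<star> Jac (OL (A q))" using principal_dichotomy[OF dx x(1)] x(2) by auto
  moreover have "x \<cdot> (w \<cdot> iv x) \<in> OL (A q)" if "w \<in> OL (A q)" for w
    using psubset_imp_subset[OF x(2)] that by (auto dest: subsetD[of _ _ "x \<cdot> w"])
  ultimately have "left_principal q x (OL (A q))" using W dx x(1) by (simp add: left_principal_def)
  moreover have "shrinks x (OL (A q))"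
  proof -
    obtain s where "s \<in> OL (A q) \<star> {x}" "s \<notin> {x} \<star> OL (A q)" using x(2) by blast
    then have s: "s \<cdot> iv x \<in> OL (A q)" "iv x \<cdot> s \<notin> OL (A q)" by simp_all
    then show ?thesis unfolding shrinks_def by (intro bexI[of _ "s \<cdot> iv x"]) auto
  qed
  ultimately show "\<exists>x W. left_principal q x W \<and> shrinks x W" by blast
next
  assume "\<exists>x W. left_principal q x W \<and> shrinks x W"
  then obtain x W where x: "left_principal q x W" "shrinks x W" by blast
  then have W: "overring W" and Aq: "A q = W \<star> {x}" by (auto simp: left_principal_def)
  have OL: "OL (A q) = W" unfolding Aq by (rule OL_overring_right[OF W])
  obtain w where w: "w \<in> W" "iv x \<cdot> (w \<cdot> x) \<notin> W" using x(2) by (auto simp: shrinks_def)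
  have "w \<cdot> iv x \<in> W" if "iv x \<cdot> w \<in> W" for w
    using x(1) that by (auto simp: left_principal_def dest: bspec[of _ _ "iv x \<cdot> w"])
  moreover have "w \<cdot> x \<in> W \<star> {x}" "w \<cdot> x \<notin> {x} \<star> W" using w by simp_all
  ultimately have "{x} \<star> W \<subset> W \<star> {x}" by auto
  then show "cone_b q" unfolding cone_b_def OL using Aq by blast
qed

text \<open>
  This conjugate is the right order of \<open>A q = W x\<close>.
\<close>

lemma OL_A_conj:
  assumes "A q = OL (A q) \<star> {x}"
  shows "overring ({iv x} \<star> (OL (A q) \<star> {x}))"
proof (rule overring_conj[OF overring_OL_A])
  have W: "overring (OL (A q))" by (rule overring_OL_A)
  fix v assume v: "v \<in> A 0"
  have "x \<in> OL (A q) \<star> {x}" using overring_e[OF W] by simp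
  then have "x \<in> A q" using assms by simp
  from A_mult[OF this v] have "x \<cdot> v \<in> OL (A q) \<star> {x}" using assms by simp
  then show "x \<cdot> v \<cdot> iv x \<in> OL (A q)" by simp
qed

text \<open>
  Replacing \<open>W\<close> by the right order \<open>U = x\<^sup>-\<^sup>1 W x\<close> writes \<open>W x\<close> as \<open>x U\<close> and turns
  \<open>W x \<subset> x W\<close> into the mirror image of Type (b).
\<close>

lemma cone_c_iff: "cone_c q \<longleftrightarrow> (\<exists>x W. right_principal q x W \<and> shrinks (iv x) W)"
proof
  assume "cone_c q"
  then obtain x where x: "A q = OL (A q) \<star> {x}" "OL (A q) \<star> {x} \<subset> {x} \<star> OL (A q)"
    by (auto simp: cone_c_def)
  define W where "W = OL (A q)"
  have W: "overring W" unfolding W_def by (rule overring_OL_A)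
  have Aq: "A q = W \<star> {x}" and ss: "W \<star> {x} \<subset> {x} \<star> W" using x by (simp_all add: W_def)
  have "x \<in> W \<star> {x}" using overring_e[OF W] by simp
  then have dx: "deg x = q" using Aq A_deg by blast
  define U where "U = {iv x} \<star> (W \<star> {x})"
  have U: "overring U" using OL_A_conj[OF x(1)] by (simp add: U_def W_def)
  have "A (- q) = {iv x} \<star> Jac W" using principal_dichotomy[OF dx x(1)] x(2) by (auto simp: W_def)
  also have "\<dots> = Jac U \<star> {iv x}" unfolding U_def by (simp add: Jac_conj)
  finally have neg: "A (- q) = Jac U \<star> {iv x}" .
  have Aq': "A q = {x} \<star> U" by (simp add: U_def Aq)
  have UW: "u \<in> W" if "u \<in> U" for u
    using psubset_imp_subset[OF ss] that by (auto simp: U_def dest: subsetD[of _ _ "x \<cdot> u"])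
  then have "iv x \<cdot> (u \<cdot> x) \<in> U" if "u \<in> U" for u using that by (simp add: U_def)
  then have "right_principal q x U" using U dx Aq' neg by (simp add: right_principal_def)
  moreover have "shrinks (iv x) U"
  proof -
    \<comment> \<open>For \<open>s\<close> in \<open>x W\<close> but not in \<open>W x\<close>, conjugation by \<open>x\<close> takes \<open>x\<^sup>-\<^sup>2 s x\<close> in \<open>U\<close> out of \<open>U\<close>.\<close>
    obtain s where "s \<notin> W \<star> {x}" "s \<in> {x} \<star> W" using ss by blast
    then have s: "s \<cdot> iv x \<notin> W" "iv x \<cdot> s \<in> W" by simp_all
    then show ?thesis unfolding shrinks_def U_def by (intro bexI[of _ "iv x \<cdot> (iv x \<cdot> (s \<cdot> x))"]) auto
  qed
  ultimately show "\<exists>x W. right_principal q x W \<and> shrinks (iv x) W" by blast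
next
  assume "\<exists>x W. right_principal q x W \<and> shrinks (iv x) W"
  then obtain x U where x: "right_principal q x U" "shrinks (iv x) U" by blast
  then have U: "overring U" and Aq: "A q = {x} \<star> U" by (auto simp: right_principal_def)
  have OL: "OL (A q) = {x} \<star> (U \<star> {iv x})" unfolding Aq using OL_conj_overring[OF U, of x e] by simp
  obtain u where u: "u \<in> U" "x \<cdot> (u \<cdot> iv x) \<notin> U" using x(2) by (auto simp: shrinks_def)
  have "iv x \<cdot> (u \<cdot> x) \<in> U" if "u \<in> U" for u
    using x(1) that by (auto simp: right_principal_def)
  from this[of "iv x \<cdot> _"] have "{x} \<star> U \<subseteq> {x} \<star> ({x} \<star> (U \<star> {iv x}))" by auto
  moreover have "x \<cdot> (x \<cdot> (u \<cdot> iv x)) \<notin> {x} \<star> U" "x \<cdot> (x \<cdot> (u \<cdot> iv x)) \<in> {x} \<star> ({x} \<star> (U \<star> {iv x}))"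
    using u by simp_all
  then have "{x} \<star> U \<noteq> {x} \<star> ({x} \<star> (U \<star> {iv x}))" by blast
  ultimately have "{x} \<star> (U \<star> {iv x}) \<star> {x} \<subset> {x} \<star> ({x} \<star> (U \<star> {iv x}))" by auto
  moreover have "A q = {x} \<star> (U \<star> {iv x}) \<star> {x}" using Aq by simp
  ultimately show "cone_c q" unfolding cone_c_def OL using Aq by (intro exI[of _ x]) (simp only: simp_thms)
qed

lemma cone_d_iff: "cone_d q \<longleftrightarrow> (\<exists>x W. left_principal q x W \<and> \<not> shrinks x W \<and> Jac W \<star> Jac W = Jac W)"
proof
  assume "cone_d q"
  then obtain x where x: "A q = OL (A q) \<star> {x}" "OL (A q) \<star> {x} = {x} \<star> OL (A q)"
      "A (- q) = Jac (OL (A q)) \<star> {iv x}" and J: "Jac (OL (A q)) \<star> Jac (OL (A q)) = Jac (OL (A q))"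
    by (auto simp: cone_d_def)
  define W where "W = OL (A q)"
  have W: "overring W" unfolding W_def by (rule overring_OL_A)
  have "x \<in> W \<star> {x}" using overring_e[OF W] by simp
  then have dx: "deg x = q" using x(1) A_deg by (auto simp: W_def)
  have Aq: "A q = W \<star> {x}" and Wx: "W \<star> {x} = {x} \<star> W" and neg: "A (- q) = Jac W \<star> {iv x}"
    and JW: "Jac W \<star> Jac W = Jac W"
    using x J unfolding W_def by blast+
  have c: "w \<cdot> iv x \<in> W \<longleftrightarrow> iv x \<cdot> w \<in> W" for w
    using arg_cong[OF Wx, of "\<lambda>S. w \<in> S"] by simp
  have "A (- q) = {iv x} \<star> Jac W"
    unfolding neg using c[of "x \<cdot> (_ \<cdot> x)"] c[of "iv _"] by (auto simp: Jac_def)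
  moreover have "x \<cdot> (w \<cdot> iv x) \<in> W" "iv x \<cdot> (w \<cdot> x) \<in> W" if "w \<in> W" for w
    using c[of "x \<cdot> w"] c[of "w \<cdot> x"] that by simp_all
  ultimately show "\<exists>x W. left_principal q x W \<and> \<not> shrinks x W \<and> Jac W \<star> Jac W = Jac W"
    using W dx Aq JW by (intro exI[of _ x] exI[of _ W]) (simp add: left_principal_def shrinks_def)
next
  assume "\<exists>x W. left_principal q x W \<and> \<not> shrinks x W \<and> Jac W \<star> Jac W = Jac W"
  then obtain x W where x: "left_principal q x W" "\<not> shrinks x W" "Jac W \<star> Jac W = Jac W" by blast
  then have W: "overring W" and Aq: "A q = W \<star> {x}" and neg: "A (- q) = {iv x} \<star> Jac W"
    by (auto simp: left_principal_def)
  have OL: "OL (A q) = W" unfolding Aq by (rule OL_overring_right[OF W])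
  have "x \<cdot> (w \<cdot> iv x) \<in> W" "iv x \<cdot> (w \<cdot> x) \<in> W" if "w \<in> W" for w
    using x(1,2) that by (auto simp: left_principal_def shrinks_def)
  from this(1)[of "iv x \<cdot> _"] this(2)[of "_ \<cdot> iv x"]
  have c: "w \<cdot> iv x \<in> W \<longleftrightarrow> iv x \<cdot> w \<in> W" for w by auto
  then have "W \<star> {x} = {x} \<star> W" by auto
  moreover have "A (- q) = Jac W \<star> {iv x}"
    unfolding neg using c[of "x \<cdot> (_ \<cdot> x)"] c[of "iv _"] by (auto simp: Jac_def)
  ultimately show "cone_d q" unfolding cone_d_def OL using Aq x(3) by blast
qed

lemma cone_b_multiplicative: "cone_b r \<Longrightarrow> multiplicative r" "cone_b r \<Longrightarrow> multiplicative (- r)"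
  unfolding cone_b_iff using left_principal_multiplicative by blast+

lemma cone_c_multiplicative: "cone_c r \<Longrightarrow> multiplicative r" "cone_c r \<Longrightarrow> multiplicative (- r)"
  unfolding cone_c_iff using right_principal_multiplicative by blast+

lemma cone_d_multiplicative: "cone_d r \<Longrightarrow> multiplicative r" "cone_d r \<Longrightarrow> multiplicative (- r)"
  unfolding cone_d_iff using left_principal_multiplicative by blast+

lemma cone_b_multiples: "cone_b r \<Longrightarrow> 1 \<le> n \<Longrightarrow> cone_b (of_nat n * r)"
  unfolding cone_b_iff using left_principal_multiples by blast

lemma cone_c_multiples: "cone_c r \<Longrightarrow> 1 \<le> n \<Longrightarrow> cone_c (of_nat n * r)"
  unfolding cone_c_iff using right_principal_multiples by blast

lemma cone_d_multiples: "cone_d r \<Longrightarrow> 1 \<le> n \<Longrightarrow> cone_d (of_nat n * r)"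
  unfolding cone_d_iff using left_principal_multiples by blast


text \<open>
  Otherwise \<open>d\<^sup>-\<^sup>1\<close> would generate the radical as a left ideal.
\<close>

lemma idempotent_Jac_conductor:
  assumes W: "overring W" and J: "Jac W \<star> Jac W = Jac W" and d: "deg d = 0"
    and c: "\<And>j. j \<in> Jac W \<Longrightarrow> j \<cdot> d \<in> W"
  shows "d \<in> W"
proof (rule ccontr)
  assume "d \<notin> W"
  then have i: "iv d \<in> Jac W" using overring_total[OF W d] by simp
  have "Jac W = W \<star> {iv d}" using c Jac_left[OF W _ i] by force
  then show False using Jac_idem_not_principal[OF W J] by blast
qed

section \<open>Type (f)\<close>

definition radical_component :: "rat \<Rightarrow> 'g \<Rightarrow> 'g set \<Rightarrow> bool" where
  "radical_component q x W \<longleftrightarrow> overring W \<and> deg x = q \<and> Jac W \<noteq> {} \<and> Jac W \<star> Jac W = Jac W \<and>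
     A q = Jac W \<star> {x} \<and> A (- q) = {iv x} \<star> W"

lemma star_empty: "star {} = {}"
  by (simp add: star_def)

text \<open>
  A component that is not star closed is \<open>J x\<close> with \<open>J\<close> not principal, and then an element of
  \<open>A (- q)\<close> outside \<open>x\<^sup>-\<^sup>1 W\<close> would make \<open>J\<close> principal.
\<close>

lemma cone_f_iff: "cone_f q \<longleftrightarrow> (\<exists>x W. radical_component q x W)"
proof
  assume "cone_f q"
  then have n: "star (A q) \<noteq> A q" by (auto simp: cone_f_def)
  define W where "W = OL (A q)"
  have W: "overring W" unfolding W_def by (rule overring_OL_A)
  obtain x where x: "deg x = q" "A q = Jac W \<star> {x}" "star (A q) = W \<star> {x}"
    unfolding W_def by (rule not_star_closed[OF A_deg overring_OL_A n])
  have "A q \<noteq> {}" using n star_empty by auto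
  then have J: "Jac W \<noteq> {}" using x(2) by auto
  have JJ: "Jac W \<star> Jac W = Jac W"
  proof (rule ccontr)
    assume "Jac W \<star> Jac W \<noteq> Jac W"
    then obtain c where "Jac W = W \<star> {c}" by (rule Jac_principal[OF W])
    then have "A q = W \<star> {c \<cdot> x}" using x(2) by simp
    then show False using n star_principal[OF W] by simp
  qed
  have "A (- q) = {iv x} \<star> W"
  proof (intro equalityI subsetI)
    fix y assume y: "y \<in> A (- q)"
    have "j \<cdot> (x \<cdot> y) \<in> W" if "j \<in> Jac W" for j
    proof -
      have "j \<cdot> x \<in> A q" using x(2) that by simp
      from A_mult[OF this y] show ?thesis using W by (auto simp: overring_def)
    qed
    then show "y \<in> {iv x} \<star> W" using idempotent_Jac_conductor[OF W JJ, of "x \<cdot> y"] y x(1) A_deg by simp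
  next
    fix y assume y: "y \<in> {iv x} \<star> W"
    then have "iv y \<cdot> iv x \<notin> Jac W" by (simp add: Jac_def)
    then have "iv y \<notin> A q" using x(2) by simp
    moreover have "deg (iv y) = q" using y overring_deg[OF W, of "x \<cdot> y"] x(1) by simp
    ultimately show "y \<in> A (- q)" using A_total[of "iv y" q] by simp
  qed
  then show "\<exists>x W. radical_component q x W" unfolding radical_component_def using W x J JJ by blast
next
  assume "\<exists>x W. radical_component q x W"
  then obtain x W where W: "overring W" and J: "Jac W \<noteq> {}" "Jac W \<star> Jac W = Jac W"
    and Aq: "A q = Jac W \<star> {x}" by (auto simp: radical_component_def)
  have "x \<notin> Jac W \<star> {x}" "x \<in> W \<star> {x}" using Jac_e overring_e[OF W] by simp_all
  then show "cone_f q"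
    unfolding cone_f_def Aq star_Jac_idem[OF W J] using Jac_subset[of W] by auto
qed

text \<open>
  With \<open>U = x\<^sup>-\<^sup>1 W x\<close> the component of degree \<open>-q\<close> is \<open>x\<^sup>-\<^sup>1 W = U x\<^sup>-\<^sup>1\<close>. Both \<open>U\<close> and \<open>W\<close> are
  overrings, so one contains the other, and the larger one decides from which side the component
  is to be viewed as principal.
\<close>

lemma radical_component_negative:
  assumes "radical_component q x W"
  shows "(\<exists>U. overring W \<and> Jac U \<noteq> {} \<and> Jac U \<star> Jac U = Jac U \<and> left_principal (- q) (iv x) U) \<or>
    right_principal (- q) (iv x) W \<and> Jac W \<noteq> {} \<and> Jac W \<star> Jac W = Jac W"
proof -
  have W: "overring W" and dx: "deg x = q" and J: "Jac W \<noteq> {}" "Jac W \<star> Jac W = Jac W"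
    and Aq: "A q = Jac W \<star> {x}" "A (- q) = {iv x} \<star> W" using assms by (auto simp: radical_component_def)
  define U where "U = {iv x} \<star> (W \<star> {x})"
  have U: "overring U" unfolding U_def
  proof (rule overring_conj[OF W])
    fix v assume v: "v \<in> A 0"
    show "x \<cdot> v \<cdot> iv x \<in> W"
    proof (rule idempotent_Jac_conductor[OF W J(2)])
      show "deg (x \<cdot> v \<cdot> iv x) = 0" using v A_deg by simp
      fix j assume "j \<in> Jac W"
      then have "j \<cdot> x \<in> A q" using Aq by simp
      from A_mult[OF this v] show "j \<cdot> (x \<cdot> v \<cdot> iv x) \<in> W" using Aq Jac_subset by auto
    qed
  qed
  have JU: "Jac U = {iv x} \<star> (Jac W \<star> {x})" unfolding U_def by (simp add: Jac_conj)
  show ?thesis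
  proof (cases "U \<subseteq> W")
    case True
    have "iv x \<cdot> (w \<cdot> x) \<in> U" if "w \<in> U" for w using True that by (auto simp: U_def)
    then have "left_principal (- q) (iv x) U" using U dx Aq JU by (simp add: left_principal_def) (simp add: U_def)
    then show ?thesis using W Jac_conj_idem[OF J, of x, folded U_def] by blast
  next
    case False
    then have WU: "W \<subseteq> U" using overring_chain[OF U W] by blast
    have "x \<cdot> (w \<cdot> iv x) \<in> W" if "w \<in> W" for w using subsetD[OF WU that] by (simp add: U_def)
    then have "right_principal (- q) (iv x) W" using W dx Aq by (simp add: right_principal_def)
    then show ?thesis using J by blast
  qed
qed

lemma cone_f_multiplicative: assumes "cone_f r" shows "multiplicative r" "multiplicative (- r)"
proof -
  obtain x W where "radical_component r x W" using assms cone_f_iff by blast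
  from radical_component_negative[OF this] show "multiplicative r" "multiplicative (- r)"
    using left_principal_multiplicative[of "- r" "iv x"] right_principal_multiplicative[of "- r" "iv x" W] by auto
qed

text \<open>
  Passing to negative degrees and back turns the radical of \<open>U\<close> on the right of \<open>y\<^sup>-\<^sup>1\<close> into the
  radical of the conjugate \<open>y\<^sup>-\<^sup>1 U y\<close> on its left.
\<close>

lemma cone_f_multiples: assumes "cone_f r" "1 \<le> (n::nat)" shows "cone_f (of_nat n * r)"
proof -
  let ?q = "of_nat n * r"
  have q: "of_nat n * - r = - ?q" by simp
  obtain x W where "radical_component r x W" using assms cone_f_iff by blast
  from radical_component_negative[OF this] have "\<exists>x W. radical_component ?q x W"
  proof (elim disjE exE conjE)
    fix U assume J: "Jac U \<noteq> {}" "Jac U \<star> Jac U = Jac U" and U: "left_principal (- r) (iv x) U"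
    then obtain y where y: "left_principal (- ?q) y U"
      using left_principal_multiples[OF U _ assms(2)] unfolding q by blast
    then have oU: "overring U" and dy: "deg y = - ?q" and Aq: "A (- ?q) = U \<star> {y}" "A ?q = {iv y} \<star> Jac U"
      by (auto simp: left_principal_def)
    define W where "W = {iv y} \<star> (U \<star> {y})"
    have "OL (A ?q) = {iv y} \<star> (OL (Jac U \<star> {e}) \<star> {y})" unfolding Aq OL_translate by simp
    also have "\<dots> = W" unfolding OL_Jac_right[OF oU J(1)] W_def ..
    finally have W: "overring W" using overring_OL_A by metis
    have JW: "Jac W = {iv y} \<star> (Jac U \<star> {y})" unfolding W_def by (rule Jac_conj)
    have "A ?q = Jac W \<star> {iv y}" unfolding Aq JW by simp
    moreover have "A (- ?q) = {y} \<star> W" unfolding Aq W_def by simp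
    ultimately have "radical_component ?q (iv y) W"
      using W dy Jac_conj_idem[OF J, of y, folded W_def] unfolding radical_component_def by simp
    then show ?thesis by blast
  next
    assume U: "right_principal (- r) (iv x) W" and J: "Jac W \<noteq> {}" "Jac W \<star> Jac W = Jac W" 
    then obtain y where y: "right_principal (- ?q) y W"
      using right_principal_multiples[OF U _ assms(2)] unfolding q by blast
    then have "radical_component ?q (iv y) W" using J by (auto simp: radical_component_def right_principal_def)
    then show ?thesis by blast
  qed
  then show ?thesis using cone_f_iff by blast
qed


section \<open>Type (g)\<close>

lemma multiplicative_spow:
  assumes "multiplicative r" "1 \<le> (n::nat)" shows "spow (A r) n = A (of_nat n * r)"
  using assms(2)
proof (induction n rule: nat_induct_at_least)
  case base
  then show ?case by simp
next
  case (Suc n)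
  then show ?case using assms(1)[unfolded multiplicative_def, rule_format, of n 1] by simp
qed

lemma multiplicative_multiples: "multiplicative r \<Longrightarrow> 1 \<le> (n::nat) \<Longrightarrow> multiplicative (of_nat n * r)"
  unfolding multiplicative_def
proof (intro allI impI)
  fix i j :: nat assume *: "\<forall>i j. 1 \<le> i \<longrightarrow> 1 \<le> j \<longrightarrow>
     A (of_nat i * r) \<star> A (of_nat j * r) = A (of_nat (i + j) * r)" and "1 \<le> n" "1 \<le> i" "1 \<le> j"
  then show "A (of_nat i * (of_nat n * r)) \<star> A (of_nat j * (of_nat n * r)) = A (of_nat (i + j) * (of_nat n * r))"
    using *[rule_format, of "i * n" "j * n"] by (simp add: ring_distribs mult.assoc)
qed

lemma spow_commute: "S \<star> spow S n = spow S n \<star> S"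
  by (induction n) (simp_all flip: sprod_assoc)

lemma spow_empty: "1 \<le> i \<Longrightarrow> spow {} i = {}"
  by (cases i) auto

lemma spow_nonempty: "S \<noteq> {} \<Longrightarrow> spow S n \<noteq> {}"
  by (induction n) (auto simp: sprod_def)

text \<open>
  All powers and their closures are empty, whereas a principal module is not.
\<close>

lemma cone_g_empty: assumes "A q = {}" shows "cone_g q"
proof -
  have "e \<in> OL (A q)" using overring_OL_A overring_e by blast
  then have "c \<in> OL (A q) \<star> {c}" for c by simp
  then have "OL (A q) \<star> {c} \<noteq> {}" for c by blast
  then show ?thesis using assms by (auto simp: cone_g_def star_empty spow_empty)
qed

definition nonprincipal :: "rat \<Rightarrow> bool" where
  "nonprincipal r \<longleftrightarrow> A r \<noteq> {} \<and> star (A r) = A r \<and> (\<forall>x. A r \<noteq> OL (A r) \<star> {x})"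

lemma cone_g_nonprincipal: "cone_g r \<Longrightarrow> A r \<noteq> {} \<Longrightarrow> nonprincipal r"
  unfolding cone_g_def nonprincipal_def by (metis One_nat_def order_refl spow.simps translate_simps(1))

lemma OL_mult: "v \<in> OL S \<Longrightarrow> s \<in> S \<Longrightarrow> v \<cdot> s \<in> S"
  by (simp add: OL_def)

lemma A_0_subset_OL: "v \<in> A 0 \<Longrightarrow> v \<in> OL (A r)"
  using overring_OL_A[of r] unfolding overring_def by blast

text \<open>
  A unit \<open>x\<close> of \<open>P\<close> in degree \<open>r\<close> would give \<open>A r = W x\<close>.
\<close>

lemma nonprincipal_no_unit:
  assumes "nonprincipal r" "x \<in> A r" shows "iv x \<notin> A (- r)"
proof
  assume i: "iv x \<in> A (- r)"
  have "s \<cdot> iv x \<in> OL (A r)" if "s \<in> A r" for s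
    using A_0_subset_OL A_mult[OF that i] by simp
  moreover have "s \<in> A r" if "s \<cdot> iv x \<in> OL (A r)" for s
    using OL_mult[OF that assms(2)] by simp
  ultimately have "A r = OL (A r) \<star> {x}" by auto
  then show False using assms(1) by (auto simp: nonprincipal_def)
qed

text \<open>
  As \<open>W b\<close> is not all of the component, there is \<open>b'\<close> outside it, and \<open>b = (b b'\<^sup>-\<^sup>1) b'\<close>.
\<close>

lemma nonprincipal_Jac_left:
  assumes "nonprincipal r" shows "Jac (OL (A r)) \<star> A r = A r"
proof (intro equalityI subsetI)
  fix b assume "b \<in> Jac (OL (A r)) \<star> A r"
  then show "b \<in> A r" using OL_mult Jac_subset by (blast elim!: sprodE)
next
  fix b assume b: "b \<in> A r"
  have "\<not> A r \<subseteq> OL (A r) \<star> {b}"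
  proof
    assume "A r \<subseteq> OL (A r) \<star> {b}"
    moreover have "s \<in> A r" if "s \<cdot> iv b \<in> OL (A r)" for s using OL_mult[OF that b] by simp
    ultimately have "A r = OL (A r) \<star> {b}" by auto
    then show False using assms by (auto simp: nonprincipal_def)
  qed
  then obtain b' where "b' \<in> A r" "b' \<notin> OL (A r) \<star> {b}" by blast
  then have b': "b' \<in> A r" "b' \<cdot> iv b \<notin> OL (A r)" by simp_all
  then have "b \<cdot> iv b' \<in> Jac (OL (A r))"
    using overring_total[OF overring_OL_A _ b'(2)] A_deg b by simp
  from sprodI[OF this b'(1)] show "b \<in> Jac (OL (A r)) \<star> A r" by simp
qed

text \<open>
  Here being star closed is essential: for \<open>v\<close> in degree \<open>-r\<close> the inverse \<open>v\<^sup>-\<^sup>1\<close> is excluded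
  from \<open>A r\<close>, hence from some \<open>W x\<close> containing \<open>A r\<close>. Then \<open>x\<close> is not in \<open>A r\<close>, so \<open>x\<^sup>-\<^sup>1\<close> is in
  \<open>A (- r)\<close>, and \<open>v = x\<^sup>-\<^sup>1 (x v)\<close>.
\<close>

lemma nonprincipal_Jac_right:
  assumes "nonprincipal r" shows "A (- r) \<star> Jac (OL (A r)) = A (- r)"
proof (intro equalityI subsetI)
  define W where "W = OL (A r)"
  have W: "overring W" unfolding W_def by (rule overring_OL_A)
  {
    fix y assume "y \<in> A (- r) \<star> Jac (OL (A r))"
    then obtain v j where y: "y = v \<cdot> j" "v \<in> A (- r)" "j \<in> W" using Jac_subset by (auto simp: W_def elim!: sprodE)
    show "y \<in> A (- r)"
    proof (rule ccontr)
      assume "y \<notin> A (- r)"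
      then have "iv j \<cdot> iv v \<in> A r" using A_total[of y "- r"] y A_deg overring_deg[OF W] by simp
      then have "j \<cdot> (iv j \<cdot> iv v) \<in> A r" using y(3) OL_mult unfolding W_def by blast
      then show False using nonprincipal_no_unit[OF assms, of "iv v"] y(2) by simp
    qed
  next
    fix v assume v: "v \<in> A (- r)"
    then have "iv v \<notin> A r" using nonprincipal_no_unit[OF assms, of "iv v"] by auto
    then have ns: "iv v \<notin> star (A r)" using assms by (simp add: nonprincipal_def)
    obtain b where b: "b \<in> A r" using assms by (auto simp: nonprincipal_def)
    then have "deg (iv v) = deg b" using v A_deg by simp
    then obtain x where x: "A r \<subseteq> W \<star> {x}" "iv v \<notin> W \<star> {x}"
      using ns b unfolding star_def W_def by blast
    have "b \<cdot> iv x \<in> W" using x(1) b by auto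
    then have dx: "deg x = r" using overring_deg[OF W, of "b \<cdot> iv x"] b A_deg by simp
    have "x \<notin> A r"
    proof
      assume "x \<in> A r"
      then have "s \<in> A r" if "s \<cdot> iv x \<in> W" for s using OL_mult[of "s \<cdot> iv x" "A r" x] that by (simp add: W_def)
      then have "A r = W \<star> {x}" using x(1) by auto
      then show False using assms by (auto simp: nonprincipal_def W_def)
    qed
    then have ix: "iv x \<in> A (- r)" using A_total[OF dx] by blast
    have "x \<cdot> v \<in> Jac W" using overring_total[OF W, of "iv v \<cdot> iv x"] x(2) dx v A_deg by simp
    from sprodI[OF ix this] show "v \<in> A (- r) \<star> Jac (OL (A r))" by (simp add: W_def)
  }
qed

text \<open>
  An element \<open>j\<close> of the radical has \<open>j\<^sup>-\<^sup>1\<close> outside the order, so \<open>j\<^sup>-\<^sup>1 b\<close> leaves \<open>A r\<close> for some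
  \<open>b\<close>, and \<open>j = b (b\<^sup>-\<^sup>1 j)\<close>.
\<close>

lemma nonprincipal_inverse:
  assumes "nonprincipal r" shows "A r \<star> A (- r) = Jac (OL (A r))"
proof (intro equalityI subsetI)
  fix y assume "y \<in> A r \<star> A (- r)"
  then obtain b c where y: "y = b \<cdot> c" "b \<in> A r" "c \<in> A (- r)" by (auto elim!: sprodE)
  have "b \<cdot> c \<in> OL (A r)" using A_0_subset_OL A_mult[OF y(2,3)] by simp
  moreover have "iv (b \<cdot> c) \<notin> OL (A r)"
  proof
    assume "iv (b \<cdot> c) \<in> OL (A r)"
    from OL_mult[OF this y(2)] have "iv c \<in> A r" by simp
    then show False using nonprincipal_no_unit[OF assms, of "iv c"] y(3) by simp
  qed
  ultimately show "y \<in> Jac (OL (A r))" by (simp add: Jac_def y(1))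
next
  fix j assume j: "j \<in> Jac (OL (A r))"
  then have "iv j \<notin> OL (A r)" "deg j = 0" using Jac_subset by (auto simp: Jac_def OL_def)
  then obtain b where b: "b \<in> A r" "iv j \<cdot> b \<notin> A r" by (auto simp: OL_def)
  then have "iv b \<cdot> j \<in> A (- r)" using A_total[of "iv j \<cdot> b" r] \<open>deg j = 0\<close> A_deg by simp
  from sprodI[OF b(1) this] show "j \<in> A r \<star> A (- r)" by simp
qed

text \<open>
  A failure gives \<open>A (n r) = A (- r) z\<close>, up to replacing \<open>z\<close> by its inverse. Multiplying by \<open>A r\<close>
  yields a power of \<open>A r\<close> equal to \<open>J z\<close>, and the closure of \<open>J z\<close> is principal whether or not \<open>J\<close> is. The
  zero component is covered by the principal component of degree \<open>-r\<close>, which is everything.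
\<close>

lemma cone_g_multiplicative: assumes "cone_g r" shows "multiplicative r" "multiplicative (- r)"
proof -
  have "multiplicative r \<and> multiplicative (- r)"
  proof (cases "A r = {}")
    case True
    obtain x where x: "deg x = - r" using deg_surj by blast
    \<comment> \<open>The component of degree \<open>-r\<close> is principal over the full degree zero part, whose radical is empty.\<close>
    define W where "W = {w. deg w = 0}"
    have W: "overring W" by (auto simp: W_def overring_def A_deg)
    have J: "Jac W = {}" by (auto simp: W_def Jac_def)
    have "y \<in> A (- r)" if "deg y = - r" for y using A_total[of "iv y" r] True that by auto
    then have "A (- r) = W \<star> {x}" using x A_deg by (auto simp: W_def)
    then have "left_principal (- r) x W" using W x J True by (auto simp: left_principal_def W_def)
    from left_principal_multiplicative[OF this] J show ?thesis by simp
  next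
    case False
    define W where "W = OL (A r)"
    have W: "overring W" unfolding W_def by (rule overring_OL_A)
    have nonprincipal: "nonprincipal r" using cone_g_nonprincipal[OF assms False] .
    have key: False if n: "A (of_nat n * r) = spow (A r) n" "A (of_nat n * r) = A (- r) \<star> {z}" for n z
    proof -
      have "spow (A r) (Suc n) = A r \<star> A (- r) \<star> {z}" using n spow_commute[of "A r" n] by simp
      also have "\<dots> = Jac W \<star> {z}" using nonprincipal_inverse[OF nonprincipal] by (simp only: W_def)
      finally have s: "spow (A r) (Suc n) = Jac W \<star> {z}" .
      moreover have "spow (A r) (Suc n) \<noteq> {}" using spow_nonempty[OF False] .
      ultimately have "Jac W \<noteq> {}" by auto
      from star_Jac[OF W this] obtain c where "star (Jac W \<star> {z}) = W \<star> {c}" .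
      then have "star (spow (A r) (Suc n)) = OL (A r) \<star> {c}" unfolding s W_def .
      then show False using assms unfolding cone_g_def by (metis le_add1 plus_1_eq_Suc)
    qed
    have Sn: "A r \<star> A (of_nat n * r) = A (of_nat (Suc n) * r)" if n: "A (of_nat n * r) = spow (A r) n" for n
    proof (rule ccontr)
      have s: "r + of_nat n * r = of_nat (Suc n) * r" by (simp add: ring_distribs)
      assume "A r \<star> A (of_nat n * r) \<noteq> A (of_nat (Suc n) * r)"
      then obtain z where "z \<in> A (r + of_nat n * r)" "z \<notin> A r \<star> A (of_nat n * r)"
        using A_sprod[of r "of_nat n * r"] unfolding s by blast
      from product_defect(1)[OF this] key[OF n] show False by blast
    qed
    have pw: "A (of_nat n * r) = spow (A r) n" if "1 \<le> n" for n using that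
    proof (induction n rule: nat_induct_at_least)
      case (Suc n)
      then show ?case using Sn[OF Suc.IH] spow_commute[of "A r" n] by simp
    qed simp
    have "A (of_nat n * - r) \<star> A (- r) = A (of_nat (Suc n) * - r)" if n: "1 \<le> n" for n
    proof (rule ccontr)
      have s: "- (of_nat n * r) + - r = of_nat (Suc n) * - r" "of_nat n * - r = - (of_nat n * r)"
        by (simp_all add: ring_distribs)
      assume "A (of_nat n * - r) \<star> A (- r) \<noteq> A (of_nat (Suc n) * - r)"
      then obtain z where z: "z \<in> A (- (of_nat n * r) + - r)" "z \<notin> A (- (of_nat n * r)) \<star> A (- r)"
        using A_sprod[of "- (of_nat n * r)" "- r"] unfolding s(2) s(1)[symmetric] by blast
      have "A (of_nat n * r) = A (- r) \<star> {iv z}"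
        using product_defect(1)[OF z] by (simp add: translate_swap)
      then show False using key pw[OF n] by blast
    qed
    then show ?thesis using multiplicative_leftI[OF Sn[OF pw]] multiplicative_rightI by blast
  qed
  then show "multiplicative r" "multiplicative (- r)" by simp_all
qed

section \<open>Every multiplicative degree has a type\<close>

text \<open>
  The component is not star closed, or empty, or principal, or nonprincipal and star closed. Only
  the last two cases need multiplicativity. For \<open>A r = W x = x W\<close> it yields \<open>J\<^sup>2 = J\<close>, as
  \<open>x\<^sup>-\<^sup>2 j\<close> lies in \<open>A (- 2 r)\<close> for all \<open>j\<close> in \<open>J\<close>. For a nonprincipal component \<open>S = A (i r)\<close> satisfies
  \<open>J S = S\<close>, which rules out \<open>S = W c\<close>. If \<open>S = J y\<close>, then \<open>y\<^sup>-\<^sup>1\<close> is in \<open>A (- i r)\<close>, hence of the form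
  \<open>a j\<close> with \<open>j\<close> in \<open>J\<close>, and \<open>S a \<subseteq> A 0\<close> says that \<open>j\<^sup>-\<^sup>1\<close> multiplies \<open>J\<close> into \<open>W\<close>;
  but \<open>J S = S\<close> gives \<open>J\<^sup>2 = J\<close>, and then only elements of \<open>W\<close> do so.
\<close>

lemma types_exhaustive:
  assumes l: "multiplicative r" "multiplicative (- r)"
  shows "cone_a r \<or> cone_b r \<or> cone_c r \<or> cone_d r \<or> cone_f r \<or> cone_g r"
proof -
  define W where "W = OL (A r)"
  have W: "overring W" unfolding W_def by (rule overring_OL_A)
  consider "A r \<noteq> star (A r)" | "A r = {}" | x where "A r = W \<star> {x}" | "nonprincipal r"
    by (metis nonprincipal_def W_def)
  then show ?thesis
  proof cases
    case 1
    then show ?thesis using star_superset by (auto simp: cone_f_def)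
  next
    case 2
    then show ?thesis by (simp add: cone_g_empty)
  next
    case (3 x)
    note Ar = 3
    then have xA: "x \<in> A r" using overring_e[OF W] by simp
    then have dx: "deg x = r" by (rule A_deg)
    show ?thesis
    proof (cases "A (- r) = {iv x} \<star> Jac W")
      case False
      then have d: "W = A 0" "A 0 \<star> {x} = {x} \<star> A 0" "A (- r) = A 0 \<star> {iv x}"
        using principal_dichotomy[OF dx Ar[unfolded W_def]] unfolding W_def by blast+
      then have "cone_a r" using dx Ar unfolding cone_a_def d(1) by blast
      then show ?thesis by blast
    next
      case neg: True
      define U where "U = {iv x} \<star> (W \<star> {x})"
      have U: "overring U" using OL_A_conj[OF Ar[unfolded W_def]] unfolding U_def W_def .
      have xU: "{x} \<star> U = W \<star> {x}" by (simp add: U_def)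
      consider "U \<subset> W" | "W \<subset> U" | "U = W" using overring_chain[OF U W] by blast
      then show ?thesis
      proof cases
        case 1
        then have "W \<star> {x} \<subset> {x} \<star> W" unfolding xU[symmetric] by (simp add: psubset_eq)
        then have "cone_c r" using Ar unfolding cone_c_def W_def by blast
        then show ?thesis by blast
      next
        case 2
        then have "{x} \<star> W \<subset> W \<star> {x}" unfolding xU[symmetric] by (simp add: psubset_eq)
        then have "cone_b r" using Ar unfolding cone_b_def W_def by blast
        then show ?thesis by blast
      next
        case 3
        then have "w \<in> W \<longleftrightarrow> w \<in> U" for w by simp
        then have c: "w \<in> W \<longleftrightarrow> x \<cdot> (w \<cdot> iv x) \<in> W" for w by (simp add: U_def)
        then have c': "w \<in> W \<longleftrightarrow> iv x \<cdot> (w \<cdot> x) \<in> W" for w using c[of "iv x \<cdot> (w \<cdot> x)"] by simp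
        have left_principal: "left_principal r x W" using W dx Ar neg c by (simp add: left_principal_def)
        have l2: "A r \<star> A r = A (2 * r)" "A (- r) \<star> A (- r) = A (- (2 * r))"
          using l[unfolded multiplicative_def, rule_format, of 1 1] by simp_all
        have "Jac W \<star> Jac W = Jac W"
        proof (intro equalityI subsetI)
          fix j assume "j \<in> Jac W \<star> Jac W"
          then show "j \<in> Jac W" using Jac_left[OF W] Jac_subset by (blast elim!: sprodE)
        next
          fix j assume j: "j \<in> Jac W"
          have "iv j \<cdot> (x \<cdot> x) \<notin> A (2 * r)"
          proof
            assume "iv j \<cdot> (x \<cdot> x) \<in> A (2 * r)"
            then obtain u v where "iv j \<cdot> (x \<cdot> x) = u \<cdot> v" "u \<in> W \<star> {x}" "v \<in> W \<star> {x}"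
              unfolding l2(1)[symmetric] Ar by (rule sprodE)
            then have uv: "iv j \<cdot> (x \<cdot> x) = u \<cdot> v" "u \<cdot> iv x \<in> W" "v \<cdot> iv x \<in> W" by simp_all
            \<comment> \<open>With \<open>u = w x\<close> and \<open>v = w' x\<close>, the element \<open>u v x\<^sup>-\<^sup>2\<close> equals \<open>w (x w' x\<^sup>-\<^sup>1)\<close>.\<close>
            have "u \<cdot> iv x \<cdot> (x \<cdot> (v \<cdot> iv x \<cdot> iv x)) \<in> W"
              by (rule overring_mult[OF W uv(2)]) (use uv(3) c[of "v \<cdot> iv x"] in simp)
            then have "u \<cdot> v \<cdot> (iv x \<cdot> iv x) \<in> W" by simp
            then have "iv j \<in> W" unfolding uv(1)[symmetric] by simp
            then show False using j by (simp add: Jac_def)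
          qed
          moreover have "deg j = 0" using j Jac_subset overring_deg[OF W] by blast
          ultimately have "iv x \<cdot> (iv x \<cdot> j) \<in> A (- r) \<star> A (- r)"
            unfolding l2(2) using A_total[of "iv j \<cdot> (x \<cdot> x)" "2 * r"] dx by simp
          then obtain u v where "iv x \<cdot> (iv x \<cdot> j) = u \<cdot> v" "u \<in> {iv x} \<star> Jac W" "v \<in> {iv x} \<star> Jac W"
            unfolding neg by (rule sprodE)
          then have uv: "iv x \<cdot> (iv x \<cdot> j) = u \<cdot> v" "x \<cdot> u \<in> Jac W" "x \<cdot> v \<in> Jac W" by simp_all
          have "x \<cdot> (x \<cdot> (u \<cdot> iv x)) \<in> Jac W"
            using uv(2) c[of "x \<cdot> u"] c[of "iv u \<cdot> iv x"] by (simp add: Jac_def)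
          from sprodI[OF this uv(3)] have "x \<cdot> (x \<cdot> (u \<cdot> v)) \<in> Jac W \<star> Jac W" by simp
          then show "j \<in> Jac W \<star> Jac W" unfolding uv(1)[symmetric] by simp
        qed
        moreover have "\<not> shrinks x W" using c' by (simp add: shrinks_def)
        ultimately have "cone_d r" using left_principal cone_d_iff by blast
        then show ?thesis by blast
      qed
    qed
  next
    case 4
    have False if i: "1 \<le> i" and st: "star (spow (A r) i) = W \<star> {c}" for i c
    proof -
      define S where "S = spow (A r) i"
      have S: "S = A (of_nat i * r)" unfolding S_def by (rule multiplicative_spow[OF l(1) i])
      obtain k where k: "i = Suc k" using i by (cases i) auto
      have "Jac W \<star> S = Jac W \<star> A r \<star> spow (A r) k"
        unfolding S_def k by (simp add: spow_commute)
      also have "\<dots> = S" unfolding W_def nonprincipal_Jac_left[OF 4] S_def k by (simp add: spow_commute)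
      finally have JS: "Jac W \<star> S = S" .
      have "S \<noteq> W \<star> {y}" for y
      proof
        assume y: "S = W \<star> {y}"
        have "Jac W \<star> {y} = S" using JS W unfolding y by (simp flip: sprod_assoc)
        moreover have "y \<in> S" using y overring_e[OF W] by simp
        ultimately show False using Jac_e by auto
      qed
      then have "star S \<noteq> S" using st S_def by metis
      moreover have "overring (OL S)" unfolding S by (rule overring_OL_A)
      ultimately obtain y where y: "deg y = of_nat i * r" "S = Jac (OL S) \<star> {y}" "star S = OL S \<star> {y}"
        using not_star_closed[of S "of_nat i * r"] A_deg S by metis
      have "OL S = W" using y(3) st OL_overring_right[OF W, of c] OL_overring_right[of "OL S" y]
          \<open>overring (OL S)\<close> by (simp add: S_def)
      then have Sy: "S = Jac W \<star> {y}" using y(2) by simp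
      have JJ: "Jac W \<star> Jac W = Jac W" using JS unfolding Sy by (simp flip: sprod_assoc)
      have "y \<notin> S" using Sy Jac_e by simp
      then have iy: "iv y \<in> A (of_nat i * - r)" using A_total[OF y(1)] S by simp
      \<comment> \<open>The last factor of the power \<open>A (- i r)\<close> of \<open>A (- r)\<close> absorbs \<open>J\<close>.\<close>
      have pr: "A (of_nat i * - r) = spow (A (- r)) k \<star> A (- r)"
        using multiplicative_spow[OF l(2) i] k by simp
      also have "\<dots> = spow (A (- r)) k \<star> (A (- r) \<star> Jac W)"
        unfolding W_def nonprincipal_Jac_right[OF 4] ..
      also have "\<dots> = A (of_nat i * - r) \<star> Jac W" unfolding pr by simp
      finally have "iv y \<in> A (of_nat i * - r) \<star> Jac W" using iy by blast
      then obtain a j where aj: "iv y = a \<cdot> j" "a \<in> A (of_nat i * - r)" "j \<in> Jac W"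
        by (rule sprodE)
      have "y \<cdot> (a \<cdot> j) = e" unfolding aj(1)[symmetric] by simp
      then have ya: "y \<cdot> a = iv j" by (metis cancel_simps(4) gp.assoc gp.right_inverse)
      have "iv j \<in> W"
      proof (rule idempotent_Jac_conductor[OF W JJ])
        show "deg (iv j) = 0" using aj(3) Jac_subset overring_deg[OF W] by auto
        fix j' assume "j' \<in> Jac W"
        then have "j' \<cdot> y \<in> A (of_nat i * r)" using Sy S by auto
        from A_mult[OF this aj(2)] have "j' \<cdot> (y \<cdot> a) \<in> A 0" by simp
        then show "j' \<cdot> iv j \<in> W" unfolding ya using W by (auto simp: overring_def)
      qed
      then show False using aj(3) by (simp add: Jac_def)
    qed
    then have "cone_g r" using 4 unfolding cone_g_def nonprincipal_def W_def by blast
    then show ?thesis by blast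
  qed
qed


section \<open>Multiples of a degree of Type (g)\<close>

definition OR :: "'g set \<Rightarrow> 'g set" where "OR S = {v. deg v = 0 \<and> (\<forall>s\<in>S. s \<cdot> v \<in> S)}"

lemma overring_OR_A: "overring (OR (A q))"
  using A_mult[of _ q _ 0] by (auto simp: overring_def OR_def A_deg simp flip: gp.assoc)

lemma OL_sprod: "OL S \<subseteq> OL (S \<star> T)"
proof
  fix v assume v: "v \<in> OL S"
  have "v \<cdot> y \<in> S \<star> T" if "y \<in> S \<star> T" for y
  proof -
    obtain s t where y: "y = s \<cdot> t" "s \<in> S" "t \<in> T" using \<open>y \<in> S \<star> T\<close> by (rule sprodE)
    from sprodI[OF OL_mult[OF v y(2)] y(3)] show ?thesis by (simp add: y(1))
  qed
  then show "v \<in> OL (S \<star> T)" using v by (simp add: OL_def)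
qed

text \<open>
  If the right order is larger, the radical contains a unit of it. If both orders coincide, the
  component is not principal on the right either, and the argument of \<open>nonprincipal_Jac_left\<close>
  applies on that side.
\<close>

lemma nonprincipal_absorb:
  assumes nonprincipal: "nonprincipal r" and le: "OL (A r) \<subseteq> OR (A r)"
  shows "A r \<star> Jac (OL (A r)) = A r"
proof (intro equalityI subsetI)
  fix b assume "b \<in> A r \<star> Jac (OL (A r))"
  then obtain s t where y: "b = s \<cdot> t" "s \<in> A r" "t \<in> Jac (OL (A r))" by (rule sprodE)
  then have "t \<in> OR (A r)" using Jac_subset le by blast
  then show "b \<in> A r" using y by (simp add: OR_def)
next
  fix b assume b: "b \<in> A r"
  define W U where "W = OL (A r)" and "U = OR (A r)"
  have W: "overring W" and U: "overring U"
    unfolding W_def U_def by (rule overring_OL_A overring_OR_A)+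
  have bU: "b \<cdot> u \<in> A r" if "u \<in> U" for u using that b by (simp add: U_def OR_def)
  show "b \<in> A r \<star> Jac (OL (A r))"
  proof (cases "U \<subseteq> W")
    case False
    then obtain u where u: "u \<in> U" "u \<notin> W" by blast
    then have "iv u \<in> Jac W" using overring_total[OF W] overring_deg[OF U] by blast
    from sprodI[OF bU[OF u(1)] this] show ?thesis by (simp add: W_def)
  next
    case True
    then have UW: "U = W" using le by (simp add: U_def W_def)
    have "\<not> A r \<subseteq> {b} \<star> U"
    proof
      assume "A r \<subseteq> {b} \<star> U"
      then have Ar: "A r = {b} \<star> U" using bU[of "iv b \<cdot> _"] by auto
      have "W = {b} \<star> (U \<star> {iv b})" unfolding W_def Ar using OL_conj_overring[OF U, of b e] by simp
      then have "W \<star> {b} = A r" unfolding Ar by simp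
      then show False using nonprincipal unfolding nonprincipal_def W_def by blast
    qed
    then obtain b' where "b' \<in> A r" "b' \<notin> {b} \<star> U" by blast
    then have b': "b' \<in> A r" "iv b \<cdot> b' \<notin> U" by simp_all
    then have "iv b' \<cdot> b \<in> Jac U" using overring_total[OF U _ b'(2)] b A_deg by simp
    from sprodI[OF b'(1) this] show ?thesis by (simp add: UW W_def)
  qed
qed

text \<open>
  Let \<open>U\<close> be the right order of \<open>A r\<close>. If \<open>W \<subseteq> U\<close>, the radical of \<open>W\<close> is absorbed on the right, so
  multiplying a power by \<open>A (- r)\<close> gives back the previous power and all powers have left order \<open>W\<close>;
  then the conditions on the powers of \<open>A (n r)\<close> are among those on the powers of \<open>A r\<close>. If
  \<open>U \<subset> W\<close>, the left order may grow, but \<open>A r\<close> lies in \<open>b W\<close> for some \<open>b\<close> in \<open>A r\<close>, so that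
  \<open>A r A r = b A r\<close> and every power is a left translate of \<open>A r\<close>, hence star closed and
  nonprincipal like \<open>A r\<close>.
\<close>

lemma cone_g_multiples: assumes cone_g: "cone_g r" and n: "1 \<le> (n::nat)" shows "cone_g (of_nat n * r)"
proof (cases "A r = {}")
  case True
  have "A (of_nat n * r) = spow (A r) n" using multiplicative_spow[OF cone_g_multiplicative(1)[OF cone_g] n] ..
  then show ?thesis using True n by (simp add: cone_g_empty spow_empty)
next
  case False
  have nonprincipal: "nonprincipal r" using cone_g_nonprincipal[OF cone_g False] .
  have st: "star (A r) = A r" using nonprincipal by (simp add: nonprincipal_def)
  define W U where "W = OL (A r)" and "U = OR (A r)"
  have W: "overring W" and U: "overring U"
    unfolding W_def U_def by (rule overring_OL_A overring_OR_A)+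
  have pw: "spow (A r) k = A (of_nat k * r)" if "1 \<le> k" for k
    using multiplicative_spow[OF cone_g_multiplicative(1)[OF cone_g] that] .
  have pwn: "spow (A (of_nat n * r)) i = spow (A r) (i * n)" if "1 \<le> i" for i
    using multiplicative_spow[OF multiplicative_multiples[OF cone_g_multiplicative(1)[OF cone_g] n] that] pw[of "i * n"] that n
    by (simp add: mult.assoc)
  have Z: "overring (OL (A (of_nat n * r)))" by (rule overring_OL_A)
  show ?thesis
  proof (cases "W \<subseteq> U")
    case True
    have abs: "A r \<star> Jac W = A r" using nonprincipal_absorb[OF nonprincipal] True by (simp add: W_def U_def)
    have OL: "OL (spow (A r) k) = W" if "1 \<le> k" for k using that
    proof (induction k rule: nat_induct_at_least)
      case base
      then show ?case by (simp add: W_def)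
    next
      case (Suc k)
      obtain l where l: "k = Suc l" using Suc.hyps by (cases k) auto
      have "spow (A r) (Suc k) \<star> A (- r) = spow (A r) k \<star> (A r \<star> A (- r))" by simp
      also have "\<dots> = spow (A r) l \<star> (A r \<star> Jac W)" unfolding nonprincipal_inverse[OF nonprincipal] l by (simp add: W_def)
      also have "\<dots> = spow (A r) k" unfolding abs l by simp
      finally have "OL (spow (A r) (Suc k)) \<subseteq> OL (spow (A r) k)" using OL_sprod by metis
      moreover have "OL (spow (A r) k) \<subseteq> OL (spow (A r) (Suc k))" using OL_sprod by simp
      ultimately show ?case using Suc.IH by blast
    qed
    have OLn: "OL (A (of_nat n * r)) = W" using OL[OF n] pw[OF n] by simp
    have ns: "star (spow (A r) i) \<noteq> W \<star> {c}" if "1 \<le> i" for i c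
      using cone_g that by (simp add: cone_g_def W_def)
    have "star (A (of_nat n * r)) = A (of_nat n * r)"
    proof (rule ccontr)
      assume "star (A (of_nat n * r)) \<noteq> A (of_nat n * r)"
      then obtain y where "star (A (of_nat n * r)) = OL (A (of_nat n * r)) \<star> {y}"
        using not_star_closed[OF A_deg Z] by blast
      then show False using ns[OF n, of y] OLn pw[OF n] by simp
    qed
    moreover have "star (spow (A (of_nat n * r)) i) \<noteq> W \<star> {c}" if "1 \<le> i" for i c
      using ns[of "i * n" c] pwn[OF that] that n by simp
    ultimately show ?thesis unfolding cone_g_def OLn by blast
  next
    case False
    then have UW: "U \<subseteq> W" using overring_chain[OF W U] by blast
    obtain w where w: "w \<in> W" "w \<notin> U" using False by blast
    then obtain b where b: "b \<in> A r" "b \<cdot> w \<notin> A r" using overring_deg[OF W] by (auto simp: U_def OR_def)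
    have bW: "iv b \<cdot> b' \<in> W" if b': "b' \<in> A r" for b'
    proof (rule ccontr)
      assume n: "iv b \<cdot> b' \<notin> W"
      then have "iv b' \<cdot> b \<in> Jac W" using overring_total[OF W _ n] b b' A_deg by simp
      from Jac_right[OF W w(1) this] have "iv b' \<cdot> (b \<cdot> w) \<in> Jac W" by simp
      then have "iv b' \<cdot> (b \<cdot> w) \<in> U" using Jac_antimono[OF U W UW] Jac_subset by blast
      then have "b' \<cdot> (iv b' \<cdot> (b \<cdot> w)) \<in> A r" using b' unfolding U_def OR_def by blast
      then show False using b(2) by simp
    qed
    have sq: "A r \<star> A r = {b} \<star> A r"
    proof (intro equalityI subsetI)
      fix y assume "y \<in> A r \<star> A r"
      then obtain s t where y: "y = s \<cdot> t" "s \<in> A r" "t \<in> A r" by (rule sprodE)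
      from OL_mult[OF bW[OF y(2), unfolded W_def] y(3)] show "y \<in> {b} \<star> A r" by (simp add: y(1))
    next
      fix y assume "y \<in> {b} \<star> A r"
      then show "y \<in> A r \<star> A r" using sprodI[OF b(1), of "iv b \<cdot> y" "A r"] by simp
    qed
    have tr: "\<exists>y. spow (A r) k = {y} \<star> A r" if "1 \<le> k" for k using that
    proof (induction k rule: nat_induct_at_least)
      case base
      then show ?case by (auto intro: exI[of _ e])
    next
      case (Suc k)
      then obtain y where "spow (A r) k = {y} \<star> A r" by blast
      then have "spow (A r) (Suc k) = {y \<cdot> b} \<star> A r" using sq by simp
      then show ?case by blast
    qed
    have "star (spow (A r) k) = spow (A r) k" if "1 \<le> k" for k
      using tr[OF that] star_translate[of _ "A r"] st by auto
    note stp = this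
    have "star (spow (A (of_nat n * r)) i) \<noteq> OL (A (of_nat n * r)) \<star> {c}" if i: "1 \<le> i" for i c
    proof
      define Z' where "Z' = OL (A (of_nat n * r))"
      have Z': "overring Z'" unfolding Z'_def by (rule Z)
      assume "star (spow (A (of_nat n * r)) i) = OL (A (of_nat n * r)) \<star> {c}"
      then have "star (spow (A r) (i * n)) = Z' \<star> {c}" using pwn[OF i] by (simp add: Z'_def)
      moreover have in1: "1 \<le> i * n" using i n by simp
      obtain y where y: "spow (A r) (i * n) = {y} \<star> A r" using tr[OF in1] by blast
      ultimately have "{y} \<star> A r = Z' \<star> {c}" using stp[OF in1] by simp
      then have Ar: "A r = {iv y} \<star> (Z' \<star> {c})" by (simp add: translate_swap)
      have "OL (A r) = {iv y} \<star> (Z' \<star> {y})" unfolding Ar using OL_conj_overring[OF Z', of "iv y" c] by simp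
      then have "A r = OL (A r) \<star> {iv y \<cdot> c}" using Ar by simp
      then show False using nonprincipal by (simp add: nonprincipal_def)
    qed
    then show ?thesis using stp[OF n] pw[OF n] by (simp add: cone_g_def)
  qed
qed

section \<open>The equivalence for cones\<close>

definition cone_I :: bool where
  "cone_I \<longleftrightarrow> (\<forall>g h. 0 < g \<longrightarrow> 0 < h \<longrightarrow> A g \<star> A h = A (g + h) \<and> A (- g) \<star> A (- h) = A (- g - h))"

lemma cone_I_multiplicative: "cone_I \<longleftrightarrow> (\<forall>r>0. multiplicative r \<and> multiplicative (- r))"
proof
  assume t: cone_I
  show "\<forall>r>0. multiplicative r \<and> multiplicative (- r)"
  proof (intro allI impI)
    fix r :: rat assume r: "0 < r"
    have "A (of_nat i * r) \<star> A (of_nat j * r) = A (of_nat (i + j) * r) \<and>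
        A (of_nat i * - r) \<star> A (of_nat j * - r) = A (of_nat (i + j) * - r)"
      if "1 \<le> i" "1 \<le> j" for i j :: nat
      using t[unfolded cone_I_def, rule_format, of "of_nat i * r" "of_nat j * r"] that r
      by (simp add: ring_distribs)
    then show "multiplicative r \<and> multiplicative (- r)" unfolding multiplicative_def by blast
  qed
next
  assume l: "\<forall>r>0. multiplicative r \<and> multiplicative (- r)"
  show cone_I unfolding cone_I_def
  proof (intro allI impI)
    fix g h :: rat assume "0 < g" "0 < h"
    then obtain s and i j :: nat where s: "0 < s" "1 \<le> i" "1 \<le> j" "g = of_nat i * s" "h = of_nat j * s"
      using common_divisor[of "{g, h}"] by auto
    have "multiplicative s" "multiplicative (- s)" using l s(1) by blast+
    then show "A g \<star> A h = A (g + h) \<and> A (- g) \<star> A (- h) = A (- g - h)"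
      using s(2,3) unfolding multiplicative_def s(4,5) by (simp add: ring_distribs)
  qed
qed

text \<open>
  Uniformity of the type is a pigeonhole argument: the types pass to multiples, and finitely many
  degrees have a common divisor.
\<close>

theorem cone_I_iff:
  "cone_I \<longleftrightarrow> (\<forall>r>0. cone_a r) \<or> (\<forall>r>0. cone_b r) \<or> (\<forall>r>0. cone_c r) \<or>
    (\<forall>r>0. cone_d r) \<or> (\<forall>r>0. cone_f r) \<or> (\<forall>r>0. cone_g r)"
proof
  assume cone_I
  then have ex: "cone_a r \<or> cone_b r \<or> cone_c r \<or> cone_d r \<or> cone_f r \<or> cone_g r" if "0 < r" for r
    using types_exhaustive that cone_I_multiplicative by blast
  show "(\<forall>r>0. cone_a r) \<or> (\<forall>r>0. cone_b r) \<or> (\<forall>r>0. cone_c r) \<or>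
    (\<forall>r>0. cone_d r) \<or> (\<forall>r>0. cone_f r) \<or> (\<forall>r>0. cone_g r)"
  proof (rule ccontr)
    assume "\<not> ?thesis"
    then obtain ra rb rc rd rf rg where pos: "0 < ra" "0 < rb" "0 < rc" "0 < rd" "0 < rf" "0 < rg"
      and n: "\<not> cone_a ra" "\<not> cone_b rb" "\<not> cone_c rc" "\<not> cone_d rd" "\<not> cone_f rf" "\<not> cone_g rg" by blast
    obtain s where s: "0 < s" "\<forall>q\<in>{ra, rb, rc, rd, rf, rg}. \<exists>n\<ge>1. q = of_nat n * s"
      using common_divisor[of "{ra, rb, rc, rd, rf, rg}"] pos by auto
    have "\<not> T s" if "q \<in> {ra, rb, rc, rd, rf, rg}" "\<not> T q" "\<And>n. T s \<Longrightarrow> 1 \<le> n \<Longrightarrow> T (of_nat n * s)" for T q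
      using s(2) that by metis
    note * = this
    have "\<not> cone_a s" by (rule *[of ra]) (use n cone_a_multiples in auto)
    moreover have "\<not> cone_b s" by (rule *[of rb]) (use n cone_b_multiples in auto)
    moreover have "\<not> cone_c s" by (rule *[of rc]) (use n cone_c_multiples in auto)
    moreover have "\<not> cone_d s" by (rule *[of rd]) (use n cone_d_multiples in auto)
    moreover have "\<not> cone_f s" by (rule *[of rf]) (use n cone_f_multiples in auto)
    moreover have "\<not> cone_g s" by (rule *[of rg]) (use n cone_g_multiples in auto)
    ultimately show False using ex[OF s(1)] by blast
  qed
next
  assume "(\<forall>r>0. cone_a r) \<or> (\<forall>r>0. cone_b r) \<or> (\<forall>r>0. cone_c r) \<or>
    (\<forall>r>0. cone_d r) \<or> (\<forall>r>0. cone_f r) \<or> (\<forall>r>0. cone_g r)"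
  then show cone_I
    unfolding cone_I_multiplicative using cone_a_multiplicative cone_b_multiplicative
      cone_c_multiplicative cone_d_multiplicative cone_f_multiplicative cone_g_multiplicative by blast
qed

end


section \<open>Homogeneous elements\<close>

text \<open>
  Removing \<open>0\<close> makes the homogeneous elements a group on a full type.
\<close>

typedef (overloaded) ('a::division_ring) nonzero = "{x::'a. x \<noteq> 0}"
  by (rule exI[of _ 1]) simp

definition mon :: "rat \<Rightarrow> 'a::division_ring \<Rightarrow> rat \<times> 'a nonzero" where
  "mon q a = (q, Abs_nonzero a)"

lemma mon_cases: obtains q a where "x = mon q a" "a \<noteq> 0"
  by (cases x; cases "snd x" rule: Abs_nonzero_cases) (auto simp: mon_def)

lemma fst_mon [simp]: "fst (mon q a) = q"
  by (simp add: mon_def)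

lemma mon_eq: "a \<noteq> 0 \<Longrightarrow> b \<noteq> 0 \<Longrightarrow> mon p a = mon q b \<longleftrightarrow> p = q \<and> a = b"
  by (simp add: mon_def Abs_nonzero_inject)

definition hset :: "rat \<Rightarrow> 'a::division_ring set \<Rightarrow> (rat \<times> 'a nonzero) set" where
  "hset q S = {mon q a | a. a \<in> S \<and> a \<noteq> 0}"

lemma mem_hset: "a \<noteq> 0 \<Longrightarrow> mon p a \<in> hset q S \<longleftrightarrow> p = q \<and> a \<in> S"
  by (auto simp: hset_def mon_eq)

lemma hset_subset: "0 \<in> T \<Longrightarrow> hset q S \<subseteq> hset q T \<longleftrightarrow> S \<subseteq> T"
proof
  assume "0 \<in> T" "hset q S \<subseteq> hset q T"
  then have "a \<in> T" if "a \<in> S" for a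
    using that mem_hset[of a q q S] mem_hset[of a q q T] by (cases "a = 0") auto
  then show "S \<subseteq> T" by blast
qed (auto simp: hset_def)

lemma hset_eq: "0 \<in> S \<Longrightarrow> 0 \<in> T \<Longrightarrow> hset q S = hset q T \<longleftrightarrow> S = T"
  using hset_subset[of S q T] hset_subset[of T q S] by auto

section \<open>Skew group rings\<close>

lemma aut_props:
  assumes "aut_action \<sigma>"
  shows "\<sigma> g (a + b) = \<sigma> g a + \<sigma> g b" "\<sigma> g (a * b) = \<sigma> g a * \<sigma> g b" "\<sigma> g 1 = 1"
    "\<sigma> (g + h) a = \<sigma> g (\<sigma> h a)" "\<sigma> 0 a = a" "\<sigma> g 0 = 0" "\<sigma> g a = 0 \<longleftrightarrow> a = 0"
    "\<sigma> g (inverse a) = inverse (\<sigma> g a)" "\<sigma> g (- a) = - \<sigma> g a" "\<sigma> g (a - b) = \<sigma> g a - \<sigma> g b"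
    "\<sigma> (- g) (\<sigma> g a) = a" "\<sigma> g (\<sigma> (- g) a) = a" "\<sigma> g a = \<sigma> g b \<longleftrightarrow> a = b"
proof -
  have r: "bij (\<sigma> g)" and one: "\<And>g. \<sigma> g 1 = 1" and
    plus: "\<And>g a b. \<sigma> g (a + b) = \<sigma> g a + \<sigma> g b" and mult: "\<And>g a b. \<sigma> g (a * b) = \<sigma> g a * \<sigma> g b"
    and comp: "\<And>g h a. \<sigma> (g + h) a = \<sigma> g (\<sigma> h a)" for g
    using assms by (simp_all add: aut_action_def ring_automorphism_def)
  have inj: "\<sigma> g a = \<sigma> g b \<longleftrightarrow> a = b" for g a b using r[of g] by (auto simp: bij_def inj_def)
  have id: "\<sigma> 0 a = a" for a using comp[of 0 0 a] inj[of 0] by simp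
  have zero: "\<sigma> g 0 = 0" for g using plus[of g 0 0] by simp
  have neg: "\<sigma> g (- a) = - \<sigma> g a" for g a using plus[of g a "- a"] zero by (simp add: add_eq_0_iff)
  show "\<sigma> g (a + b) = \<sigma> g a + \<sigma> g b" "\<sigma> g (a * b) = \<sigma> g a * \<sigma> g b" "\<sigma> g 1 = 1"
    "\<sigma> (g + h) a = \<sigma> g (\<sigma> h a)" "\<sigma> 0 a = a" "\<sigma> g 0 = 0" "\<sigma> g a = \<sigma> g b \<longleftrightarrow> a = b" "\<sigma> g (- a) = - \<sigma> g a"
    by (fact plus mult one comp id zero inj neg)+
  show z: "\<sigma> g a = 0 \<longleftrightarrow> a = 0" for a using inj[of g a 0] zero by simp
  show "\<sigma> g (inverse a) = inverse (\<sigma> g a)"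
  proof (cases "a = 0")
    case False
    then have "\<sigma> g a * \<sigma> g (inverse a) = 1" using mult[of g a "inverse a"] one by simp
    then show ?thesis by (metis inverse_unique)
  qed (simp add: zero)
  show "\<sigma> g (a - b) = \<sigma> g a - \<sigma> g b" using plus[of g a "- b"] neg by simp
  show "\<sigma> (- g) (\<sigma> g a) = a" "\<sigma> g (\<sigma> (- g) a) = a" using comp[of "- g" g a] comp[of g "- g" a] id by simp_all
qed

lemma add_subgroup_props:
  assumes "add_subgroup I"
  shows "0 \<in> I" "a \<in> I \<Longrightarrow> b \<in> I \<Longrightarrow> a - b \<in> I" "a \<in> I \<Longrightarrow> - a \<in> I" "a \<in> I \<Longrightarrow> b \<in> I \<Longrightarrow> a + b \<in> I"
proof -
  show 1: "0 \<in> I" "\<And>a b. a \<in> I \<Longrightarrow> b \<in> I \<Longrightarrow> a - b \<in> I" using assms by (auto simp: add_subgroup_def)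
  show 2: "- a \<in> I" if "a \<in> I" for a using 1(2)[OF 1(1) that] by simp
  show "a \<in> I \<Longrightarrow> b \<in> I \<Longrightarrow> a + b \<in> I" using 1(2)[of a "- b"] 2[of b] by simp
qed

lemma skew_single:
  assumes "aut_action \<sigma>"
  shows "skew_mult \<sigma> (Poly_Mapping.single g a) (Poly_Mapping.single h b) = Poly_Mapping.single (g + h) (a * \<sigma> g b)"
  by (cases "a = 0"; cases "b = 0") (simp_all add: skew_mult_def aut_props[OF assms])

lemma lookup_skew_single:
  assumes "aut_action \<sigma>"
  shows "Poly_Mapping.lookup (skew_mult \<sigma> (Poly_Mapping.single g a) y) (g + h) = a * \<sigma> g (Poly_Mapping.lookup y h)"
proof -
  have "Poly_Mapping.lookup (skew_mult \<sigma> (Poly_Mapping.single g a) y) (g + h) =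
      (\<Sum>k\<in>Poly_Mapping.keys y. if k = h then a * \<sigma> g (Poly_Mapping.lookup y k) else 0)"
    by (cases "a = 0") (auto simp: skew_mult_def lookup_sum lookup_single when_def intro!: sum.cong)
  then show ?thesis
    by (simp add: in_keys_iff aut_props[OF assms])
qed

text \<open>
  The coefficients of a right inverse of a monomial can be computed one by one, which gives
  uniqueness without associativity of the product.
\<close>

lemma inv_single:
  assumes \<sigma>: "aut_action \<sigma>" and G: "- g \<in> G" and a: "a \<noteq> 0"
  shows "inv\<^bsub>skew_group_ring G \<sigma>\<^esub> (Poly_Mapping.single g a) = Poly_Mapping.single (- g) (\<sigma> (- g) (inverse a))"
    (is "_ = ?y")
  unfolding m_inv_def
proof (rule the_equality)
  show "?y \<in> carrier (skew_group_ring G \<sigma>) \<and>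
    Poly_Mapping.single g a \<otimes>\<^bsub>skew_group_ring G \<sigma>\<^esub> ?y = \<one>\<^bsub>skew_group_ring G \<sigma>\<^esub> \<and>
    ?y \<otimes>\<^bsub>skew_group_ring G \<sigma>\<^esub> Poly_Mapping.single g a = \<one>\<^bsub>skew_group_ring G \<sigma>\<^esub>"
    using G a by (simp add: skew_group_ring_def skew_single[OF \<sigma>] aut_props[OF \<sigma>])
next
  fix y assume "y \<in> carrier (skew_group_ring G \<sigma>) \<and>
    Poly_Mapping.single g a \<otimes>\<^bsub>skew_group_ring G \<sigma>\<^esub> y = \<one>\<^bsub>skew_group_ring G \<sigma>\<^esub> \<and>
    y \<otimes>\<^bsub>skew_group_ring G \<sigma>\<^esub> Poly_Mapping.single g a = \<one>\<^bsub>skew_group_ring G \<sigma>\<^esub>"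
  then have y: "skew_mult \<sigma> (Poly_Mapping.single g a) y = Poly_Mapping.single 0 1"
    by (simp add: skew_group_ring_def)
  show "y = ?y"
  proof (rule poly_mapping_eqI)
    fix h
    have "a * \<sigma> g (Poly_Mapping.lookup y h) = (if h = - g then 1 else 0)"
      using lookup_skew_single[OF \<sigma>, of g a y h] unfolding y
      by (auto simp: lookup_one when_def eq_neg_iff_add_eq_0 add.commute)
    moreover have "a * \<sigma> g (Poly_Mapping.lookup ?y h) = (if h = - g then 1 else 0)"
      using a by (simp add: lookup_single when_def aut_props[OF \<sigma>])
    ultimately have "a * \<sigma> g (Poly_Mapping.lookup y h) = a * \<sigma> g (Poly_Mapping.lookup ?y h)" by simp
    then show "Poly_Mapping.lookup y h = Poly_Mapping.lookup ?y h"
      using a by (simp add: aut_props[OF \<sigma>])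
  qed
qed

lemma single_in_graded_sum:
  "add_subgroup (A g) \<Longrightarrow> (\<And>h. h \<in> G \<Longrightarrow> 0 \<in> A h) \<Longrightarrow> g \<in> G \<Longrightarrow> Poly_Mapping.single g a \<in> graded_sum G A \<longleftrightarrow> a \<in> A g"
  by (auto simp: graded_sum_def lookup_single when_def add_subgroup_props)

lemma graded_extension_props:
  assumes \<sigma>: "aut_action \<sigma>" and ext: "graded_extension V UNIV \<sigma> A"
  shows "add_subgroup (A g)" "a \<in> A g \<Longrightarrow> b \<in> A h \<Longrightarrow> a * \<sigma> g b \<in> A (g + h)"
    "a \<noteq> 0 \<Longrightarrow> a \<in> A g \<or> \<sigma> (- g) (inverse a) \<in> A (- g)" "A 0 = V"
proof -
  have sub: "\<And>g. add_subgroup (A g)" and ring: "subring (graded_sum UNIV A) (skew_group_ring UNIV \<sigma>)"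
    and tot: "\<And>g a. a \<noteq> 0 \<Longrightarrow> Poly_Mapping.single g a \<in> graded_sum UNIV A \<or>
        inv\<^bsub>skew_group_ring UNIV \<sigma>\<^esub> (Poly_Mapping.single g a) \<in> graded_sum UNIV A"
    using ext by (auto simp: graded_extension_def graded_total_valuation_ring_def graded_subring_def)
  show "add_subgroup (A g)" by (rule sub)
  have s: "Poly_Mapping.single g a \<in> graded_sum UNIV A \<longleftrightarrow> a \<in> A g" for g a
    by (rule single_in_graded_sum) (simp_all add: sub add_subgroup_props)
  have "submonoid (graded_sum UNIV A) (skew_group_ring UNIV \<sigma>)" using ring by (simp add: subring_def)
  from submonoid.m_closed[OF this, of "Poly_Mapping.single g a" "Poly_Mapping.single h b"]
  show "a \<in> A g \<Longrightarrow> b \<in> A h \<Longrightarrow> a * \<sigma> g b \<in> A (g + h)"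
    by (simp add: s skew_group_ring_def skew_single[OF \<sigma>])
  show "a \<noteq> 0 \<Longrightarrow> a \<in> A g \<or> \<sigma> (- g) (inverse a) \<in> A (- g)"
    using tot[of a g] by (simp add: s inv_single[OF \<sigma>])
  show "A 0 = V" using ext by (simp add: graded_extension_def)
qed

lemma keys_uminus: "Poly_Mapping.keys (- p) = Poly_Mapping.keys (p :: _ \<Rightarrow>\<^sub>0 'a::ab_group_add)"
  by (auto simp: in_keys_iff)

lemma graded_extension_subgroup:
  assumes \<sigma>: "aut_action \<sigma>" and ext: "graded_extension V UNIV \<sigma> A"
    and G: "0 \<in> G" "\<And>g h. g \<in> G \<Longrightarrow> h \<in> G \<Longrightarrow> g + h \<in> G" "\<And>g. g \<in> G \<Longrightarrow> - g \<in> G"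
  shows "graded_extension V G \<sigma> A"
proof -
  note props = graded_extension_props[OF \<sigma> ext]
  have z: "0 \<in> A g" for g using props(1) add_subgroup_props(1) by blast
  have ring: "subring (graded_sum UNIV A) (skew_group_ring UNIV \<sigma>)"
    using ext by (auto simp: graded_extension_def graded_total_valuation_ring_def graded_subring_def)
  then have mon: "submonoid (graded_sum UNIV A) (skew_group_ring UNIV \<sigma>)" by (simp add: subring_def)
  have eq: "p \<in> graded_sum G A \<longleftrightarrow> p \<in> graded_sum UNIV A \<and> Poly_Mapping.keys p \<subseteq> G" for p
    using z by (auto simp: graded_sum_def) (metis in_keys_iff subsetD)
  have keys: "Poly_Mapping.keys (skew_mult \<sigma> p q) \<subseteq> G"
    if "Poly_Mapping.keys p \<subseteq> G" "Poly_Mapping.keys q \<subseteq> G" for p q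
  proof
    fix k assume "k \<in> Poly_Mapping.keys (skew_mult \<sigma> p q)"
    then have "Poly_Mapping.lookup (skew_mult \<sigma> p q) k \<noteq> 0" by (simp add: in_keys_iff)
    then obtain g where g: "g \<in> Poly_Mapping.keys p"
      "(\<Sum>h\<in>Poly_Mapping.keys q. Poly_Mapping.lookup (Poly_Mapping.single (g + h)
          (Poly_Mapping.lookup p g * \<sigma> g (Poly_Mapping.lookup q h))) k) \<noteq> 0"
      unfolding skew_mult_def lookup_sum by (rule sum.not_neutral_contains_not_neutral)
    from g(2) obtain h where "h \<in> Poly_Mapping.keys q" "Poly_Mapping.lookup (Poly_Mapping.single (g + h)
          (Poly_Mapping.lookup p g * \<sigma> g (Poly_Mapping.lookup q h))) k \<noteq> 0"
      by (rule sum.not_neutral_contains_not_neutral)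
    then show "k \<in> G" using g(1) that G(2)[of g h] by (auto simp: lookup_single when_def split: if_splits)
  qed
  have mem: "p \<in> graded_sum G A \<longleftrightarrow> Poly_Mapping.keys p \<subseteq> G \<and> (\<forall>g. Poly_Mapping.lookup p g \<in> A g)" for p
    unfolding eq by (auto simp: graded_sum_def)
  have minus: "inv\<^bsub>add_monoid (skew_group_ring G \<sigma>)\<^esub> p = - p" if "p \<in> graded_sum G A" for p
    unfolding m_inv_def
  proof (rule the_equality)
    show "- p \<in> carrier (add_monoid (skew_group_ring G \<sigma>)) \<and>
        p \<otimes>\<^bsub>add_monoid (skew_group_ring G \<sigma>)\<^esub> - p = \<one>\<^bsub>add_monoid (skew_group_ring G \<sigma>)\<^esub> \<and>
        - p \<otimes>\<^bsub>add_monoid (skew_group_ring G \<sigma>)\<^esub> p = \<one>\<^bsub>add_monoid (skew_group_ring G \<sigma>)\<^esub>"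
      using that by (simp add: skew_group_ring_def mem keys_uminus)
    fix y assume "y \<in> carrier (add_monoid (skew_group_ring G \<sigma>)) \<and>
        p \<otimes>\<^bsub>add_monoid (skew_group_ring G \<sigma>)\<^esub> y = \<one>\<^bsub>add_monoid (skew_group_ring G \<sigma>)\<^esub> \<and>
        y \<otimes>\<^bsub>add_monoid (skew_group_ring G \<sigma>)\<^esub> p = \<one>\<^bsub>add_monoid (skew_group_ring G \<sigma>)\<^esub>"
    then have "p + y = 0" by (simp add: skew_group_ring_def)
    then show "y = - p" using minus_unique by metis
  qed
  have "subgroup (graded_sum G A) (add_monoid (skew_group_ring G \<sigma>))"
  proof
    show "graded_sum G A \<subseteq> carrier (add_monoid (skew_group_ring G \<sigma>))"
      by (auto simp: mem skew_group_ring_def)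
    fix p q assume p: "p \<in> graded_sum G A" and q: "q \<in> graded_sum G A"
    show "p \<otimes>\<^bsub>add_monoid (skew_group_ring G \<sigma>)\<^esub> q \<in> graded_sum G A"
    proof -
      have "Poly_Mapping.keys (p + q) \<subseteq> G" using p q Poly_Mapping.keys_add[of p q] unfolding mem by blast
      moreover have "Poly_Mapping.lookup (p + q) g \<in> A g" for g
        using p q add_subgroup_props(4)[OF props(1)] unfolding mem lookup_add by blast
      ultimately show ?thesis by (simp add: mem skew_group_ring_def)
    qed
  next
    show "\<one>\<^bsub>add_monoid (skew_group_ring G \<sigma>)\<^esub> \<in> graded_sum G A"
      using z by (simp add: mem skew_group_ring_def)
  next
    fix p assume p: "p \<in> graded_sum G A"
    show "inv\<^bsub>add_monoid (skew_group_ring G \<sigma>)\<^esub> p \<in> graded_sum G A"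
      unfolding minus[OF p] using p add_subgroup_props(3)[OF props(1)] by (simp add: mem keys_uminus)
  qed
  moreover have "submonoid (graded_sum G A) (skew_group_ring G \<sigma>)"
  proof
    show "graded_sum G A \<subseteq> carrier (skew_group_ring G \<sigma>)"
      by (auto simp: mem skew_group_ring_def)
    show "\<one>\<^bsub>skew_group_ring G \<sigma>\<^esub> \<in> graded_sum G A"
      using submonoid.one_closed[OF mon] G(1) by (simp add: eq skew_group_ring_def)
    fix p q assume "p \<in> graded_sum G A" "q \<in> graded_sum G A"
    then show "p \<otimes>\<^bsub>skew_group_ring G \<sigma>\<^esub> q \<in> graded_sum G A"
      using submonoid.m_closed[OF mon, of p q] keys by (simp add: eq skew_group_ring_def)
  qed
  ultimately have "subring (graded_sum G A) (skew_group_ring G \<sigma>)" by (rule subring.intro)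
  moreover have "Poly_Mapping.single g a \<in> graded_sum G A \<or>
      inv\<^bsub>skew_group_ring G \<sigma>\<^esub> (Poly_Mapping.single g a) \<in> graded_sum G A" if "g \<in> G" "a \<noteq> 0" for g a
    using props(3)[OF that(2), of g] inv_single[OF \<sigma> G(3)[OF that(1)] that(2)]
      single_in_graded_sum[OF props(1) z that(1)] single_in_graded_sum[OF props(1) z G(3)[OF that(1)]] by simp
  ultimately show ?thesis
    using props(1,4) by (simp add: graded_extension_def graded_total_valuation_ring_def graded_subring_def)
qed

lemma graded_extension_multiples:
  assumes "aut_action \<sigma>" "graded_extension V UNIV \<sigma> A"
  shows "graded_extension V (multiples g) \<sigma> A"
proof (rule graded_extension_subgroup[OF assms])
  show "0 \<in> multiples g" by (auto simp: multiples_def intro: range_eqI[of _ _ 0])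
  show "h + k \<in> multiples g" if hk: "h \<in> multiples g" "k \<in> multiples g" for h k
  proof -
    obtain i j :: int where "h = of_int i * g" "k = of_int j * g" using hk by (auto simp: multiples_def)
    then show ?thesis unfolding multiples_def by (intro range_eqI[of _ _ "i + j"]) (simp add: ring_distribs)
  qed
  show "- h \<in> multiples g" if "h \<in> multiples g" for h
  proof -
    obtain i :: int where "h = of_int i * g" using \<open>h \<in> multiples g\<close> by (auto simp: multiples_def)
    then show ?thesis unfolding multiples_def by (intro range_eqI[of _ _ "- i"]) simp
  qed
qed

section \<open>Total valuation rings\<close>

lemma valuation_chain:
  assumes "total_valuation_ring W" shows "\<exists>v\<in>W. a = v * b \<or> b = v * a"
proof (cases "a = 0 \<or> b = 0")
  case True
  then show ?thesis using assms by (intro bexI[of _ 0]) (auto simp: total_valuation_ring_def add_subgroup_def)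
next
  case False
  then have "a * inverse b \<in> W \<or> inverse (a * inverse b) \<in> W"
    using assms by (simp add: total_valuation_ring_def)
  moreover have "a = a * inverse b * b" "b = inverse (a * inverse b) * a"
    using False by (simp_all add: mult.assoc nonzero_inverse_mult_distrib)
  ultimately show ?thesis by blast
qed

text \<open>
  The non-units form a left ideal because of any two elements one is a left multiple of the other;
  it contains every proper left ideal and so is the only maximal one.
\<close>

lemma jacobson_radical_valuation_ring:
  assumes W: "total_valuation_ring W"
  shows "jacobson_radical W = {w \<in> W. w = 0 \<or> inverse w \<notin> W}" (is "_ = ?N")
proof -
  have sub: "add_subgroup W" and one: "1 \<in> W" and mult: "\<And>a b. a \<in> W \<Longrightarrow> b \<in> W \<Longrightarrow> a * b \<in> W"
    using W by (auto simp: total_valuation_ring_def)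
  have left: "w * x \<in> ?N" if w: "w \<in> W" and x: "x \<in> ?N" for w x
  proof -
    have "inverse (w * x) \<notin> W" if "w * x \<noteq> 0"
    proof
      assume "inverse (w * x) \<in> W"
      then have "inverse (w * x) * w \<in> W" using w by (rule mult)
      moreover have "inverse (w * x) * w = inverse x" using that by (simp add: nonzero_inverse_mult_distrib mult.assoc)
      ultimately show False using x that by simp
    qed
    then show ?thesis using mult w x by auto
  qed
  have "a - b \<in> ?N" if ab: "a \<in> ?N" "b \<in> ?N" for a b
  proof -
    obtain v where v: "v \<in> W" "a = v * b \<or> b = v * a" using valuation_chain[OF W] by blast
    have "v - 1 \<in> W" "1 - v \<in> W" using v(1) one add_subgroup_props(2)[OF sub] by auto
    from left[OF this(1) ab(2)] left[OF this(2) ab(1)] v(2) show ?thesis by (auto simp: algebra_simps)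
  qed
  then have N: "left_ideal_of W ?N"
    using left add_subgroup_props(1)[OF sub] by (auto simp: left_ideal_of_def add_subgroup_def)
  have N1: "1 \<notin> ?N" using one by simp
  have max: "L \<subseteq> ?N" if L: "left_ideal_of W L" "L \<noteq> W" for L
  proof
    fix x assume x: "x \<in> L"
    have "x = 0" if "inverse x \<in> W"
    proof (rule ccontr)
      assume "x \<noteq> 0"
      then have "inverse x * x = 1" by simp
      moreover have "inverse x * x \<in> L" using that x L(1) by (simp add: left_ideal_of_def)
      ultimately have "1 \<in> L" by simp
      then have "w \<in> L" if "w \<in> W" for w using that L(1) by (force simp: left_ideal_of_def)
      then show False using L by (auto simp: left_ideal_of_def)
    qed
    then show "x \<in> ?N" using x L(1) by (auto simp: left_ideal_of_def)
  qed
  have "maximal_left_ideal_of W ?N"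
    unfolding maximal_left_ideal_of_def using N N1 one max by blast
  moreover have "M = ?N" if M: "maximal_left_ideal_of W M" for M
  proof -
    have "left_ideal_of W M" "M \<noteq> W" using M by (auto simp: maximal_left_ideal_of_def)
    then have "M \<subseteq> ?N" by (rule max)
    then show ?thesis using M N N1 one unfolding maximal_left_ideal_of_def by blast
  qed
  ultimately have "{M. maximal_left_ideal_of W M} = {?N}" by blast
  then show ?thesis by (auto simp: jacobson_radical_def)
qed


section \<open>The cone of a graded extension\<close>

locale graded_ext =
  fixes V :: "'a::division_ring set" and \<sigma> :: "rat \<Rightarrow> 'a \<Rightarrow> 'a" and B :: "rat \<Rightarrow> 'a set"
  assumes tvr: "total_valuation_ring V" and aut: "aut_action \<sigma>"
    and ext: "graded_extension V UNIV \<sigma> B"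
begin

lemmas \<sigma>_props [simp] = aut_props[OF aut]
lemmas B_props = graded_extension_props[OF aut ext]

definition hmult :: "rat \<times> 'a nonzero \<Rightarrow> rat \<times> 'a nonzero \<Rightarrow> rat \<times> 'a nonzero" where
  "hmult x y = mon (fst x + fst y) (Rep_nonzero (snd x) * \<sigma> (fst x) (Rep_nonzero (snd y)))"

definition hinv :: "rat \<times> 'a nonzero \<Rightarrow> rat \<times> 'a nonzero" where
  "hinv x = mon (- fst x) (\<sigma> (- fst x) (inverse (Rep_nonzero (snd x))))"

definition hcone :: "(rat \<times> 'a nonzero) set" where
  "hcone = {x. Rep_nonzero (snd x) \<in> B (fst x)}"

lemma hmult_mon: "a \<noteq> 0 \<Longrightarrow> b \<noteq> 0 \<Longrightarrow> hmult (mon p a) (mon q b) = mon (p + q) (a * \<sigma> p b)"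
  by (simp add: hmult_def) (simp add: mon_def Abs_nonzero_inverse)

lemma hinv_mon: "a \<noteq> 0 \<Longrightarrow> hinv (mon p a) = mon (- p) (\<sigma> (- p) (inverse a))"
  by (simp add: hinv_def) (simp add: mon_def Abs_nonzero_inverse)

lemma mem_hcone: "a \<noteq> 0 \<Longrightarrow> mon p a \<in> hcone \<longleftrightarrow> a \<in> B p"
  by (simp add: hcone_def mon_def Abs_nonzero_inverse)

lemma hgroup: "Groups.group hmult (mon 0 1) hinv"
proof
  fix x y z
  show "hmult (hmult x y) z = hmult x (hmult y z)"
    by (rule mon_cases[of x], rule mon_cases[of y], rule mon_cases[of z])
      (simp add: hmult_mon add.assoc mult.assoc)
  show "hmult (mon 0 1) x = x" by (rule mon_cases[of x]) (simp add: hmult_mon)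
  show "hmult (hinv x) x = mon 0 1" by (rule mon_cases[of x]) (simp add: hmult_mon hinv_mon)
qed

sublocale H: graded_cone hmult "mon 0 1" hinv fst hcone
proof (intro graded_cone.intro hgroup graded_cone_axioms.intro)
  fix x y q
  show "fst (hmult x y) = fst x + fst y" by (simp add: hmult_def)
  show "\<exists>x :: rat \<times> 'a nonzero. fst x = q" by (rule exI[of _ "mon q 1"]) simp
  show "x \<in> hcone \<Longrightarrow> y \<in> hcone \<Longrightarrow> hmult x y \<in> hcone"
    by (rule mon_cases[of x], rule mon_cases[of y]) (simp add: hmult_mon mem_hcone B_props(2))
  show "x \<in> hcone \<or> hinv x \<in> hcone"
    by (rule mon_cases[of x]) (use B_props(3) in \<open>simp add: hinv_mon mem_hcone\<close>)
qed

lemma A_hset: "H.A q = hset q (B q)"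
proof -
  have "x \<in> H.A q \<longleftrightarrow> x \<in> hset q (B q)" for x
    by (rule mon_cases[of x]) (auto simp: H.A_def mem_hcone mem_hset)
  then show ?thesis by blast
qed

lemma B0: "B 0 = V"
  by (rule B_props(4))

lemma V_props: "add_subgroup V" "1 \<in> V" "a \<in> V \<Longrightarrow> b \<in> V \<Longrightarrow> a * b \<in> V"
  using tvr by (auto simp: total_valuation_ring_def)

definition lmod :: "'a set \<Rightarrow> bool" where
  "lmod S \<longleftrightarrow> add_subgroup S \<and> (\<forall>v\<in>V. \<forall>s\<in>S. v * s \<in> S)"

text \<open>
  This says that \<open>S X\<^sup>q\<close> is a right \<open>V\<close>-module.
\<close>

definition rmod :: "rat \<Rightarrow> 'a set \<Rightarrow> bool" where
  "rmod q S \<longleftrightarrow> add_subgroup S \<and> (\<forall>v\<in>V. \<forall>s\<in>S. s * \<sigma> q v \<in> S)"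

lemma lmod_B: "lmod (B q)"
  using B_props(1)[of q] B_props(2)[of _ 0 _ q] by (auto simp: lmod_def B0)

lemma rmod_B: "rmod q (B q)"
  using B_props(1)[of q] B_props(2)[of _ q _ 0] by (auto simp: rmod_def B0)

lemma lmod_0: "lmod S \<Longrightarrow> 0 \<in> S" and rmod_0: "rmod q S \<Longrightarrow> 0 \<in> S"
  by (simp_all add: lmod_def rmod_def add_subgroup_props)

text \<open>
  In \<open>a \<sigma>(b) - c \<sigma>(d)\<close> one of \<open>b\<close>, \<open>d\<close> is a left multiple of the other, say \<open>b = v d\<close>, and
  \<open>\<sigma>(v)\<close> can be moved to the factor \<open>a\<close>.
\<close>

lemma set_prod_eq:
  assumes S: "rmod p S" and T: "lmod T"
  shows "S \<odot> \<sigma> p ` T = {a * \<sigma> p b | a b. a \<in> S \<and> b \<in> T}" (is "_ = ?R")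
proof
  have sS: "add_subgroup S" and sT: "add_subgroup T" using S T by (auto simp: rmod_def lmod_def)
  show "?R \<subseteq> S \<odot> \<sigma> p ` T" unfolding set_prod_def by (auto intro: group_closure.base)
  show "S \<odot> \<sigma> p ` T \<subseteq> ?R"
  proof
    fix x assume "x \<in> S \<odot> \<sigma> p ` T"
    then show "x \<in> ?R" unfolding set_prod_def
    proof (induction rule: group_closure.induct)
      case (base s)
      moreover have "0 = 0 * \<sigma> p 0" by simp
      ultimately show ?case using add_subgroup_props(1)[OF sS] add_subgroup_props(1)[OF sT] by blast
    next
      case (diff x y)
      then obtain a b c d where x: "x = a * \<sigma> p b" "a \<in> S" "b \<in> T" and y: "y = c * \<sigma> p d" "c \<in> S" "d \<in> T"
        by blast
      obtain v where v: "v \<in> V" "b = v * d \<or> d = v * b" using valuation_chain[OF tvr] by blast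
      from v(2) show ?case
      proof
        assume "b = v * d"
        then have "x - y = (a * \<sigma> p v - c) * \<sigma> p d" by (simp add: x y algebra_simps)
        moreover have "a * \<sigma> p v - c \<in> S" using S v(1) x y add_subgroup_props(2)[OF sS] by (simp add: rmod_def)
        ultimately show ?thesis using y by blast
      next
        assume "d = v * b"
        then have "x - y = (a - c * \<sigma> p v) * \<sigma> p b" by (simp add: x y algebra_simps)
        moreover have "a - c * \<sigma> p v \<in> S" using S v(1) x y add_subgroup_props(2)[OF sS] by (simp add: rmod_def)
        ultimately show ?thesis using x by blast
      qed
    qed
  qed
qed

lemma add_subgroup_set_prod: "add_subgroup (S \<odot> T)"
  by (simp add: add_subgroup_def set_prod_def group_closure.diff)

lemma zero_set_prod: "0 \<in> S \<odot> T"
  by (simp add: set_prod_def)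

lemma hset_set_prod:
  assumes "rmod p S" "lmod T"
  shows "hset (p + q) (S \<odot> \<sigma> p ` T) = H.sprod (hset p S) (hset q T)"
proof -
  have "x \<in> hset (p + q) (S \<odot> \<sigma> p ` T) \<longleftrightarrow> x \<in> H.sprod (hset p S) (hset q T)" for x
  proof
    assume "x \<in> hset (p + q) (S \<odot> \<sigma> p ` T)"
    then obtain a b where x: "x = mon (p + q) (a * \<sigma> p b)" "a * \<sigma> p b \<noteq> 0" "a \<in> S" "b \<in> T"
      unfolding set_prod_eq[OF assms] hset_def by blast
    then have nonzero: "a \<noteq> 0" "b \<noteq> 0" by auto
    then have "x = hmult (mon p a) (mon q b)" by (simp add: x(1) hmult_mon)
    moreover have "mon p a \<in> hset p S" "mon q b \<in> hset q T" using nonzero x by (simp_all add: mem_hset)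
    ultimately show "x \<in> H.sprod (hset p S) (hset q T)" by (simp add: H.sprodI)
  next
    assume "x \<in> H.sprod (hset p S) (hset q T)"
    then obtain a b where x: "x = hmult (mon p a) (mon q b)" "a \<in> S" "b \<in> T" "a \<noteq> 0" "b \<noteq> 0"
      by (auto simp: hset_def elim!: H.sprodE)
    then have "x = mon (p + q) (a * \<sigma> p b)" "a * \<sigma> p b \<noteq> 0" by (simp_all add: hmult_mon)
    then show "x \<in> hset (p + q) (S \<odot> \<sigma> p ` T)"
      unfolding set_prod_eq[OF assms] hset_def using x(2,3) by blast
  qed
  then show ?thesis by blast
qed

lemma rmod_set_prod:
  assumes "rmod p S" "lmod T" "rmod q T" shows "rmod (p + q) (S \<odot> \<sigma> p ` T)"
proof -
  have "a * \<sigma> p b * \<sigma> (p + q) v \<in> S \<odot> \<sigma> p ` T" if "v \<in> V" "a \<in> S" "b \<in> T" for v a b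
  proof -
    have "a * \<sigma> p b * \<sigma> (p + q) v = a * \<sigma> p (b * \<sigma> q v)" by (simp add: mult.assoc)
    moreover have "b * \<sigma> q v \<in> T" using assms(3) that by (simp add: rmod_def)
    ultimately show ?thesis unfolding set_prod_eq[OF assms(1,2)] using that by blast
  qed
  then have "\<forall>v\<in>V. \<forall>s\<in>S \<odot> \<sigma> p ` T. s * \<sigma> (p + q) v \<in> S \<odot> \<sigma> p ` T"
    using set_prod_eq[OF assms(1,2)] by (smt (verit) mem_Collect_eq)
  then show ?thesis by (simp add: rmod_def add_subgroup_set_prod)
qed

lemma hset_set_right: "a \<noteq> 0 \<Longrightarrow> hset q (W \<bullet>> a) = H.sprod (hset 0 W) {mon q a}"
proof -
  assume a: "a \<noteq> 0"
  have "x \<in> hset q (W \<bullet>> a) \<longleftrightarrow> x \<in> H.sprod (hset 0 W) {mon q a}" for x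
  proof (rule mon_cases[of x])
    fix p b assume b: "x = mon p b" "b \<noteq> 0"
    have "b \<in> W \<bullet>> a \<longleftrightarrow> b * inverse a \<in> W"
    proof
      assume "b \<in> W \<bullet>> a"
      then show "b * inverse a \<in> W" using a by (auto simp: set_right_def mult.assoc)
    next
      assume "b * inverse a \<in> W"
      moreover have "b = b * inverse a * a" using a by (simp add: mult.assoc)
      ultimately show "b \<in> W \<bullet>> a" unfolding set_right_def by blast
    qed
    then show ?thesis using a b
      by (auto simp: H.mem_translate hinv_mon hmult_mon mem_hset simp flip: \<sigma>_props(4))
  qed
  then show ?thesis by blast
qed

lemma hset_set_left: "a \<noteq> 0 \<Longrightarrow> hset q (a <\<bullet> (\<sigma> q ` W)) = H.sprod {mon q a} (hset 0 W)"
proof -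
  assume a: "a \<noteq> 0"
  have "x \<in> hset q (a <\<bullet> (\<sigma> q ` W)) \<longleftrightarrow> x \<in> H.sprod {mon q a} (hset 0 W)" for x
  proof (rule mon_cases[of x])
    fix p b assume b: "x = mon p b" "b \<noteq> 0"
    have "b \<in> a <\<bullet> (\<sigma> q ` W) \<longleftrightarrow> \<sigma> (- q) (inverse a) * \<sigma> (- q) b \<in> W"
    proof
      assume "b \<in> a <\<bullet> (\<sigma> q ` W)"
      then obtain w where w: "w \<in> W" "b = a * \<sigma> q w" unfolding set_left_def by blast
      have "\<sigma> (- q) (inverse a) * \<sigma> (- q) b = \<sigma> (- q) (inverse a * b)" by (simp only: \<sigma>_props)
      also have "inverse a * b = \<sigma> q w" using a w(2) by (simp flip: mult.assoc)
      finally show "\<sigma> (- q) (inverse a) * \<sigma> (- q) b \<in> W" using w(1) by simp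
    next
      assume c: "\<sigma> (- q) (inverse a) * \<sigma> (- q) b \<in> W"
      have "\<sigma> q (\<sigma> (- q) (inverse a) * \<sigma> (- q) b) = inverse a * b" by simp
      then have "b = a * \<sigma> q (\<sigma> (- q) (inverse a) * \<sigma> (- q) b)" using a by (simp flip: mult.assoc)
      then show "b \<in> a <\<bullet> (\<sigma> q ` W)" using c unfolding set_left_def by blast
    qed
    then show ?thesis using a b
      by (auto simp: H.mem_translate hinv_mon hmult_mon mem_hset)
  qed
  then show ?thesis by blast
qed

lemma hset_O_l: "hset 0 (O_l S) = H.OL (hset q S)"
proof -
  have "x \<in> hset 0 (O_l S) \<longleftrightarrow> x \<in> H.OL (hset q S)" for x
  proof (rule mon_cases[of x])
    fix p a assume x: "x = mon p a" "a \<noteq> 0"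
    have "a \<in> O_l S \<longleftrightarrow> (\<forall>s\<in>S. s \<noteq> 0 \<longrightarrow> a * s \<in> S)"
    proof -
      have "a * s \<in> S" if "\<forall>s\<in>S. s \<noteq> 0 \<longrightarrow> a * s \<in> S" "s \<in> S" for s using that by (cases "s = 0") auto
      then show ?thesis by (auto simp: O_l_def set_left_def)
    qed
    moreover have "mon 0 a \<in> H.OL (hset q S) \<longleftrightarrow> (\<forall>s\<in>S. s \<noteq> 0 \<longrightarrow> mon q (a * s) \<in> hset q S)"
    proof -
      have "(\<forall>s\<in>hset q S. R s) \<longleftrightarrow> (\<forall>s\<in>S. s \<noteq> 0 \<longrightarrow> R (mon q s))" for R
        unfolding hset_def by blast
      from this[of "\<lambda>s. hmult (mon 0 a) s \<in> hset q S"] show ?thesis using x(2) by (auto simp: H.OL_def hmult_mon)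
    qed
    ultimately show ?thesis using x by (auto simp: mem_hset H.OL_def)
  qed
  then show ?thesis by blast
qed

lemma mem_O_l: "a \<in> O_l S \<longleftrightarrow> (\<forall>s\<in>S. a * s \<in> S)"
  by (auto simp: O_l_def set_left_def)

lemma O_l_valuation_ring:
  assumes "lmod S" shows "total_valuation_ring (O_l S)"
proof -
  have S: "add_subgroup S" "\<And>v s. v \<in> V \<Longrightarrow> s \<in> S \<Longrightarrow> v * s \<in> S" using assms by (auto simp: lmod_def)
  have V: "V \<subseteq> O_l S" using S(2) by (auto simp: O_l_def set_left_def)
  have "add_subgroup (O_l S)" using add_subgroup_props[OF S(1)]
    by (simp add: add_subgroup_def mem_O_l left_diff_distrib)
  moreover have "a * b \<in> O_l S" if "a \<in> O_l S" "b \<in> O_l S" for a b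
    using that by (simp add: mem_O_l mult.assoc)
  ultimately show ?thesis using tvr V by (auto simp: total_valuation_ring_def)
qed

lemma hset_jacobson_radical:
  assumes "total_valuation_ring W" shows "hset 0 (jacobson_radical W) = H.Jac (hset 0 W)"
proof -
  have "x \<in> hset 0 (jacobson_radical W) \<longleftrightarrow> x \<in> H.Jac (hset 0 W)" for x
    by (rule mon_cases[of x])
      (auto simp: jacobson_radical_valuation_ring[OF assms] H.Jac_def mem_hset hinv_mon)
  then show ?thesis by blast
qed

lemma zero_jacobson_radical: "total_valuation_ring W \<Longrightarrow> 0 \<in> jacobson_radical W"
  by (simp add: jacobson_radical_valuation_ring) (simp add: total_valuation_ring_def add_subgroup_def)

lemma zero_O_l: "0 \<in> S \<Longrightarrow> 0 \<in> O_l S"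
  by (auto simp: O_l_def set_left_def)

lemma zero_set_right: "0 \<in> W \<Longrightarrow> 0 \<in> W \<bullet>> a" and zero_set_left: "0 \<in> W \<Longrightarrow> 0 \<in> a <\<bullet> (\<sigma> q ` W)"
  by (force simp: set_right_def set_left_def)+

lemma zero_star: "0 \<in> S \<Longrightarrow> 0 \<in> star S"
  by (auto simp: star_def intro: zero_set_right zero_O_l)

text \<open>
  For \<open>S = {0}\<close> the closure is taken over the generator \<open>0\<close>, which has no counterpart in the group;
  otherwise no translate containing \<open>S\<close> has generator \<open>0\<close>.
\<close>

lemma hset_star:
  assumes "0 \<in> S" shows "hset q (star S) = H.star (hset q S)"
proof (cases "S = {0}")
  case True
  have "star S \<subseteq> O_l S \<bullet>> 0" using True unfolding star_def
    by (intro Inter_lower CollectI exI[of _ 0]) (simp add: zero_set_right zero_O_l)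
  then have "star S \<subseteq> {0}" by (auto simp: set_right_def)
  then show ?thesis using True by (auto simp: hset_def H.star_def)
next
  case False
  then obtain s where s: "s \<in> S" "s \<noteq> 0" using assms by blast
  have OL: "H.OL (hset q S) = hset 0 (O_l S)" by (rule hset_O_l[symmetric])
  have "x \<in> hset q (star S) \<longleftrightarrow> x \<in> H.star (hset q S)" for x
  proof (rule mon_cases[of x])
    fix p a assume x: "x = mon p a" "a \<noteq> 0"
    have "mon q s \<in> hset q S" using s by (simp add: mem_hset)
    moreover have "fst t = q" if "t \<in> hset q S" for t using that by (auto simp: hset_def)
    ultimately have 1: "(\<exists>t\<in>hset q S. fst x = fst t) \<longleftrightarrow> p = q" unfolding x(1) fst_mon by (metis fst_mon)
    have 2: "a \<in> star S \<longleftrightarrow> (\<forall>c. c \<noteq> 0 \<longrightarrow> S \<subseteq> O_l S \<bullet>> c \<longrightarrow> a \<in> O_l S \<bullet>> c)"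
    proof -
      have "c \<noteq> 0" if "S \<subseteq> O_l S \<bullet>> c" for c using s that by (auto simp: set_right_def)
      then show ?thesis by (auto simp: star_def)
    qed
    have 3: "(\<forall>z. hset q S \<subseteq> H.sprod (H.OL (hset q S)) {z} \<longrightarrow> mon q a \<in> H.sprod (H.OL (hset q S)) {z}) \<longleftrightarrow>
      (\<forall>c. c \<noteq> 0 \<longrightarrow> S \<subseteq> O_l S \<bullet>> c \<longrightarrow> a \<in> O_l S \<bullet>> c)" (is "?L \<longleftrightarrow> ?R")
    proof -
      have eq: "hset q S \<subseteq> H.sprod (H.OL (hset q S)) {mon q c} \<longleftrightarrow> S \<subseteq> O_l S \<bullet>> c"
        "mon q a \<in> H.sprod (H.OL (hset q S)) {mon q c} \<longleftrightarrow> a \<in> O_l S \<bullet>> c" if "c \<noteq> 0" for c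
        unfolding OL hset_set_right[OF that, symmetric]
        using hset_subset[OF zero_set_right[OF zero_O_l[OF assms]]] x(2) by (simp_all add: mem_hset)
      have deg: "r = q" if "hset q S \<subseteq> H.sprod (H.OL (hset q S)) {mon r c}" for r c
      proof -
        have "mon q s \<in> hset q S" using s by (simp add: mem_hset)
        then have "hmult (mon q s) (hinv (mon r c)) \<in> H.OL (hset q S)" using that by auto
        then show ?thesis by (simp add: H.OL_def)
      qed
      show ?thesis
      proof
        assume ?L
        then show ?R using eq by metis
      next
        assume R: ?R
        show ?L
        proof (intro allI impI)
          fix z assume z: "hset q S \<subseteq> H.sprod (H.OL (hset q S)) {z}"
          obtain r c where rc: "z = mon r c" "c \<noteq> 0" by (rule mon_cases)
          then have zq: "z = mon q c" using deg z by blast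
          show "mon q a \<in> H.sprod (H.OL (hset q S)) {z}"
            using z R rc(2) eq[OF rc(2)] unfolding zq by blast
        qed
      qed
    qed
    have "x \<in> hset q (star S) \<longleftrightarrow> p = q \<and> a \<in> star S" unfolding x(1) by (rule mem_hset[OF x(2)])
    also have "\<dots> \<longleftrightarrow> p = q \<and>
        (\<forall>z. hset q S \<subseteq> H.sprod (H.OL (hset q S)) {z} \<longrightarrow> x \<in> H.sprod (H.OL (hset q S)) {z})"
      unfolding 2 3[symmetric] x(1) by (rule conj_cong[OF refl]) (simp only:)
    also have "\<dots> \<longleftrightarrow> x \<in> H.star (hset q S)" unfolding H.star_def mem_Collect_eq 1 ..
    finally show ?thesis .
  qed
  then show ?thesis by blast
qed

lemma iter_prod_props:
  "rmod (of_nat (Suc i) * g) (iter_prod \<sigma> B g (Suc i)) \<and>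
   hset (of_nat (Suc i) * g) (iter_prod \<sigma> B g (Suc i)) = H.spow (hset g (B g)) (Suc i)"
proof (induction i)
  case 0
  then show ?case using rmod_B by simp
next
  case (Suc i)
  have s: "of_nat (Suc (Suc i)) * g = of_nat (Suc i) * g + g" by (simp add: ring_distribs)
  show ?case unfolding s iter_prod.simps(3)
  proof (rule conjI)
    show "rmod (of_nat (Suc i) * g + g) (iter_prod \<sigma> B g (Suc i) \<odot> \<sigma> (of_nat (Suc i) * g) ` B g)"
      by (rule rmod_set_prod[OF conjunct1[OF Suc] lmod_B rmod_B])
    show "hset (of_nat (Suc i) * g + g) (iter_prod \<sigma> B g (Suc i) \<odot> \<sigma> (of_nat (Suc i) * g) ` B g) =
        H.spow (hset g (B g)) (Suc (Suc i))"
      unfolding hset_set_prod[OF conjunct1[OF Suc] lmod_B] conjunct2[OF Suc] H.spow.simps(2)[of _ "Suc i"] ..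
  qed
qed


lemma graded_extension_cyclic: "graded_extension V (multiples g) \<sigma> B"
  by (rule graded_extension_multiples[OF aut ext])

lemma zero_B: "0 \<in> B q"
  using lmod_B lmod_0 by blast

lemma zero_W: "0 \<in> O_l (B q)"
  by (rule zero_O_l[OF zero_B])

lemma zero_V: "0 \<in> V"
  using zero_B[of 0] by (simp add: B0)

lemma W_valuation_ring: "total_valuation_ring (O_l (B q))"
  by (rule O_l_valuation_ring[OF lmod_B])

lemma hset_W: "hset 0 (O_l (B q)) = H.OL (H.A q)"
  by (simp add: A_hset hset_O_l)

lemma hset_J: "hset 0 (jacobson_radical (O_l (B q))) = H.Jac (H.OL (H.A q))"
  by (simp add: hset_jacobson_radical[OF W_valuation_ring] hset_W)

lemma zero_J: "0 \<in> jacobson_radical (O_l (B q))"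
  by (rule zero_jacobson_radical[OF W_valuation_ring])

lemma hset_V: "hset 0 V = H.A 0"
  by (simp add: A_hset B0)

lemma principal_iff:
  assumes "a \<noteq> 0"
  shows "B q = O_l (B q) \<bullet>> a \<longleftrightarrow> H.A q = H.sprod (H.OL (H.A q)) {mon q a}"
  unfolding hset_W[symmetric] hset_set_right[OF assms, symmetric] unfolding A_hset[of q]
  by (rule hset_eq[OF zero_B zero_set_right[OF zero_W], symmetric])

text \<open>
  The generator lies in the module, since the order contains \<open>1\<close>; this fixes its degree.
\<close>

lemma principal_degree:
  assumes "H.A q = H.sprod (H.OL (H.A q)) {x}" obtains a where "x = mon q a" "a \<noteq> 0"
proof -
  obtain p a where x: "x = mon p a" "a \<noteq> 0" by (rule mon_cases)
  have "x \<in> H.sprod (H.OL (H.A q)) {x}"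
    using H.overring_e[OF H.overring_OL_A] by simp
  then have "x \<in> H.A q" using assms by simp
  then have "fst x = q" by (rule H.A_deg)
  then show thesis using x that by simp
qed

section \<open>Translation of the types\<close>

lemma type_a_iff: "type_a V \<sigma> B g \<longleftrightarrow> H.cone_a g"
proof -
  have 1: "B g = V \<bullet>> a \<longleftrightarrow> H.A g = H.sprod (H.A 0) {mon g a}"
    "V \<bullet>> a = a <\<bullet> (\<sigma> g ` V) \<longleftrightarrow> H.sprod (H.A 0) {mon g a} = H.sprod {mon g a} (H.A 0)"
    "B (- g) = V \<bullet>> \<sigma> (- g) (inverse a) \<longleftrightarrow> H.A (- g) = H.sprod (H.A 0) {hinv (mon g a)}"
    if a: "a \<noteq> 0" for a
  proof -
    have b: "\<sigma> (- g) (inverse a) \<noteq> 0" using a by simp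
    show "B g = V \<bullet>> a \<longleftrightarrow> H.A g = H.sprod (H.A 0) {mon g a}"
      unfolding hset_V[symmetric] hset_set_right[OF a, symmetric] unfolding A_hset[of g] hset_set_right[OF a, symmetric]
      by (rule hset_eq[OF zero_B zero_set_right[OF zero_V], symmetric])
    show "V \<bullet>> a = a <\<bullet> (\<sigma> g ` V) \<longleftrightarrow> H.sprod (H.A 0) {mon g a} = H.sprod {mon g a} (H.A 0)"
      unfolding hset_V[symmetric] hset_set_right[OF a, symmetric] hset_set_left[OF a, symmetric]
      by (rule hset_eq[OF zero_set_right[OF zero_V] zero_set_left[OF zero_V], symmetric])
    show "B (- g) = V \<bullet>> \<sigma> (- g) (inverse a) \<longleftrightarrow> H.A (- g) = H.sprod (H.A 0) {hinv (mon g a)}"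
      unfolding hset_V[symmetric] A_hset[of "- g"] hinv_mon[OF a] hset_set_right[OF b, symmetric]
      by (rule hset_eq[OF zero_B zero_set_right[OF zero_V], symmetric])
  qed
  show ?thesis
  proof
    assume "type_a V \<sigma> B g"
    then obtain a where a: "a \<noteq> 0" "B g = V \<bullet>> a" "V \<bullet>> a = a <\<bullet> (\<sigma> g ` V)" "B (- g) = V \<bullet>> \<sigma> (- g) (inverse a)"
      unfolding type_a_def by blast
    show "H.cone_a g" unfolding H.cone_a_def
      using a(2-4) unfolding 1[OF a(1)] by (intro exI[of _ "mon g a"]) simp
  next
    assume "H.cone_a g"
    then obtain x where x: "fst x = g" "H.A g = H.sprod (H.A 0) {x}" "H.sprod (H.A 0) {x} = H.sprod {x} (H.A 0)"
        "H.A (- g) = H.sprod (H.A 0) {hinv x}" unfolding H.cone_a_def by blast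
    obtain p a where "x = mon p a" and a: "a \<noteq> 0" by (rule mon_cases)
    then have xg: "x = mon g a" using x(1) by simp
    show "type_a V \<sigma> B g" unfolding type_a_def
      using graded_extension_cyclic a x(2-4)[unfolded xg, folded 1[OF a]] by blast
  qed
qed

lemma translate_psubset:
  assumes "a \<noteq> 0"
  shows "a <\<bullet> (\<sigma> q ` O_l (B q)) \<subset> O_l (B q) \<bullet>> a \<longleftrightarrow>
      H.sprod {mon q a} (H.OL (H.A q)) \<subset> H.sprod (H.OL (H.A q)) {mon q a}"
    "O_l (B q) \<bullet>> a \<subset> a <\<bullet> (\<sigma> q ` O_l (B q)) \<longleftrightarrow>
      H.sprod (H.OL (H.A q)) {mon q a} \<subset> H.sprod {mon q a} (H.OL (H.A q))"
    "O_l (B q) \<bullet>> a = a <\<bullet> (\<sigma> q ` O_l (B q)) \<longleftrightarrow>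
      H.sprod (H.OL (H.A q)) {mon q a} = H.sprod {mon q a} (H.OL (H.A q))"
proof -
  note z = zero_set_right[OF zero_W, of q a] zero_set_left[OF zero_W, of a q q]
  note h = hset_set_right[OF assms, of q "O_l (B q)"] hset_set_left[OF assms, of q "O_l (B q)"]
  note s = hset_subset[OF z(1), of q "a <\<bullet> (\<sigma> q ` O_l (B q))"] hset_subset[OF z(2), of q "O_l (B q) \<bullet>> a"]
  show "a <\<bullet> (\<sigma> q ` O_l (B q)) \<subset> O_l (B q) \<bullet>> a \<longleftrightarrow>
      H.sprod {mon q a} (H.OL (H.A q)) \<subset> H.sprod (H.OL (H.A q)) {mon q a}"
    "O_l (B q) \<bullet>> a \<subset> a <\<bullet> (\<sigma> q ` O_l (B q)) \<longleftrightarrow>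
      H.sprod (H.OL (H.A q)) {mon q a} \<subset> H.sprod {mon q a} (H.OL (H.A q))"
    "O_l (B q) \<bullet>> a = a <\<bullet> (\<sigma> q ` O_l (B q)) \<longleftrightarrow>
      H.sprod (H.OL (H.A q)) {mon q a} = H.sprod {mon q a} (H.OL (H.A q))"
    using s unfolding h hset_W by (auto simp only: less_le_not_le set_eq_subset)
qed

lemma type_b_iff: "type_b V \<sigma> B g \<longleftrightarrow> H.cone_b g"
proof
  assume "type_b V \<sigma> B g"
  then obtain a where a: "B g = O_l (B g) \<bullet>> a" "a <\<bullet> (\<sigma> g ` O_l (B g)) \<subset> O_l (B g) \<bullet>> a"
    unfolding type_b_def Let_def by blast
  have nonzero: "a \<noteq> 0" using a(2) zero_W[of g] by (auto simp: set_left_def set_right_def)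
  show "H.cone_b g" unfolding H.cone_b_def
    using principal_iff[OF nonzero, THEN iffD1, OF a(1)] translate_psubset(1)[OF nonzero, THEN iffD1, OF a(2)] by blast
next
  assume "H.cone_b g"
  then obtain x where x: "H.A g = H.sprod (H.OL (H.A g)) {x}"
      "H.sprod {x} (H.OL (H.A g)) \<subset> H.sprod (H.OL (H.A g)) {x}" unfolding H.cone_b_def by blast
  obtain a where a: "x = mon g a" "a \<noteq> 0" by (rule principal_degree[OF x(1)])
  show "type_b V \<sigma> B g" unfolding type_b_def Let_def
    using graded_extension_cyclic x[unfolded a(1), folded principal_iff[OF a(2)] translate_psubset[OF a(2)]] by blast
qed

lemma type_c_iff: "type_c V \<sigma> B g \<longleftrightarrow> H.cone_c g"
proof
  assume "type_c V \<sigma> B g"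
  then obtain a where a: "B g = O_l (B g) \<bullet>> a" "O_l (B g) \<bullet>> a \<subset> a <\<bullet> (\<sigma> g ` O_l (B g))"
    unfolding type_c_def Let_def by blast
  have nonzero: "a \<noteq> 0" using a(2) zero_W[of g] by (auto simp: set_left_def set_right_def)
  show "H.cone_c g" unfolding H.cone_c_def
    using principal_iff[OF nonzero, THEN iffD1, OF a(1)] translate_psubset(2)[OF nonzero, THEN iffD1, OF a(2)] by blast
next
  assume "H.cone_c g"
  then obtain x where x: "H.A g = H.sprod (H.OL (H.A g)) {x}"
      "H.sprod (H.OL (H.A g)) {x} \<subset> H.sprod {x} (H.OL (H.A g))" unfolding H.cone_c_def by blast
  obtain a where a: "x = mon g a" "a \<noteq> 0" by (rule principal_degree[OF x(1)])
  show "type_c V \<sigma> B g" unfolding type_c_def Let_def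
    using graded_extension_cyclic x[unfolded a(1), folded principal_iff[OF a(2)] translate_psubset[OF a(2)]] by blast
qed

text \<open>
  The product is an instance of \<open>hset_set_prod\<close> in degree zero, where \<open>\<sigma>\<close> acts trivially.
\<close>

lemma jacobson_idem_iff:
  "jacobson_radical (O_l (B g)) \<odot> jacobson_radical (O_l (B g)) = jacobson_radical (O_l (B g)) \<longleftrightarrow>
   H.sprod (H.Jac (H.OL (H.A g))) (H.Jac (H.OL (H.A g))) = H.Jac (H.OL (H.A g))"
proof -
  let ?W = "O_l (B g)" and ?J = "jacobson_radical (O_l (B g))"
  have W: "total_valuation_ring ?W" by (rule W_valuation_ring)
  have VW: "v \<in> ?W" if "v \<in> V" for v using lmod_B[of g] that by (simp add: mem_O_l lmod_def)
  have J: "?J = {w \<in> ?W. w = 0 \<or> inverse w \<notin> ?W}" by (rule jacobson_radical_valuation_ring[OF W])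
  have mult: "a * b \<in> ?W" if "a \<in> ?W" "b \<in> ?W" for a b using that by (simp add: mem_O_l mult.assoc)
  have lr: "v * j \<in> ?J \<and> j * v \<in> ?J" if v: "v \<in> V" and j: "j \<in> ?J" for v j
  proof (cases "v * j = 0 \<or> j * v = 0")
    case True
    then have z: "v * j = 0" "j * v = 0" by auto
    show ?thesis unfolding z using zero_J by blast
  next
    case False
    then have nonzero: "v \<noteq> 0" "j \<noteq> 0" by auto
    have e1: "inverse (v * j) * v = inverse j"
      using nonzero by (simp add: nonzero_inverse_mult_distrib mult.assoc)
    have e2: "v * inverse (j * v) = inverse j"
      using nonzero by (simp add: nonzero_inverse_mult_distrib flip: mult.assoc)
    have nj: "inverse j \<notin> ?W" "j \<in> ?W" using j nonzero(2) unfolding J by blast+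
    have "inverse (v * j) \<notin> ?W" using mult[OF _ VW[OF v]] nj(1) e1 by metis
    moreover have "inverse (j * v) \<notin> ?W" using mult[OF VW[OF v]] nj(1) e2 by metis
    ultimately show ?thesis using mult[OF VW[OF v] nj(2)] mult[OF nj(2) VW[OF v]] unfolding J by blast
  qed
  have sub: "add_subgroup ?J"
  proof -
    have "a - b \<in> ?J" if ab: "a \<in> ?J" "b \<in> ?J" for a b
    proof -
      obtain v where v: "v \<in> V" "a = v * b \<or> b = v * a" using valuation_chain[OF tvr] by blast
      have "v - 1 \<in> V" "1 - v \<in> V" using v(1) V_props(2) add_subgroup_props(2)[OF V_props(1)] by auto
      then show ?thesis using lr[of "v - 1" b] lr[of "1 - v" a] ab v(2) by (auto simp: algebra_simps)
    qed
    then show ?thesis using zero_J by (auto simp: add_subgroup_def)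
  qed
  have m: "rmod 0 ?J" "lmod ?J" using sub lr by (auto simp: rmod_def lmod_def)
  have "\<sigma> 0 ` ?J = ?J" by simp
  then have "hset 0 (?J \<odot> ?J) = H.sprod (hset 0 ?J) (hset 0 ?J)" using hset_set_prod[OF m, of 0] by simp
  then show ?thesis unfolding hset_J[symmetric] using hset_eq[OF zero_set_prod zero_J, of 0 ?J ?J g] by simp
qed

lemma type_d_iff: "type_d V \<sigma> B g \<longleftrightarrow> H.cone_d g"
proof -
  have 1: "B (- g) = jacobson_radical (O_l (B g)) \<bullet>> \<sigma> (- g) (inverse a) \<longleftrightarrow>
      H.A (- g) = H.sprod (H.Jac (H.OL (H.A g))) {hinv (mon g a)}" if "a \<noteq> 0" for a
  proof -
    have b: "\<sigma> (- g) (inverse a) \<noteq> 0" using that by simp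
    show ?thesis
      unfolding hset_J[symmetric] A_hset[of "- g"] hinv_mon[OF that] hset_set_right[OF b, symmetric]
      by (rule hset_eq[OF zero_B zero_set_right[OF zero_J], symmetric])
  qed
  show ?thesis
  proof
    assume "type_d V \<sigma> B g"
    then obtain a where a: "a \<noteq> 0" and *: "B g = O_l (B g) \<bullet>> a" "O_l (B g) \<bullet>> a = a <\<bullet> (\<sigma> g ` O_l (B g))"
        "B (- g) = jacobson_radical (O_l (B g)) \<bullet>> \<sigma> (- g) (inverse a)"
        "jacobson_radical (O_l (B g)) \<odot> jacobson_radical (O_l (B g)) = jacobson_radical (O_l (B g))"
      unfolding type_d_def Let_def by blast
    show "H.cone_d g" unfolding H.cone_d_def
      using principal_iff[OF a, THEN iffD1, OF *(1)] translate_psubset(3)[OF a, THEN iffD1, OF *(2)]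
        1[OF a, THEN iffD1, OF *(3)] jacobson_idem_iff[THEN iffD1, OF *(4)] by blast
  next
    assume "H.cone_d g"
    then obtain x where x: "H.A g = H.sprod (H.OL (H.A g)) {x}"
      "H.sprod (H.OL (H.A g)) {x} = H.sprod {x} (H.OL (H.A g))"
      "H.A (- g) = H.sprod (H.Jac (H.OL (H.A g))) {hinv x}"
      and J: "H.sprod (H.Jac (H.OL (H.A g))) (H.Jac (H.OL (H.A g))) = H.Jac (H.OL (H.A g))" unfolding H.cone_d_def by blast
    obtain a where a: "x = mon g a" "a \<noteq> 0" by (rule principal_degree[OF x(1)])
    show "type_d V \<sigma> B g" unfolding type_d_def Let_def
      using graded_extension_cyclic a(2) x[unfolded a(1), folded principal_iff[OF a(2)] translate_psubset[OF a(2)] 1[OF a(2)]]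
        jacobson_idem_iff[THEN iffD2, OF J] by blast
  qed
qed

lemma type_f_iff: "type_f V \<sigma> B g \<longleftrightarrow> H.cone_f g"
  unfolding type_f_def H.cone_f_def A_hset hset_star[OF zero_B, symmetric]
  using graded_extension_cyclic hset_subset[OF zero_star[OF zero_B], of g "B g"] hset_subset[OF zero_B, of g "star (B g)"]
  by (auto simp only: less_le_not_le)

lemma type_g_iff: "type_g V \<sigma> B g \<longleftrightarrow> H.cone_g g"
proof -
  have 1: "star (B g) = B g \<longleftrightarrow> H.star (H.A g) = H.A g"
    unfolding A_hset hset_star[OF zero_B, symmetric] by (simp add: hset_eq zero_star zero_B)
  have 2: "principal_left_ideal (O_l (B g)) (star (iter_prod \<sigma> B g i)) \<longleftrightarrow>
      (\<exists>c. H.star (H.spow (H.A g) i) = H.sprod (H.OL (H.A g)) {c})" if i: "1 \<le> i" for i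
  proof -
    obtain k where k: "i = Suc k" using i by (cases i) auto
    let ?S = "iter_prod \<sigma> B g i" and ?q = "of_nat i * g"
    have r: "rmod ?q ?S" "hset ?q ?S = H.spow (H.A g) i"
      using iter_prod_props[of k g] unfolding k A_hset by blast+
    have z: "0 \<in> ?S" using rmod_0[OF r(1)] .
    have st: "H.star (H.spow (H.A g) i) = hset ?q (star ?S)" using hset_star[OF z, of ?q] r(2) by simp
    have eq: "star ?S = O_l (B g) \<bullet>> c \<longleftrightarrow> H.star (H.spow (H.A g) i) = H.sprod (H.OL (H.A g)) {mon ?q c}"
      if "c \<noteq> 0" for c
      unfolding st hset_W[symmetric] hset_set_right[OF that, symmetric]
      using hset_eq[OF zero_star[OF z] zero_set_right[OF zero_W], of ?q g c] by simp
    show ?thesis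
    proof
      assume "principal_left_ideal (O_l (B g)) (star ?S)"
      then obtain c where "c \<noteq> 0" "star ?S = O_l (B g) \<bullet>> c" unfolding principal_left_ideal_def by blast
      then show "\<exists>c. H.star (H.spow (H.A g) i) = H.sprod (H.OL (H.A g)) {c}" using eq by blast
    next
      assume "\<exists>c. H.star (H.spow (H.A g) i) = H.sprod (H.OL (H.A g)) {c}"
      then obtain x where x: "H.star (H.spow (H.A g) i) = H.sprod (H.OL (H.A g)) {x}" by blast
      obtain p c where c: "x = mon p c" "c \<noteq> 0" by (rule mon_cases)
      have "x \<in> H.sprod (H.OL (H.A g)) {x}" using H.overring_e[OF H.overring_OL_A] by simp
      then have "x \<in> hset ?q (star ?S)" using x st by simp
      then have "p = ?q" using c by (simp add: mem_hset)
      then show "principal_left_ideal (O_l (B g)) (star ?S)"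
        using eq[OF c(2)] x c unfolding principal_left_ideal_def by blast
    qed
  qed
  show ?thesis unfolding type_g_def H.cone_g_def using graded_extension_cyclic 1 2 by blast
qed

lemma type_I_iff: "type_I V UNIV \<sigma> B \<longleftrightarrow> H.cone_I"
proof -
  have "B p \<odot> \<sigma> p ` B q = B (p + q) \<longleftrightarrow> H.sprod (H.A p) (H.A q) = H.A (p + q)" for p q
    unfolding A_hset hset_set_prod[OF rmod_B lmod_B, symmetric]
    by (simp add: hset_eq zero_B zero_set_prod)
  note eq = this[of g h for g h] this[of "- g" "- h" for g h, simplified]
  show ?thesis unfolding type_I_def H.cone_I_def using ext eq by simp
qed

end

theorem theorem3p3:
  fixes V :: "'a::division_ring set"
    and \<sigma> :: "rat \<Rightarrow> 'a \<Rightarrow> 'a"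
    and A :: "rat \<Rightarrow> 'a set"
  assumes "total_valuation_ring V" and "V \<noteq> UNIV"
    and "aut_action \<sigma>"
    and "graded_extension V UNIV \<sigma> A"
  shows "type_I V UNIV \<sigma> A \<longleftrightarrow>
    type_Q type_a V \<sigma> A \<or> type_Q type_b V \<sigma> A \<or> type_Q type_c V \<sigma> A \<or>
    type_Q type_d V \<sigma> A \<or> type_Q type_f V \<sigma> A \<or> type_Q type_g V \<sigma> A"
proof -
  interpret graded_ext V \<sigma> A using assms by unfold_locales
  show ?thesis
    unfolding type_Q_def type_a_iff type_b_iff type_c_iff type_d_iff type_f_iff type_g_iff type_I_iff
    using H.cone_I_iff ext by simp
qed

end
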